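(* Suppose that Assumptions 1 and 3 (listed in the context) hold and that $\lambda<\mu$. Let $\psi(t)=Q(0)+(\lambda-\mu)t$ and $\phi(t)=\psi(t)-\sup_{s\in[0,t]}(\psi(s)-H(0,s))^+$, $t\ge0$. Let $\bar T=\inf\{t\ge0:\phi(t)=0\}$ and define $$\bar\phi(t)=\begin{cases}\phi(t)&\text{if } t\le\bar T,\\ 0&\text{otherwise.}\end{cases}$$ Then $\frac1NQ^N\Rightarrow\bar\phi$ as $N\to\infty$.
   Context: Notation. $\mathbb R_+=[0,\infty)$, $x^+=x\vee 0$, $\mathbb I_A$ is the indicator of $A$. $\mathcal M$ is the space of finite nonnegative Borel measures on $\mathbb R_+$ with the weak topology. $D_{\mathcal S}(\mathbb R_+)$ is the space of right-continuous functions with left limits (RCLL) $\mathbb R_+\to\mathcal S$ with the Skorohod $J_1$ topology; processes are viewed as random elements of such spaces, and $\Rightarrow$ is convergence in distribution. All random variables live on a common probability space. Model. For each $N\in\mathbb N$ there is a single server with an infinite buffer. Parameters $\lambda^N,\mu^N>0$ are given. The arrival process is $E^N(t)=E^0(\lambda^Nt)$, where $E^0$ is a renewal process with mean inter-renewal time $1$; $a_i^N$ ($i=1,2,\dots$) is the arrival time of the $i$-th customer. $S^N(t)=S^0(\mu^Nt)$ is the number of jobs completed by the time the server has been busy for $t$ units of time, where $S^0$ is a renewal process with mean inter-renewal time $1$. $X^N(t)$ and $Q^N(t)$ are the numbers of customers at time $t$ in the system and in the queue (not including service). Customers in the system at time $0$ are indexed by $i=-X^N(0)+1,\dots,0$ (with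 arrival times $a^N_i\le0$). Customer $i$ has an initial lead time $u_i^N>0$ and lead time process $L_i^N(t)=u_i^N+a_i^N-t$ (so $L_i^N(t)=L_i^N(0)-t$ for $i\le 0$). The $u_i^N$ of incoming customers are positive i.i.d. with law $\nu^N$ and cumulative distribution function $G^N$. The sequence of initial lead times, the arrival process and the service requirements are mutually independent. An arriving customer starts service immediately if the server is idle, otherwise joins the queue. A customer in the queue reneges (leaves) once his lead time becomes $\le 0$; customers in service do not renege, so customers in the queue have positive lead times. Service is non-idling and non-preemptive; when the server completes a job and the queue is nonempty, it takes the customer in the queue with smallest lead time (non-preemptive earliest-deadline-first). $R^N(t)$ is the number of customers that reneged in $[0,t]$, with $R^N(0)=0$. With $D^N(t)=S^N\big(\int_0^t\mathbb I_{\{X^N(s)>0\}}ds\big)$ the number of service completions by time $t$, $$X^N(t)=X^N(0)+E^N(t)-D^N(t)-R^N(t),\qquad Q^N(t)=(X^N(t)-1)^+ .$$ Queue measure: for Borel $B\subset(0,\infty)$, $\mathcal Q^N_t(B)$ is the number of customers in the queue at time $t$ whose lead time at time $t$ lies in $B$ (extended by zero outside $(0,\infty)$). $F^N(0)$ is the lead time of the customer at the head of the queue (smallest lead time) at time $0$, or $0$ if the queue is empty. Assumption 1. As $N\to\infty$: (i) $\lambda^N/N\to\lambda>0$; (ii) $\mu^N/N\to\mu>0$; (iii) $u_1^N$ converges in distribution to a random variable $u$ with law $\nu$ and cumulative distribution function $G$; $G$ is strictly increasing in $(0,y_{\max})$, where $y_{\max}=\inf\{x:G(x)=1\}$, and $G$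 is continuous at $0$ with $G(0)=0$. Let $y^*=\sup\{y<y_{\max}:\lambda G(y)<\mu\}$. Assumption 3. There is a pair $(\mathcal Q_0,F(0))\in\mathcal M\times[0,y^*]$ such that: (i) $\mathcal Q_0([0,F(0)])=0$ and $G_0(x)=\mathcal Q_0([0,x])$ is a continuous cumulative distribution function; (ii) $\mathcal Q_0([0,x])>0$ for all $x>F(0)$; (iii) $(\frac1N\mathcal Q_0^N,F^N(0))\Rightarrow(\mathcal Q_0,F(0))$ as $N\to\infty$. Set $Q(0)=\mathcal Q_0(\mathbb R_+)$, $\overline G=1-G$, $\overline G_0(x)=\mathcal Q_0((x,\infty))$ and $$H(x,t)=\overline G_0(x+t)+\lambda\int_0^t\overline G(x+t-s)\,ds,\qquad x,t\ge0 .$$ *)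

theory Defs
  imports "HOL-Probability.Probability"
begin

section \<open>Convergence in distribution of random elements of a topological space\<close>

definition borel_of :: "'b topology \<Rightarrow> 'b measure" where
  "borel_of T = sigma (topspace T) {U. openin T U}"

text \<open>Measurability of the prelimits is only demanded for large indices, so that members of the
  sequence on which nothing is assumed (here the index \<open>0\<close>) play no role.\<close>

definition converges_in_distribution ::
  "'a measure \<Rightarrow> 'b topology \<Rightarrow> (nat \<Rightarrow> 'a \<Rightarrow> 'b) \<Rightarrow> ('a \<Rightarrow> 'b) \<Rightarrow> bool" where
  "converges_in_distribution M T Z Y \<longleftrightarrow>
     (\<forall>\<^sub>F n in sequentially. Z n \<in> M \<rightarrow>\<^sub>M borel_of T) \<and>
     Y \<in> M \<rightarrow>\<^sub>M borel_of T \<and>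
     (\<forall>f. continuous_map T euclideanreal f \<and> bounded (f ` topspace T) \<longrightarrow>
        (\<lambda>n. \<integral>\<omega>. f (Z n \<omega>) \<partial>M) \<longlonglongrightarrow> (\<integral>\<omega>. f (Y \<omega>) \<partial>M))"


section \<open>Finite measures on the half-line with the weak topology\<close>

definition nn_borel :: "real measure" where
  "nn_borel = restrict_space borel {0..}"

definition finite_nn_measures :: "real measure set" where
  "finite_nn_measures = {m. sets m = sets nn_borel \<and> finite_measure m}"

definition weak_topology :: "real measure topology" where
  "weak_topology = topology_generated_by
     {{m \<in> finite_nn_measures. (\<integral>x. f x \<partial>m) \<in> U} | f U.
        continuous_on {0..} f \<and> bounded (f ` {0..}) \<and> open (U :: real set)}"


section \<open>RCLL paths with the Skorohod J1 topology\<close>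

text \<open>Paths on the half-line are represented by functions on all reals whose values at negative
  times are irrelevant: no open set distinguishes two paths that agree on \<open>{0..}\<close>.\<close>

definition rcll :: "(real \<Rightarrow> 'b::metric_space) set" where
  "rcll = {x. (\<forall>t\<ge>0. (x \<longlongrightarrow> x t) (at_right t)) \<and> (\<forall>t>0. \<exists>l. (x \<longlongrightarrow> l) (at_left t))}"

text \<open>Such a map is automatically continuous on \<open>{0..}\<close> and fixes \<open>0\<close>.\<close>

definition time_changes :: "(real \<Rightarrow> real) set" where
  "time_changes = {c. strict_mono_on {0..} c \<and> c ` {0..} = {0..}}"

text \<open>The sets \<open>skorohod_nbhd x e\<close> decrease with \<open>e\<close>, and a sequence \<open>y\<^sub>n\<close> is eventually in each of
  them iff there are time changes \<open>c\<^sub>n\<close> such that \<open>c\<^sub>n(s) - s\<close> tends to \<open>0\<close> uniformly on \<open>{0..}\<close> and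
  \<open>y\<^sub>n(c\<^sub>n(s)) - x(s)\<close> tends to \<open>0\<close> uniformly on each \<open>{0..t}\<close>. This is the convergence that
  characterises the (metrizable) J1 topology, see Jacod and Shiryaev, Limit Theorems for
  Stochastic Processes, Theorem VI.1.14.\<close>

definition skorohod_nbhd :: "(real \<Rightarrow> 'b::metric_space) \<Rightarrow> real \<Rightarrow> (real \<Rightarrow> 'b) set" where
  "skorohod_nbhd x e = {y \<in> rcll. \<exists>c\<in>time_changes.
     (\<forall>s\<ge>0. \<bar>c s - s\<bar> < e) \<and> (\<forall>s\<in>{0..1 / e}. dist (y (c s)) (x s) < e)}"

definition skorohod :: "(real \<Rightarrow> 'b::metric_space) topology" where
  "skorohod = topology (\<lambda>U. U \<subseteq> rcll \<and> (\<forall>x\<in>U. \<exists>e>0. skorohod_nbhd x e \<subseteq> U))"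

lemma skorohod_nbhd_mono:
  assumes "0 < d" "d \<le> e"
  shows "skorohod_nbhd x d \<subseteq> skorohod_nbhd x e"
proof
  fix y assume "y \<in> skorohod_nbhd x d"
  then obtain c where c: "y \<in> rcll" "c \<in> time_changes" "\<And>s. 0 \<le> s \<Longrightarrow> \<bar>c s - s\<bar> < d"
    "\<And>s. s \<in> {0..1 / d} \<Longrightarrow> dist (y (c s)) (x s) < d"
    unfolding skorohod_nbhd_def by blast
  have "1 / e \<le> 1 / d"
    using assms by (simp add: frac_le)
  then have "\<bar>c s - s\<bar> < e" if "0 \<le> s" for s
    using c(3)[OF that] assms by linarith
  moreover have "dist (y (c s)) (x s) < e" if "s \<in> {0..1 / e}" for s
  proof -
    have "s \<in> {0..1 / d}" using that \<open>1 / e \<le> 1 / d\<close> by auto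
    from c(4)[OF this] show ?thesis using assms by linarith
  qed
  ultimately show "y \<in> skorohod_nbhd x e"
    unfolding skorohod_nbhd_def using c(1,2) by blast
qed

lemma openin_skorohod:
  "openin skorohod U \<longleftrightarrow> U \<subseteq> rcll \<and> (\<forall>x\<in>U. \<exists>e>0. skorohod_nbhd x e \<subseteq> U)"
proof -
  have "istopology (\<lambda>U :: (real \<Rightarrow> 'a) set. U \<subseteq> rcll \<and> (\<forall>x\<in>U. \<exists>e>0. skorohod_nbhd x e \<subseteq> U))"
    unfolding istopology_def
  proof (intro conjI allI impI ballI)
    fix S T :: "(real \<Rightarrow> 'a) set" and x
    assume S: "S \<subseteq> rcll \<and> (\<forall>x\<in>S. \<exists>e>0. skorohod_nbhd x e \<subseteq> S)"
      and T: "T \<subseteq> rcll \<and> (\<forall>x\<in>T. \<exists>e>0. skorohod_nbhd x e \<subseteq> T)"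
    show "S \<inter> T \<subseteq> rcll" using S by blast
    assume "x \<in> S \<inter> T"
    then obtain d e where "d > 0" "skorohod_nbhd x d \<subseteq> S" "e > 0" "skorohod_nbhd x e \<subseteq> T"
      using S T by blast
    then show "\<exists>e>0. skorohod_nbhd x e \<subseteq> S \<inter> T"
      using skorohod_nbhd_mono[of "min d e" d x] skorohod_nbhd_mono[of "min d e" e x]
      by (intro exI[of _ "min d e"]) auto
  next
    fix K :: "(real \<Rightarrow> 'a) set set" and x
    assume K: "\<forall>S\<in>K. S \<subseteq> rcll \<and> (\<forall>x\<in>S. \<exists>e>0. skorohod_nbhd x e \<subseteq> S)"
    show "\<Union>K \<subseteq> rcll" using K by blast
    assume "x \<in> \<Union>K"
    then obtain S where "S \<in> K" "x \<in> S" by blast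
    then obtain e where "e > 0" "skorohod_nbhd x e \<subseteq> S" using K by blast
    then show "\<exists>e>0. skorohod_nbhd x e \<subseteq> \<Union>K" using \<open>S \<in> K\<close> by blast
  qed
  then show ?thesis
    unfolding skorohod_def by (simp add: topology_inverse')
qed

lemma topspace_skorohod: "topspace skorohod = rcll"
proof (rule antisym)
  show "topspace skorohod \<subseteq> (rcll :: (real \<Rightarrow> 'a) set)"
    using openin_topspace[of skorohod] unfolding openin_skorohod by (rule conjunct1)
  have "\<exists>e>0. skorohod_nbhd x e \<subseteq> rcll" for x :: "real \<Rightarrow> 'a"
    unfolding skorohod_nbhd_def by (rule exI[of _ 1]) auto
  then have "openin skorohod (rcll :: (real \<Rightarrow> 'a) set)"
    unfolding openin_skorohod by simp
  then show "(rcll :: (real \<Rightarrow> 'a) set) \<subseteq> topspace skorohod"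
    by (rule openin_subset)
qed

lemma topspace_weak_topology: "topspace weak_topology = finite_nn_measures"
proof -
  have "finite_nn_measures \<in> {{m \<in> finite_nn_measures. (\<integral>x. f x \<partial>m) \<in> U} | f U.
        continuous_on {0..} f \<and> bounded (f ` {0..}) \<and> open (U :: real set)}"
    by (rule CollectI, rule exI[of _ "\<lambda>_. 0"], rule exI[of _ UNIV]) (auto simp: image_constant_conv)
  then show ?thesis
    unfolding weak_topology_def topology_generated_by_topspace by auto
qed


section \<open>The single-server queue under nonpreemptive earliest-deadline-first\<close>

text \<open>\<open>T n\<close> is the time between the \<open>n\<close>-th and the \<open>n+1\<close>-st renewal, and \<open>renewal_count\<close> is the
  number of renewals in \<open>(0, t]\<close>.\<close>

definition (in prob_space) renewal_intervals :: "(nat \<Rightarrow> 'a \<Rightarrow> real) \<Rightarrow> bool" where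
  "renewal_intervals T \<longleftrightarrow>
     indep_vars (\<lambda>_. borel) T UNIV \<and>
     (\<forall>n. distr M borel (T n) = distr M borel (T 0)) \<and>
     (\<forall>n. AE \<omega> in M. 0 < T n \<omega>) \<and>
     integrable M (T 0) \<and> expectation (T 0) = 1"

definition renewal_count :: "(nat \<Rightarrow> real) \<Rightarrow> real \<Rightarrow> nat" where
  "renewal_count T t = card {n. 1 \<le> n \<and> (\<Sum>j<n. T j) \<le> t}"

text \<open>In the following, \<open>a i\<close> is the arrival time of customer \<open>i\<close>, \<open>u i\<close> the initial lead time,
  so that the lead time at time \<open>t\<close> is \<open>u i + a i - t\<close>, and \<open>b i\<close> is the time at which the customer
  enters service (\<open>\<infinity>\<close> if this never happens); \<open>x0\<close> is the number of customers in the system at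
  time \<open>0\<close>.\<close>

definition customers :: "nat \<Rightarrow> int set" where
  "customers x0 = {i. - int x0 + 1 \<le> i}"

definition queue_set ::
  "nat \<Rightarrow> (int \<Rightarrow> real) \<Rightarrow> (int \<Rightarrow> real) \<Rightarrow> (int \<Rightarrow> ereal) \<Rightarrow> real \<Rightarrow> int set" where
  "queue_set x0 a u b t = {i \<in> customers x0. a i \<le> t \<and> ereal t < b i \<and> 0 < u i + a i - t}"

text \<open>A set \<open>B\<close> receives as mass the number of queued customers with lead time in \<open>B\<close>.\<close>

definition queue_measure ::
  "nat \<Rightarrow> (int \<Rightarrow> real) \<Rightarrow> (int \<Rightarrow> real) \<Rightarrow> (int \<Rightarrow> ereal) \<Rightarrow> real \<Rightarrow> real measure" where
  "queue_measure x0 a u b t = distr (count_space (queue_set x0 a u b t)) nn_borel (\<lambda>i. u i + a i - t)"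

definition head_lead_time ::
  "nat \<Rightarrow> (int \<Rightarrow> real) \<Rightarrow> (int \<Rightarrow> real) \<Rightarrow> (int \<Rightarrow> ereal) \<Rightarrow> real \<Rightarrow> real" where
  "head_lead_time x0 a u b t =
     (if queue_set x0 a u b t = {} then 0
      else Min ((\<lambda>i. u i + a i - t) ` queue_set x0 a u b t))"

definition completions :: "(real \<Rightarrow> nat) \<Rightarrow> (real \<Rightarrow> nat) \<Rightarrow> real \<Rightarrow> nat" where
  "completions S X t = S (integral {0..t} (\<lambda>s. of_bool (0 < X s)))"

text \<open>
  The sample-path description of the system with arrival process \<open>E\<close>, service process \<open>S\<close>,
  number of customers \<open>X\<close> and reneging process \<open>R\<close>.

  \<^item> Customers enter service after their arrival and while their lead time is positive; those who
    never enter service renege when their lead time reaches \<open>0\<close>. Since \<open>R 0 = 0\<close>, all customers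
    queued at time \<open>0\<close> have positive lead times. If \<open>X 0 > 0\<close>, the customer in service at time \<open>0\<close>
    is the one with \<open>b i \<le> 0\<close>; its lead time at time \<open>0\<close> is unrestricted.
  \<^item> \<open>card {i. b i \<le> t} - completions\<close> is the number of customers in service at time \<open>t\<close>.
    That it equals \<open>1\<close> if \<open>X t > 0\<close> and \<open>0\<close> otherwise says that there is a single
    server which does not idle and does not preempt; in particular, a customer arriving at an idle
    server starts service at once, and at a completion time a new customer is taken iff someone
    is present.
  \<^item> A customer entering service at time \<open>t\<close> has a lead time not exceeding that of any customer
    left in the queue. If several events happen at the same instant, arrivals and reneging precede
    the choice of the next customer.\<close>

definition edf_path ::
  "(real \<Rightarrow> nat) \<Rightarrow> (real \<Rightarrow> nat) \<Rightarrow> (int \<Rightarrow> real) \<Rightarrow> (int \<Rightarrow> real) \<Rightarrow> (int \<Rightarrow> ereal) \<Rightarrow>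
   (real \<Rightarrow> nat) \<Rightarrow> (real \<Rightarrow> nat) \<Rightarrow> bool" where
  "edf_path E S a u b X R \<longleftrightarrow>
     (\<forall>i\<in>customers (X 0). 0 < u i \<and> (i \<le> 0 \<longrightarrow> a i \<le> 0)) \<and>
     (\<forall>i\<in>customers (X 0). b i \<noteq> \<infinity> \<longrightarrow> ereal (a i) \<le> b i \<and> b i < ereal (u i + a i)) \<and>
     R 0 = 0 \<and>
     (\<forall>t\<ge>0. R t = card {i \<in> customers (X 0). b i = \<infinity> \<and> u i + a i - t \<le> 0}) \<and>
     (\<forall>t\<ge>0. int (X t) = int (X 0) + int (E t) - int (completions S X t) - int (R t)) \<and>
     (\<forall>t\<ge>0. card {i \<in> customers (X 0). b i \<le> ereal t} = completions S X t + of_bool (0 < X t)) \<and>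
     (\<forall>t>0. \<forall>i\<in>customers (X 0). b i = ereal t \<longrightarrow>
        (\<forall>j\<in>queue_set (X 0) a u b t. u i + a i - t \<le> u j + a j - t))"

text \<open>\<open>tau\<close> and \<open>sigma\<close> are the inter-renewal times of the unit rate arrival and service
  processes. The lead times and arrival times of customers \<open>i \<le> 0\<close> are part of the initial
  condition, on whose joint law with the other data nothing is assumed.\<close>

locale edf_queue = prob_space M
  for M :: "'a measure" +
  fixes lam mu :: real
    and tau sigma :: "nat \<Rightarrow> 'a \<Rightarrow> real"
    and nu :: "real measure"
    and a u :: "int \<Rightarrow> 'a \<Rightarrow> real"
    and b :: "int \<Rightarrow> 'a \<Rightarrow> ereal"
    and X R :: "'a \<Rightarrow> real \<Rightarrow> nat"
  assumes rates: "0 < lam" "0 < mu"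
    and arrival_renewal: "renewal_intervals tau"
    and service_renewal: "renewal_intervals sigma"
    and random_variables:
      "\<And>i. a i \<in> borel_measurable M" "\<And>i. u i \<in> borel_measurable M" "\<And>i. b i \<in> borel_measurable M"
    and random_paths:
      "(\<lambda>\<omega> t. real (X \<omega> t)) \<in> M \<rightarrow>\<^sub>M borel_of skorohod"
      "(\<lambda>\<omega> t. real (R \<omega> t)) \<in> M \<rightarrow>\<^sub>M borel_of skorohod"
    and lead_times_indep: "indep_vars (\<lambda>_. borel) u {1..}"
    and lead_times_law: "\<And>i. 1 \<le> i \<Longrightarrow> distr M borel (u i) = nu"
    and mutually_independent:
      "indep_vars (\<lambda>_. \<Pi>\<^sub>M n\<in>(UNIV :: nat set). borel)
         (\<lambda>k \<omega>. [\<lambda>n. u (int n + 1) \<omega>, \<lambda>n. tau n \<omega>, \<lambda>n. sigma n \<omega>] ! k) {..<3}"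
    and arrival_times: "\<And>i \<omega>. 1 \<le> i \<Longrightarrow> \<omega> \<in> space M \<Longrightarrow> a i \<omega> = (\<Sum>j<nat i. tau j \<omega>) / lam"
    and dynamics: "AE \<omega> in M.
      edf_path (\<lambda>t. renewal_count (\<lambda>n. tau n \<omega>) (lam * t)) (\<lambda>t. renewal_count (\<lambda>n. sigma n \<omega>) (mu * t))
        (\<lambda>i. a i \<omega>) (\<lambda>i. u i \<omega>) (\<lambda>i. b i \<omega>) (X \<omega>) (R \<omega>)"

text \<open>The truncated subtraction on \<open>nat\<close> is \<open>(X - 1)\<^sup>+\<close>.\<close>

definition queue_length :: "(real \<Rightarrow> nat) \<Rightarrow> real \<Rightarrow> nat" where
  "queue_length X t = X t - 1"


section \<open>The fluid limit\<close>

definition y_max :: "(real \<Rightarrow> real) \<Rightarrow> ereal" where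
  "y_max G = Inf {ereal x | x. G x = 1}"

definition y_star :: "real \<Rightarrow> real \<Rightarrow> (real \<Rightarrow> real) \<Rightarrow> ereal" where
  "y_star lam mu G = Sup {ereal y | y. ereal y < y_max G \<and> lam * G y < mu}"

definition fluid_H :: "real \<Rightarrow> (real \<Rightarrow> real) \<Rightarrow> real measure \<Rightarrow> real \<Rightarrow> real \<Rightarrow> real" where
  "fluid_H lam G Q0 x t =
     measure Q0 {x + t<..} + lam * integral {0..t} (\<lambda>s. 1 - G (x + t - s))"

definition fluid_psi :: "real \<Rightarrow> real \<Rightarrow> real measure \<Rightarrow> real \<Rightarrow> real" where
  "fluid_psi lam mu Q0 t = measure Q0 {0..} + (lam - mu) * t"

definition fluid_phi :: "real \<Rightarrow> real \<Rightarrow> (real \<Rightarrow> real) \<Rightarrow> real measure \<Rightarrow> real \<Rightarrow> real" where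
  "fluid_phi lam mu G Q0 t =
     fluid_psi lam mu Q0 t - (SUP s\<in>{0..t}. max (fluid_psi lam mu Q0 s - fluid_H lam G Q0 0 s) 0)"

definition fluid_T :: "real \<Rightarrow> real \<Rightarrow> (real \<Rightarrow> real) \<Rightarrow> real measure \<Rightarrow> ereal" where
  "fluid_T lam mu G Q0 = Inf {ereal t | t. 0 \<le> t \<and> fluid_phi lam mu G Q0 t = 0}"

definition fluid_limit :: "real \<Rightarrow> real \<Rightarrow> (real \<Rightarrow> real) \<Rightarrow> real measure \<Rightarrow> real \<Rightarrow> real" where
  "fluid_limit lam mu G Q0 t =
     (if ereal t \<le> fluid_T lam mu G Q0 then fluid_phi lam mu G Q0 t else 0)"

end

theory Submission
  imports Defs
begin

text \<open>
  Since the limit is deterministic, it suffices to compare the queue length with the fluid limit on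
  an event of high probability on which the renewal processes and the counts of the deadlines (times
  at which lead times reach \<open>0\<close>) are uniformly close to their means on compact time intervals. On such
  an event everything is deterministic. Let \<open>H t\<close> be the number of customers that have arrived by time
  \<open>t\<close>, were not in service at time \<open>0\<close> and have deadline after \<open>t\<close>. As long as the server has not been
  idle, the queue length is \<open>\<psi> - R\<close> with the number \<open>R\<close> of reneged customers nondecreasing, and
  it is at most \<open>H\<close>; hence \<open>R \<ge> sup (\<psi> - H)\<^sup>+\<close>. For the converse, consider a customer who
  reneges at time \<open>r\<close>. Either no customer with deadline after \<open>r\<close> has been served before \<open>r\<close>, in which
  case the queue length at \<open>r\<close> is essentially \<open>H r\<close> and so \<open>R r \<le> \<psi> r - H r\<close> up to a small error; or
  the customer arrived after the last service entry of such a customer. In the latter case all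
  entries to service since then are new arrivals, and \<open>lam < mu\<close> bounds the length of this period, so
  that the customer had a short initial lead time; such customers are few because \<open>G\<close> is continuous at
  \<open>0\<close> with \<open>G 0 = 0\<close>. After the first idle time the queue remains short, again because \<open>lam < mu\<close>, and
  the decreasing function \<open>\<phi>\<close> is essentially nonpositive.
\<close>

text \<open>The deadline of an arriving customer is the sum of a random arrival time and a lead time
  whose limit law may have atoms. To count deadlines, arrival times are replaced by i/(\<lambda> N):
  the count becomes a sum of independent indicators with deterministic thresholds, Hoeffding's
  inequality applies, and the mean is a Riemann sum of the distribution function. Only the integral
  of G survives in the limit. It is Lipschitz, so it tolerates both the atoms and the perturbation
  of the arrival times. Who reneges depends on the whole history of the service order. The set
  \<open>pending\<close> escapes this: customers who enter service after time 0 stay in it until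
  their deadline, so its size is a matter of arrivals, deadlines and the initial queue alone.
  Uniformity in time rests on monotonicity: all counts are monotone with continuous limits, so
  finitely many time points suffice. The limit is max \<phi> 0, because \<phi> is continuous and
  nonincreasing. This form does not single out the emptying time, so the random time of the first
  idleness need not be shown to converge.\<close>

section \<open>Convergence in distribution to a constant\<close>

text \<open>Inner probability tending to 1. The sets \<open>A N\<close> of interest quantify over
  uncountably many times and over sample-path descriptions, so no measurability is asked of them; an
  event inside carries the mass.\<close>

definition (in prob_space) whp :: "(nat \<Rightarrow> 'a \<Rightarrow> bool) \<Rightarrow> bool" where
  "whp A \<longleftrightarrow> (\<forall>e>0. \<forall>\<^sub>F N in sequentially. \<exists>B\<in>events. 1 - e \<le> prob B \<and> (\<forall>\<omega>\<in>B. A N \<omega>))"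

context prob_space
begin

lemma whp_mono:
  assumes "whp A" "\<forall>\<^sub>F N in sequentially. \<forall>\<omega>\<in>space M. A N \<omega> \<longrightarrow> B N \<omega>"
  shows "whp B"
  unfolding whp_def
proof (intro allI impI)
  fix e :: real assume "0 < e"
  with assms(1) have "\<forall>\<^sub>F N in sequentially. \<exists>C\<in>events. 1 - e \<le> prob C \<and> (\<forall>\<omega>\<in>C. A N \<omega>)"
    unfolding whp_def by blast
  with assms(2) show "\<forall>\<^sub>F N in sequentially. \<exists>C\<in>events. 1 - e \<le> prob C \<and> (\<forall>\<omega>\<in>C. B N \<omega>)"
  proof eventually_elim
    case (elim N)
    then obtain C where "C \<in> events" "1 - e \<le> prob C" "\<forall>\<omega>\<in>C. A N \<omega>" by blast
    then show ?case using elim(1) sets.sets_into_space[of C M] by (intro bexI[of _ C]) auto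
  qed
qed

lemma whp_conj:
  assumes "whp A" "whp B"
  shows "whp (\<lambda>N \<omega>. A N \<omega> \<and> B N \<omega>)"
  unfolding whp_def
proof (intro allI impI)
  fix e :: real assume "0 < e"
  then have e: "0 < e / 2" by simp
  have "\<forall>\<^sub>F N in sequentially. \<exists>C\<in>events. 1 - e / 2 \<le> prob C \<and> (\<forall>\<omega>\<in>C. A N \<omega>)"
    "\<forall>\<^sub>F N in sequentially. \<exists>C\<in>events. 1 - e / 2 \<le> prob C \<and> (\<forall>\<omega>\<in>C. B N \<omega>)"
    using assms e unfolding whp_def by blast+
  then show "\<forall>\<^sub>F N in sequentially. \<exists>C\<in>events. 1 - e \<le> prob C \<and> (\<forall>\<omega>\<in>C. A N \<omega> \<and> B N \<omega>)"
  proof eventually_elim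
    case (elim N)
    then obtain C D where C: "C \<in> events" "1 - e / 2 \<le> prob C" "\<forall>\<omega>\<in>C. A N \<omega>"
      and D: "D \<in> events" "1 - e / 2 \<le> prob D" "\<forall>\<omega>\<in>D. B N \<omega>" by blast
    have "prob (C \<union> D) = prob C + prob D - prob (C \<inter> D)"
      using C D by (intro measure_Un3) (auto simp: fmeasurable_eq_sets)
    then have "prob C + prob D - 1 \<le> prob (C \<inter> D)" using prob_le_1[of "C \<union> D"] by linarith
    then show ?case using C D by (intro bexI[of _ "C \<inter> D"]) auto
  qed
qed

lemma whp_AE:
  assumes "\<forall>\<^sub>F N in sequentially. AE \<omega> in M. A N \<omega>"
  shows "whp A"
  unfolding whp_def
proof (intro allI impI)
  fix e :: real assume "0 < e"
  from assms show "\<forall>\<^sub>F N in sequentially. \<exists>C\<in>events. 1 - e \<le> prob C \<and> (\<forall>\<omega>\<in>C. A N \<omega>)"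
  proof eventually_elim
    case (elim N)
    then obtain Z where Z: "{\<omega> \<in> space M. \<not> A N \<omega>} \<subseteq> Z" "Z \<in> events" "emeasure M Z = 0"
      by (rule AE_E) auto
    then have "prob (space M - Z) = 1" by (simp add: prob_compl emeasure_eq_measure)
    then show ?case using Z \<open>0 < e\<close> by (intro bexI[of _ "space M - Z"]) auto
  qed
qed

lemma whp_eventually:
  assumes "\<forall>\<^sub>F N in sequentially. \<forall>\<omega>\<in>space M. A N \<omega>"
  shows "whp A"
  by (rule whp_AE) (use assms in \<open>auto elim!: eventually_mono\<close>)

lemma whp_ball:
  assumes "finite I" "\<And>i. i \<in> I \<Longrightarrow> whp (A i)"
  shows "whp (\<lambda>N \<omega>. \<forall>i\<in>I. A i N \<omega>)"
  using assms
proof (induction I rule: finite_induct)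
  case empty
  show ?case by (rule whp_eventually) simp
next
  case (insert i I)
  then have "whp (\<lambda>N \<omega>. A i N \<omega> \<and> (\<forall>i\<in>I. A i N \<omega>))" by (intro whp_conj) auto
  then show ?case by (rule whp_mono) simp
qed

lemma whp_prob:
  assumes "\<And>N. B N \<in> events" "(\<lambda>N. prob (B N)) \<longlonglongrightarrow> 0"
    and "\<forall>\<^sub>F N in sequentially. \<forall>\<omega>\<in>space M - B N. A N \<omega>"
  shows "whp A"
  unfolding whp_def
proof (intro allI impI)
  fix e :: real assume "0 < e"
  then have "\<forall>\<^sub>F N in sequentially. prob (B N) < e" using order_tendstoD(2)[OF assms(2)] by blast
  with assms(3) show "\<forall>\<^sub>F N in sequentially. \<exists>C\<in>events. 1 - e \<le> prob C \<and> (\<forall>\<omega>\<in>C. A N \<omega>)"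
  proof eventually_elim
    case (elim N)
    then show ?case using assms(1)
      by (intro bexI[of _ "space M - B N"]) (auto simp: prob_compl)
  qed
qed

lemma whp_subseq:
  assumes "whp A" "filterlim k sequentially sequentially"
  shows "whp (\<lambda>N. A (k N))"
  unfolding whp_def
proof (intro allI impI)
  fix e :: real assume "0 < e"
  with assms(1) have "\<forall>\<^sub>F N in sequentially. \<exists>B\<in>events. 1 - e \<le> prob B \<and> (\<forall>\<omega>\<in>B. A N \<omega>)"
    unfolding whp_def by blast
  from eventually_compose_filterlim[OF this assms(2)]
  show "\<forall>\<^sub>F N in sequentially. \<exists>B\<in>events. 1 - e \<le> prob B \<and> (\<forall>\<omega>\<in>B. A (k N) \<omega>)" .
qed

lemma whp_tendsto_expectation:
  fixes f :: "nat \<Rightarrow> 'a \<Rightarrow> real"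
  assumes meas: "\<forall>\<^sub>F N in sequentially. f N \<in> borel_measurable M"
    and bound: "\<And>N \<omega>. \<omega> \<in> space M \<Longrightarrow> \<bar>f N \<omega> - c\<bar> \<le> K"
    and whp: "\<And>e. 0 < e \<Longrightarrow> whp (\<lambda>N \<omega>. \<bar>f N \<omega> - c\<bar> < e)"
  shows "(\<lambda>N. expectation (f N)) \<longlonglongrightarrow> c"
proof (rule tendstoI)
  fix e :: real assume "0 < e"
  have K: "0 \<le> K" using bound not_empty by (meson abs_ge_zero ex_in_conv order_trans)
  \<comment> \<open>Chosen so that \<open>K * d < e / 2\<close>; the summand 1 allows
    \<open>K = 0\<close>.\<close>
  define d where "d = e / (2 * (K + 1))"
  have d: "0 < d" using \<open>0 < e\<close> K by (simp add: d_def)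
  have "\<forall>\<^sub>F N in sequentially. \<exists>B\<in>events. 1 - d \<le> prob B \<and> (\<forall>\<omega>\<in>B. \<bar>f N \<omega> - c\<bar> < e / 2)"
    using whp[of "e / 2"] d \<open>0 < e\<close> unfolding whp_def by simp
  with meas show "\<forall>\<^sub>F N in sequentially. dist (expectation (f N)) c < e"
  proof eventually_elim
    case (elim N)
    then obtain B where B: "B \<in> events" "1 - d \<le> prob B" "\<forall>\<omega>\<in>B. \<bar>f N \<omega> - c\<bar> < e / 2" by blast
    have [measurable]: "f N \<in> borel_measurable M" by fact
    have int: "integrable M (\<lambda>\<omega>. f N \<omega> - c)"
      by (rule integrable_const_bound[where B = K]) (use bound in auto)
    have ind: "integrable M (\<lambda>\<omega>. K * indicator (space M - B) \<omega> :: real)"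
      using B by (intro integrable_mult_right integrable_real_indicator) (auto simp: emeasure_eq_measure)
    have "\<bar>expectation (\<lambda>\<omega>. f N \<omega> - c)\<bar> \<le> expectation (\<lambda>\<omega>. \<bar>f N \<omega> - c\<bar>)"
      by (rule integral_abs_bound)
    also have "\<dots> \<le> expectation (\<lambda>\<omega>. e / 2 + K * indicator (space M - B) \<omega>)"
    proof (rule integral_mono)
      fix \<omega> assume w: "\<omega> \<in> space M"
      show "\<bar>f N \<omega> - c\<bar> \<le> e / 2 + K * indicator (space M - B) \<omega>"
        using B(3) bound[OF w, of N] \<open>0 < e\<close> K w
        by (cases "\<omega> \<in> B") (auto simp: less_imp_le intro: order_trans)
    qed (use int ind in auto)
    also have "\<dots> = e / 2 + K * prob (space M - B)"
      using ind B by (subst Bochner_Integration.integral_add) (auto simp: prob_space)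
    also have "\<dots> \<le> e / 2 + K * d" using B K by (intro add_left_mono mult_left_mono) (auto simp: prob_compl)
    also have "\<dots> < e"
    proof -
      have "K * e < (K + 1) * e" using \<open>0 < e\<close> by simp
      then have "K * d < e / 2" using K by (simp add: d_def field_simps)
      then show ?thesis by simp
    qed
    finally have "\<bar>expectation (\<lambda>\<omega>. f N \<omega> - c)\<bar> < e" .
    moreover have "integrable M (f N)" using Bochner_Integration.integrable_add[OF int, of "\<lambda>_. c"] by simp
    ultimately show ?case by (simp add: dist_real_def prob_space)
  qed
qed

end

lemma space_borel_of: "space (borel_of T) = topspace T"
  unfolding borel_of_def by (rule space_measure_of) (auto dest: openin_subset)

lemma sets_borel_of: "sets (borel_of T) = sigma_sets (topspace T) {U. openin T U}"
  unfolding borel_of_def by (rule sets_measure_of) (auto dest: openin_subset)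

lemma continuous_map_measurable_borel_of:
  assumes "continuous_map T T' f"
  shows "f \<in> borel_of T \<rightarrow>\<^sub>M borel_of T'"
  unfolding borel_of_def[of T']
proof (rule measurable_measure_of)
  show "f \<in> space (borel_of T) \<rightarrow> topspace T'"
    using assms by (auto simp: space_borel_of continuous_map_def)
  fix U assume "U \<in> {U. openin T' U}"
  then have "openin T {x \<in> topspace T. f x \<in> U}" using assms by (auto simp: continuous_map_def)
  moreover have "f -` U \<inter> space (borel_of T) = {x \<in> topspace T. f x \<in> U}"
    by (auto simp: space_borel_of)
  ultimately show "f -` U \<inter> space (borel_of T) \<in> sets (borel_of T)"
    unfolding sets_borel_of by auto
qed (auto dest: openin_subset)

lemma borel_of_euclidean: "borel_of euclidean = borel"
  by (simp add: borel_of_def borel_def)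

context prob_space
begin

text \<open>A continuous \<open>f\<close> is close to \<open>f y\<close> on an open neighbourhood of
  \<open>y\<close>, so convergence in probability to the constant gives convergence of the means of
  bounded continuous functions.\<close>

lemma converges_in_distribution_constI:
  assumes "\<forall>\<^sub>F N in sequentially. Z N \<in> M \<rightarrow>\<^sub>M borel_of T" "y \<in> topspace T"
    and whp: "\<And>U. openin T U \<Longrightarrow> y \<in> U \<Longrightarrow> whp (\<lambda>N \<omega>. Z N \<omega> \<in> U)"
  shows "converges_in_distribution M T Z (\<lambda>_. y)"
  unfolding converges_in_distribution_def
proof (intro conjI allI impI)
  show "(\<lambda>_. y) \<in> M \<rightarrow>\<^sub>M borel_of T" using assms(2) by (simp add: space_borel_of)
  fix f :: "_ \<Rightarrow> real" assume f: "continuous_map T euclideanreal f \<and> bounded (f ` topspace T)"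
  then obtain K where K: "\<And>x. x \<in> topspace T \<Longrightarrow> \<bar>f x\<bar> \<le> K" by (auto simp: bounded_iff)
  \<comment> \<open>The default \<open>f y\<close> at the indices where \<open>Z N\<close> is not
    measurable keeps the bound valid for every \<open>N\<close>; from some index on it does not
    occur.\<close>
  let ?Z = "\<lambda>N \<omega>. if Z N \<in> M \<rightarrow>\<^sub>M borel_of T then f (Z N \<omega>) else f y"
  have fm: "f \<in> borel_measurable (borel_of T)"
    using continuous_map_measurable_borel_of[of T euclideanreal f] f by (simp add: borel_of_euclidean)
  have "(\<lambda>N. expectation (?Z N)) \<longlonglongrightarrow> f y"
  proof (rule whp_tendsto_expectation[where K = "2 * K"])
    have "?Z N \<in> borel_measurable M" for N
    proof (cases "Z N \<in> M \<rightarrow>\<^sub>M borel_of T")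
      case True
      from measurable_compose[OF True fm] True show ?thesis by simp
    qed simp
    then show "\<forall>\<^sub>F N in sequentially. ?Z N \<in> borel_measurable M" by simp
  next
    fix N \<omega> assume "\<omega> \<in> space M"
    then have "\<bar>?Z N \<omega>\<bar> \<le> K" using K assms(2) by (auto dest!: measurable_space[where x = \<omega>] simp: space_borel_of)
    then show "\<bar>?Z N \<omega> - f y\<bar> \<le> 2 * K" using K[OF assms(2)] by linarith
  next
    fix e :: real assume "0 < e"
    have "openin T {x \<in> topspace T. f x \<in> ball (f y) e}"
      using f by (auto simp: continuous_map_def)
    then have "whp (\<lambda>N \<omega>. Z N \<omega> \<in> {x \<in> topspace T. f x \<in> ball (f y) e})"
      using \<open>0 < e\<close> assms(2) by (intro whp) auto
    then show "whp (\<lambda>N \<omega>. \<bar>?Z N \<omega> - f y\<bar> < e)"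
      by (rule whp_mono) (use \<open>0 < e\<close> in \<open>auto simp: dist_real_def abs_minus_commute\<close>)
  qed
  moreover have "\<forall>\<^sub>F N in sequentially. expectation (?Z N) = expectation (\<lambda>\<omega>. f (Z N \<omega>))"
    using assms(1) by eventually_elim simp
  ultimately have "(\<lambda>N. expectation (\<lambda>\<omega>. f (Z N \<omega>))) \<longlonglongrightarrow> f y"
    by (rule Lim_transform_eventually)
  then show "(\<lambda>N. expectation (\<lambda>\<omega>. f (Z N \<omega>))) \<longlonglongrightarrow> expectation (\<lambda>\<omega>. f y)"
    by (simp add: prob_space)
qed fact

text \<open>The truncated distance \<open>min 1 \<bar>g x - g y\<bar>\<close> is a bounded
  continuous test function that vanishes at \<open>y\<close>; its mean tends to 0 and Markov's
  inequality does the rest.\<close>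

lemma converges_in_distribution_constD:
  assumes conv: "converges_in_distribution M T Z (\<lambda>_. y)"
    and g: "continuous_map T euclideanreal g" and e: "0 < e"
  shows "whp (\<lambda>N \<omega>. \<bar>g (Z N \<omega>) - g y\<bar> < e)"
proof -
  define f where "f x = min 1 \<bar>g x - g y\<bar>" for x
  have f: "continuous_map T euclideanreal f"
    unfolding f_def by (intro continuous_intros g)
  have "bounded (f ` topspace T)" by (auto simp: bounded_iff f_def intro!: exI[of _ 1])
  then have lim: "(\<lambda>N. expectation (\<lambda>\<omega>. f (Z N \<omega>))) \<longlonglongrightarrow> 0"
    using conv f unfolding converges_in_distribution_def by (auto simp: f_def)
  have fm: "f \<in> borel_measurable (borel_of T)"
    using continuous_map_measurable_borel_of[OF f] by (simp add: borel_of_euclidean)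
  \<comment> \<open>The test function is capped at 1, so the threshold is capped too:
    \<open>f x < d\<close> still forces \<open>\<bar>g x - g y\<bar> < e\<close>.\<close>
  define d where "d = min 1 e"
  have d: "0 < d" using e by (simp add: d_def)
  define B where "B N = (if Z N \<in> M \<rightarrow>\<^sub>M borel_of T then {\<omega> \<in> space M. d \<le> f (Z N \<omega>)} else {})" for N
  have B: "B N \<in> events \<and> prob (B N) \<le> expectation (\<lambda>\<omega>. f (Z N \<omega>)) / d" if "Z N \<in> M \<rightarrow>\<^sub>M borel_of T" for N
  proof -
    have [measurable]: "(\<lambda>\<omega>. f (Z N \<omega>)) \<in> borel_measurable M" by (rule measurable_compose[OF that fm])
    have "prob {\<omega> \<in> space M. d \<le> f (Z N \<omega>)} \<le> expectation (\<lambda>\<omega>. f (Z N \<omega>)) / d"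
      by (rule integral_Markov_inequality_measure[where A = "{}"])
        (use d in \<open>auto simp: f_def intro!: integrable_const_bound[where B = 1, OF _ \<open>(\<lambda>\<omega>. f (Z N \<omega>)) \<in> borel_measurable M\<close>[unfolded f_def]]\<close>)
    then show ?thesis using that by (simp add: B_def)
  qed
  have ev: "\<forall>\<^sub>F N in sequentially. Z N \<in> M \<rightarrow>\<^sub>M borel_of T"
    using conv by (simp add: converges_in_distribution_def)
  show ?thesis
  proof (rule whp_prob[where B = B])
    show "B N \<in> events" for N using B[of N] by (cases "Z N \<in> M \<rightarrow>\<^sub>M borel_of T") (auto simp: B_def)
    show "(\<lambda>N. prob (B N)) \<longlonglongrightarrow> 0"
    proof (rule tendsto_sandwich)
      show "\<forall>\<^sub>F N in sequentially. 0 \<le> prob (B N)" by simp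
      show "\<forall>\<^sub>F N in sequentially. prob (B N) \<le> expectation (\<lambda>\<omega>. f (Z N \<omega>)) / d"
        using ev by eventually_elim (use B in blast)
      show "(\<lambda>N. expectation (\<lambda>\<omega>. f (Z N \<omega>)) / d) \<longlonglongrightarrow> 0"
        using tendsto_divide[OF lim tendsto_const[of d]] d by simp
    qed simp
    show "\<forall>\<^sub>F N in sequentially. \<forall>\<omega>\<in>space M - B N. \<bar>g (Z N \<omega>) - g y\<bar> < e"
      using ev by eventually_elim (auto simp: B_def f_def d_def)
  qed
qed

end

text \<open>A nonexpansive \<open>g\<close> keeps every basic neighbourhood with the same radius and
  the same time change. This transfers measurability from the number in system to the scaled queue
  length.\<close>

lemma skorohod_compose:
  fixes g :: "'b::metric_space \<Rightarrow> 'c::metric_space"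
  assumes g: "\<And>x y. dist (g x) (g y) \<le> dist x y"
  shows "continuous_map skorohod skorohod (\<lambda>x t. g (x t))"
proof -
  have cont: "isCont g x" for x
    unfolding isCont_def tendsto_iff eventually_at by (metis g order_le_less_trans)
  have rcll: "(\<lambda>t. g (x t)) \<in> rcll" if x: "x \<in> rcll" for x
    unfolding rcll_def
  proof (intro CollectI conjI allI impI)
    fix t :: real
    show "0 \<le> t \<Longrightarrow> ((\<lambda>t. g (x t)) \<longlongrightarrow> g (x t)) (at_right t)"
      using x by (auto simp: rcll_def intro: isCont_tendsto_compose[OF cont])
    assume "0 < t"
    then obtain l where "(x \<longlongrightarrow> l) (at_left t)" using x by (auto simp: rcll_def)
    then show "\<exists>l. ((\<lambda>t. g (x t)) \<longlongrightarrow> l) (at_left t)"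
      by (blast intro: isCont_tendsto_compose[OF cont])
  qed
  show ?thesis
    unfolding continuous_map_def topspace_skorohod
  proof (intro conjI allI impI)
    show "(\<lambda>x t. g (x t)) \<in> rcll \<rightarrow> rcll" using rcll by auto
    fix U :: "(real \<Rightarrow> 'c) set" assume U: "openin skorohod U"
    show "openin skorohod {x \<in> rcll. (\<lambda>t. g (x t)) \<in> U}"
      unfolding openin_skorohod
    proof (intro conjI ballI)
      fix x assume "x \<in> {x \<in> rcll. (\<lambda>t. g (x t)) \<in> U}"
      then obtain e where e: "0 < e" "skorohod_nbhd (\<lambda>t. g (x t)) e \<subseteq> U"
        using U unfolding openin_skorohod by blast
      have "(\<lambda>t. g (y t)) \<in> skorohod_nbhd (\<lambda>t. g (x t)) e" if y: "y \<in> skorohod_nbhd x e" for y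
        using y rcll unfolding skorohod_nbhd_def by (blast intro: order_le_less_trans[OF g])
      moreover have "skorohod_nbhd x e \<subseteq> rcll" by (auto simp: skorohod_nbhd_def)
      ultimately have "skorohod_nbhd x e \<subseteq> {x \<in> rcll. (\<lambda>t. g (x t)) \<in> U}"
        using e by blast
      then show "\<exists>e>0. skorohod_nbhd x e \<subseteq> {x \<in> rcll. (\<lambda>t. g (x t)) \<in> U}" using e by blast
    qed auto
  qed
qed

lemma continuous_on_imp_rcll:
  fixes y :: "real \<Rightarrow> 'b::metric_space"
  assumes "continuous_on {0..} y"
  shows "y \<in> rcll"
  unfolding rcll_def
proof (intro CollectI conjI allI impI)
  fix t :: real
  have lim: "(y \<longlongrightarrow> y t) (at t within {0..})" if "0 \<le> t"
    using assms that by (auto simp: continuous_on_def)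
  show "(y \<longlongrightarrow> y t) (at_right t)" if "0 \<le> t"
    by (rule tendsto_within_subset[OF lim[OF that]]) (use that in auto)
  assume t: "0 < t"
  have "(y \<longlongrightarrow> y t) (at_left t)"
  proof -
    have "at_left t = at t within {0<..<t}"
      by (rule at_within_nhd[of t "{0<..}"]) (use t in auto)
    moreover have "(y \<longlongrightarrow> y t) (at t within {0<..<t})"
      by (rule tendsto_within_subset[OF lim]) (use t in auto)
    ultimately show ?thesis by simp
  qed
  then show "\<exists>l. (y \<longlongrightarrow> l) (at_left t)" ..
qed

text \<open>With the identity as time change, uniform closeness on \<open>{0..1 / e}\<close> already
  puts a path into \<open>skorohod_nbhd y e\<close>.\<close>

lemma (in prob_space) converges_in_distribution_skorohod_constI:
  assumes meas: "\<forall>\<^sub>F N in sequentially. Z N \<in> M \<rightarrow>\<^sub>M borel_of skorohod" and y: "y \<in> rcll"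
    and unif: "\<And>T e. 0 < e \<Longrightarrow> whp (\<lambda>N \<omega>. \<forall>t\<in>{0..T}. dist (Z N \<omega> t) (y t) < e)"
  shows "converges_in_distribution M skorohod Z (\<lambda>_. y)"
proof (rule converges_in_distribution_constI[OF meas])
  show "y \<in> topspace skorohod" using y by (simp add: topspace_skorohod)
  fix U assume "openin skorohod U" "y \<in> U"
  then obtain e where e: "0 < e" "skorohod_nbhd y e \<subseteq> U" unfolding openin_skorohod by blast
  have id: "(\<lambda>t. t) \<in> time_changes" by (auto simp: time_changes_def strict_mono_on_def)
  show "whp (\<lambda>N \<omega>. Z N \<omega> \<in> U)"
  proof (rule whp_mono[OF unif[OF e(1), of "1 / e"]])
    show "\<forall>\<^sub>F N in sequentially. \<forall>\<omega>\<in>space M. (\<forall>t\<in>{0..1 / e}. dist (Z N \<omega> t) (y t) < e) \<longrightarrow> Z N \<omega> \<in> U"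
      using meas
    proof eventually_elim
      case (elim N)
      have "Z N \<omega> \<in> rcll" if "\<omega> \<in> space M" for \<omega>
        using measurable_space[OF elim that] by (simp add: space_borel_of topspace_skorohod)
      then have "Z N \<omega> \<in> skorohod_nbhd y e"
        if "\<omega> \<in> space M" "\<forall>t\<in>{0..1 / e}. dist (Z N \<omega> t) (y t) < e" for \<omega>
        unfolding skorohod_nbhd_def using that e id by (auto intro!: bexI[of _ "\<lambda>t. t"])
      then show ?case using e by blast
    qed
  qed
qed

section \<open>Laws of large numbers for renewal processes\<close>

lemma eventually_real_gt: "\<forall>\<^sub>F N in sequentially. c < real N"
  using filterlim_real_sequentially unfolding filterlim_at_top_dense by blast

text \<open>Between two neighbouring grid points a monotone \<open>F\<close> is trapped by its
  values there, and \<open>f\<close> varies by less than \<open>e\<close>. The grid depends only on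
  \<open>f\<close>, \<open>T\<close> and \<open>e\<close>, not on \<open>F\<close>, so one finite
  set of points serves all random paths.\<close>

lemma mono_uniform_grid:
  fixes f :: "real \<Rightarrow> real"
  assumes f: "continuous_on {0..T} f" and e: "0 < e"
  obtains P where "finite P" "P \<subseteq> {0..T}"
    "\<And>F t. mono_on {0..T} F \<Longrightarrow> (\<And>p. p \<in> P \<Longrightarrow> \<bar>F p - f p\<bar> \<le> e) \<Longrightarrow> t \<in> {0..T} \<Longrightarrow> \<bar>F t - f t\<bar> \<le> 2 * e"
proof -
  have "uniformly_continuous_on {0..T} f"
    using f by (rule compact_uniformly_continuous) simp
  then obtain d where d: "0 < d" "\<And>s t. s \<in> {0..T} \<Longrightarrow> t \<in> {0..T} \<Longrightarrow> \<bar>s - t\<bar> < d \<Longrightarrow> \<bar>f s - f t\<bar> < e"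
    using e unfolding uniformly_continuous_on_def dist_real_def by metis
  define h where "h = d / 2"
  \<comment> \<open>The extra 1 leaves room for the right neighbour \<open>k + 1\<close> of the cell
    that contains \<open>t\<close>.\<close>
  define m where "m = nat \<lceil>T / h\<rceil> + 1"
  define P where "P = (\<lambda>k. min T (real k * h)) ` {0..m} \<inter> {0..T}"
  have h: "0 < h" "h < d" using d by (auto simp: h_def)
  show thesis
  proof
    show "finite P" "P \<subseteq> {0..T}" by (auto simp: P_def)
    fix F :: "real \<Rightarrow> real" and t assume F: "mono_on {0..T} F" "\<And>p. p \<in> P \<Longrightarrow> \<bar>F p - f p\<bar> \<le> e" and t: "t \<in> {0..T}"
    define k where "k = nat \<lfloor>t / h\<rfloor>"
    have "0 \<le> t / h" using t h by simp
    then have k: "real k \<le> t / h" "t / h < real k + 1" by (auto simp: k_def)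
    have "t / h \<le> T / h" using t h by (simp add: divide_right_mono)
    then have km: "k + 1 \<le> m" unfolding k_def m_def by (simp add: nat_mono floor_le_ceiling le_diff_conv)
        (meson floor_le_ceiling floor_mono nat_mono order_trans)
    define p q where "p = real k * h" and "q = min T (real (k + 1) * h)"
    have p: "p \<le> t" "t < p + h" using k h by (auto simp: p_def field_simps)
    have q: "t \<le> q" "q \<le> p + h" using p t by (auto simp: q_def p_def field_simps)
    have "0 \<le> p" using h by (simp add: p_def)
    have T: "p \<in> {0..T}" "q \<in> {0..T}" using p q t \<open>0 \<le> p\<close> by (auto simp: q_def)
    have "p = min T (real k * h)" using T by (simp add: p_def)
    then have "p \<in> (\<lambda>k. min T (real k * h)) ` {0..m}" "q \<in> (\<lambda>k. min T (real k * h)) ` {0..m}"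
      using km unfolding q_def by (intro image_eqI[of _ _ k] image_eqI[of _ _ "k + 1"]; simp)+
    then have P: "p \<in> P" "q \<in> P" using T unfolding P_def by auto
    have "F p \<le> F t" "F t \<le> F q" using F(1) T t p q by (auto simp: mono_on_def)
    moreover have "\<bar>f p - f t\<bar> < e" "\<bar>f q - f t\<bar> < e" using T t p q h by (auto intro!: d(2))
    ultimately show "\<bar>F t - f t\<bar> \<le> 2 * e" using F(2)[OF P(1)] F(2)[OF P(2)] by linarith
  qed
qed

text \<open>The form in which the grid argument is applied: pointwise convergence in probability of
  monotone paths to a continuous function is locally uniform.\<close>

lemma (in prob_space) whp_uniform_mono:
  fixes F :: "nat \<Rightarrow> 'a \<Rightarrow> real \<Rightarrow> real"
  assumes f: "continuous_on {0..T} f" and mono: "whp (\<lambda>N \<omega>. mono_on {0..T} (F N \<omega>))"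
    and point: "\<And>t e. t \<in> {0..T} \<Longrightarrow> 0 < e \<Longrightarrow> whp (\<lambda>N \<omega>. \<bar>F N \<omega> t - f t\<bar> \<le> e)" and e: "0 < e"
  shows "whp (\<lambda>N \<omega>. \<forall>t\<in>{0..T}. \<bar>F N \<omega> t - f t\<bar> \<le> e)"
proof -
  have e2: "0 < e / 2" using e by simp
  show ?thesis
  proof (rule mono_uniform_grid[OF f e2])
    fix P assume P: "finite P" "P \<subseteq> {0..T}"
      "\<And>F t. mono_on {0..T} F \<Longrightarrow> (\<And>p. p \<in> P \<Longrightarrow> \<bar>F p - f p\<bar> \<le> e / 2) \<Longrightarrow> t \<in> {0..T} \<Longrightarrow> \<bar>F t - f t\<bar> \<le> 2 * (e / 2)"
    have "whp (\<lambda>N \<omega>. mono_on {0..T} (F N \<omega>) \<and> (\<forall>p\<in>P. \<bar>F N \<omega> p - f p\<bar> \<le> e / 2))"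
      using P(1,2) point[OF _ e2] by (intro whp_conj mono whp_ball) auto
    then show ?thesis
          by (rule whp_mono) (use P(3) in \<open>auto simp del: atLeastAtMost_iff\<close>)
  qed
qed

context prob_space
begin

lemma renewal_intervals_expectation:
  assumes T: "renewal_intervals T" and g: "g \<in> borel_measurable borel"
  shows "expectation (\<lambda>\<omega>. g (T j \<omega>) :: real) = expectation (\<lambda>\<omega>. g (T 0 \<omega>))"
    "integrable M (\<lambda>\<omega>. g (T j \<omega>)) \<longleftrightarrow> integrable M (\<lambda>\<omega>. g (T 0 \<omega>))"
proof -
  have m: "T i \<in> borel_measurable M" for i
    using T unfolding renewal_intervals_def indep_vars_def by auto
  have eq: "distr M borel (T j) = distr M borel (T 0)" using T by (simp add: renewal_intervals_def)
  show "expectation (\<lambda>\<omega>. g (T j \<omega>) :: real) = expectation (\<lambda>\<omega>. g (T 0 \<omega>))"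
    using integral_distr[OF m g, of j] integral_distr[OF m g, of 0] eq by simp
  show "integrable M (\<lambda>\<omega>. g (T j \<omega>)) \<longleftrightarrow> integrable M (\<lambda>\<omega>. g (T 0 \<omega>))"
    using integrable_distr_eq[OF m g, of j] integrable_distr_eq[OF m g, of 0] eq by simp
qed

text \<open>Only the first moment is finite: the truncated variables are handled by Hoeffding's inequality
  and the remainders by Markov's.\<close>

lemma weak_law_of_large_numbers:
  assumes T: "renewal_intervals T" and e: "0 < e"
  shows "whp (\<lambda>n \<omega>. \<bar>(\<Sum>j<n. T j \<omega>) - real n\<bar> \<le> e * real n)"
  unfolding whp_def
proof (intro allI impI)
  fix d :: real assume d: "0 < d"
  have m [measurable]: "T j \<in> borel_measurable M" for j
    using T unfolding renewal_intervals_def indep_vars_def by auto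
  have pos: "AE \<omega> in M. 0 < T j \<omega>" for j using T by (simp add: renewal_intervals_def)
  have int0: "integrable M (T 0)" and exp0: "expectation (T 0) = 1" using T by (auto simp: renewal_intervals_def)
  have int: "integrable M (T j)" for j
    using renewal_intervals_expectation(2)[OF T, of "\<lambda>x. x" j] int0 by simp
  define c where "c K = expectation (\<lambda>\<omega>. min (T 0 \<omega>) (real K))" for K :: nat
  have "c \<longlonglongrightarrow> expectation (T 0)"
    unfolding c_def
  proof (rule integral_dominated_convergence[where w = "\<lambda>\<omega>. \<bar>T 0 \<omega>\<bar>"])
    show "AE \<omega> in M. (\<lambda>K. min (T 0 \<omega>) (real K)) \<longlonglongrightarrow> T 0 \<omega>"
    proof (rule AE_I2)
      fix \<omega>
      obtain k where "T 0 \<omega> \<le> real k" using real_arch_simple by blast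
      then have "\<forall>\<^sub>F K in sequentially. min (T 0 \<omega>) (real K) = T 0 \<omega>"
        unfolding eventually_sequentially by (intro exI[of _ k]) auto
      then show "(\<lambda>K. min (T 0 \<omega>) (real K)) \<longlonglongrightarrow> T 0 \<omega>" by (rule tendsto_eventually)
    qed
    show "AE \<omega> in M. norm (min (T 0 \<omega>) (real K)) \<le> \<bar>T 0 \<omega>\<bar>" for K by auto
  qed (use int0 in auto)
  then have "c \<longlonglongrightarrow> 1" by (simp add: exp0)
  \<comment> \<open>\<open>e / 4\<close> limits the shift of the mean from 1 to \<open>c K\<close>;
    \<open>d * e / 8\<close> brings Markov's bound \<open>4 * (1 - c K) / e\<close> for the
    remainders down to \<open>d / 2\<close>.\<close>
  moreover have "0 < min (e / 4) (d * e / 8)" using d e by simp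
  ultimately have "\<forall>\<^sub>F K in sequentially. dist (c K) 1 < min (e / 4) (d * e / 8) \<and> 0 < K"
    by (intro eventually_conj tendstoD eventually_gt_at_top) auto
  then obtain K where K: "dist (c K) 1 < min (e / 4) (d * e / 8)" "0 < K"
    using eventually_happens'[OF sequentially_bot] by blast
  define Z where "Z j \<omega> = min (T j \<omega>) (real K)" for j \<omega>
  have [measurable]: "Z j \<in> borel_measurable M" for j unfolding Z_def by measurable
  have Zexp: "expectation (Z j) = c K" for j
    unfolding Z_def c_def by (rule renewal_intervals_expectation(1)[OF T, of "\<lambda>x. min x (real K)"]) simp
  have Zint: "integrable M (Z j)" for j
    by (rule Bochner_Integration.integrable_bound[OF int[of j]]) (auto simp: Z_def)
  have hoeff: "prob {\<omega> \<in> space M. e / 4 * real n \<le> \<bar>(\<Sum>j<n. Z j \<omega>) - real n * c K\<bar>}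
      \<le> 2 * exp (- (2 * (e / 4)\<^sup>2 / (real K)\<^sup>2) * real n)" if "0 < n" for n
  proof -
    interpret Hoeffding_ineq M "{..<n}" Z "\<lambda>_. 0" "\<lambda>_. real K" "real n * c K"
    proof unfold_locales
      have "indep_vars (\<lambda>_. borel) T {..<n}"
        using T unfolding renewal_intervals_def by (auto intro: indep_vars_subset)
      then show "indep_vars (\<lambda>_. borel) Z {..<n}"
        unfolding Z_def by (rule indep_vars_compose2[where Y = "\<lambda>_ x. min x (real K)"]) simp
      show "AE x in M. Z i x \<in> {0..real K}" for i
        using pos[of i] by eventually_elim (auto simp: Z_def)
      show "real n * c K \<equiv> \<Sum>i<n. expectation (Z i)" by (simp add: Zexp)
    qed simp
    have "prob {\<omega> \<in> space M. e / 4 * real n \<le> \<bar>(\<Sum>j<n. Z j \<omega>) - real n * c K\<bar>}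
      \<le> 2 * exp (- 2 * (e / 4 * real n)\<^sup>2 / (\<Sum>i<n. (real K - 0)\<^sup>2))"
      by (rule Hoeffding_ineq_abs_ge) (use e that K in auto)
    also have "- 2 * (e / 4 * real n)\<^sup>2 / (\<Sum>i<n. (real K - 0)\<^sup>2) = - (2 * (e / 4)\<^sup>2 / (real K)\<^sup>2) * real n"
      using that by (simp add: power2_eq_square field_simps)
    finally show ?thesis .
  qed
  have markov: "prob {\<omega> \<in> space M. e / 4 * real n \<le> (\<Sum>j<n. T j \<omega> - Z j \<omega>)} \<le> d / 2" if "0 < n" for n
  proof -
    have "prob {\<omega> \<in> space M. e / 4 * real n \<le> (\<Sum>j<n. T j \<omega> - Z j \<omega>)}
      \<le> expectation (\<lambda>\<omega>. \<Sum>j<n. T j \<omega> - Z j \<omega>) / (e / 4 * real n)"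
      using e that int Zint by (intro integral_Markov_inequality_measure[where A = "{}"] Bochner_Integration.integrable_sum)
        (auto intro!: sum_nonneg simp: Z_def)
    also have "expectation (\<lambda>\<omega>. \<Sum>j<n. T j \<omega> - Z j \<omega>) = (\<Sum>j<n. expectation (T j) - c K)"
      using int Zint by (simp add: Bochner_Integration.integral_sum Zexp)
    also have "\<dots> = real n * (1 - c K)"
      using renewal_intervals_expectation(1)[OF T, of "\<lambda>x. x"] exp0 by simp
    also have "real n * (1 - c K) / (e / 4 * real n) = 4 * (1 - c K) / e" using that e by simp
    also have "\<dots> \<le> d / 2"
    proof -
      have "1 - c K \<le> \<bar>c K - 1\<bar>" by simp
      also have "\<dots> < d * e / 8" using K(1) by (simp add: dist_real_def)
      finally have "4 * (1 - c K) / e \<le> 4 * (d * e / 8) / e"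
        using e by (intro divide_right_mono mult_left_mono) auto
      also have "\<dots> = d / 2" using e by simp
      finally show ?thesis .
    qed
    finally show ?thesis .
  qed
  have lim: "(\<lambda>n. 2 * exp (- (2 * (e / 4)\<^sup>2 / (real K)\<^sup>2) * real n)) \<longlonglongrightarrow> 0"
  proof -
    have "0 < 2 * (e / 4)\<^sup>2 / (real K)\<^sup>2" using e K by simp
    then have "filterlim (\<lambda>n. - (2 * (e / 4)\<^sup>2 / (real K)\<^sup>2) * real n) at_bot sequentially"
      by (intro filterlim_tendsto_neg_mult_at_bot[OF tendsto_const] filterlim_real_sequentially) auto
    then have "(\<lambda>n. exp (- (2 * (e / 4)\<^sup>2 / (real K)\<^sup>2) * real n)) \<longlonglongrightarrow> 0"
      by (rule filterlim_compose[OF exp_at_bot])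
    then show ?thesis using tendsto_mult_right_zero by blast
  qed
  have "\<forall>\<^sub>F n in sequentially. 2 * exp (- (2 * (e / 4)\<^sup>2 / (real K)\<^sup>2) * real n) < d / 2"
    by (rule order_tendstoD(2)[OF lim]) (use d in simp)
  then show "\<forall>\<^sub>F n in sequentially. \<exists>B\<in>events. 1 - d \<le> prob B \<and>
      (\<forall>\<omega>\<in>B. \<bar>(\<Sum>j<n. T j \<omega>) - real n\<bar> \<le> e * real n)"
    using eventually_gt_at_top[of 0]
  proof eventually_elim
    case (elim n)
    let ?A = "{\<omega> \<in> space M. e / 4 * real n \<le> \<bar>(\<Sum>j<n. Z j \<omega>) - real n * c K\<bar>}"
    let ?B = "{\<omega> \<in> space M. e / 4 * real n \<le> (\<Sum>j<n. T j \<omega> - Z j \<omega>)}"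
    have ev: "?A \<in> events" "?B \<in> events" by measurable
    have "prob (?A \<union> ?B) \<le> prob ?A + prob ?B" using ev by (intro measure_Un_le) auto
    then have "1 - d \<le> prob (space M - (?A \<union> ?B))"
      using hoeff[OF elim(2)] markov[OF elim(2)] elim(1) ev by (subst prob_compl) auto
    moreover have "\<bar>(\<Sum>j<n. T j \<omega>) - real n\<bar> \<le> e * real n" if "\<omega> \<in> space M - (?A \<union> ?B)" for \<omega>
    proof -
      \<comment> \<open>The centred truncated sum, the nonnegative remainder and the shift of the
        mean contribute at most \<open>e / 4 * real n\<close> each.\<close>
      have 1: "\<bar>(\<Sum>j<n. Z j \<omega>) - real n * c K\<bar> < e / 4 * real n"
        and 2: "(\<Sum>j<n. T j \<omega>) - (\<Sum>j<n. Z j \<omega>) < e / 4 * real n"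
        using that by (auto simp: sum_subtractf not_le)
      have 3: "0 \<le> (\<Sum>j<n. T j \<omega>) - (\<Sum>j<n. Z j \<omega>)"
        unfolding sum_subtractf[symmetric] by (rule sum_nonneg) (simp add: Z_def)
      have "\<bar>c K - 1\<bar> * real n \<le> e / 4 * real n"
        using K by (intro mult_right_mono) (auto simp: dist_real_def)
      moreover have "real n * c K - real n = (c K - 1) * real n" by (simp add: algebra_simps)
      then have "\<bar>real n * c K - real n\<bar> = \<bar>c K - 1\<bar> * real n" by (simp add: abs_mult)
      ultimately have "\<bar>real n * c K - real n\<bar> \<le> e / 4 * real n" by simp
      moreover have "0 \<le> e * real n" using e by simp
      ultimately show ?thesis using 1 2 3 by linarith
    qed
    ultimately show ?case using ev by (intro bexI[of _ "space M - (?A \<union> ?B)"]) auto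
  qed
qed

end

text \<open>Finiteness is recorded together with the bound, since \<open>card\<close> of an infinite
  set would be 0 and the count meaningless.\<close>

lemma renewal_count_less:
  assumes pos: "\<And>j. 0 < T j" and t: "0 \<le> t" "t < (\<Sum>j<n. T j)"
  shows "finite {k. 1 \<le> k \<and> (\<Sum>j<k. T j) \<le> t}" "renewal_count T t < n"
proof -
  have sub: "{k. 1 \<le> k \<and> (\<Sum>j<k. T j) \<le> t} \<subseteq> {1..<n}"
  proof (clarsimp, rule ccontr)
    fix k assume k: "(\<Sum>j<k. T j) \<le> t" "\<not> k < n"
    then have "(\<Sum>j<n. T j) \<le> (\<Sum>j<k. T j)" by (intro sum_mono2) (auto simp: pos less_imp_le)
    then show False using k t by linarith
  qed
  then show "finite {k. 1 \<le> k \<and> (\<Sum>j<k. T j) \<le> t}" by (rule finite_subset) simp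
  have "0 < n" using t by (cases n) auto
  moreover have "renewal_count T t \<le> card {1..<n}"
    unfolding renewal_count_def using sub by (rule card_mono[rotated]) simp
  ultimately show "renewal_count T t < n" by simp
qed

lemma renewal_count_ge:
  assumes pos: "\<And>j. 0 < T j" and fin: "finite {k. 1 \<le> k \<and> (\<Sum>j<k. T j) \<le> t}" and t: "(\<Sum>j<n. T j) \<le> t"
  shows "n \<le> renewal_count T t"
proof -
  have "{1..n} \<subseteq> {k. 1 \<le> k \<and> (\<Sum>j<k. T j) \<le> t}"
  proof clarsimp
    fix k assume "k \<le> n"
    then have "(\<Sum>j<k. T j) \<le> (\<Sum>j<n. T j)" by (intro sum_mono2) (auto simp: pos less_imp_le)
    then show "(\<Sum>j<k. T j) \<le> t" using t by linarith
  qed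
  from card_mono[OF fin this] show ?thesis by (simp add: renewal_count_def)
qed

text \<open>Counts are inverse to partial sums: the count stays below \<open>n\<close> once the
  \<open>n\<close>-th sum exceeds the time, and reaches \<open>n\<close> if it does not. The law of
  large numbers is read at \<open>n2 N\<close>, about N(\<rho>t + e/2), for the upper bound and at
  \<open>n1 N\<close>, about N(\<rho>t - e/2), for the lower one; the other half of \<open>e\<close>
  absorbs rounding.\<close>

lemma (in prob_space) whp_renewal_count:
  assumes T: "renewal_intervals T" and r: "(\<lambda>N. r N / real N) \<longlonglongrightarrow> \<rho>" "0 < \<rho>" and t: "0 \<le> t" and e: "0 < e"
  shows "whp (\<lambda>N \<omega>. finite {k. 1 \<le> k \<and> (\<Sum>j<k. T j \<omega>) \<le> r N * t} \<and>
    \<bar>real (renewal_count (\<lambda>n. T n \<omega>) (r N * t)) / real N - \<rho> * t\<bar> \<le> e)"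
proof -
  define e1 where "e1 = e / 2"
  have e1: "0 < e1" using e by (simp add: e1_def)
  have "AE \<omega> in M. \<forall>j. 0 < T j \<omega>"
    using T by (subst AE_all_countable) (simp add: renewal_intervals_def)
  then have pos: "whp (\<lambda>N \<omega>. \<forall>j. 0 < T j \<omega>)" by (intro whp_AE always_eventually) simp
  have rt: "(\<lambda>N. r N / real N * t) \<longlonglongrightarrow> \<rho> * t" by (intro tendsto_intros r)
  have gt: "\<forall>\<^sub>F N in sequentially. (0 :: nat) < N" by (rule eventually_gt_at_top)
  have rpos: "\<forall>\<^sub>F N in sequentially. 0 \<le> r N * t"
    using order_tendstoD(1)[OF r] gt
  proof eventually_elim
    case (elim N)
    then show ?case using t by (simp add: zero_less_divide_iff)
  qed
  define c where "c = \<rho> * t + e1"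
  have c: "0 < c" using r t e1 by (simp add: c_def add_nonneg_pos)
  define n2 where "n2 N = nat \<lceil>real N * c\<rceil>" for N
  have n2: "real N * c \<le> real (n2 N)" "real (n2 N) \<le> real N * c + 1" for N
    using c unfolding n2_def by (auto simp: of_nat_ceiling)
  have n2lim: "filterlim n2 sequentially sequentially"
  proof (rule filterlim_at_top_mono[where f = "\<lambda>N. nat \<lfloor>real N * c\<rfloor>"])
    have "filterlim (\<lambda>N. real N * c) at_top sequentially"
      using c by (intro filterlim_at_top_mult_tendsto_pos[OF tendsto_const] filterlim_real_sequentially)
    then show "filterlim (\<lambda>N. nat \<lfloor>real N * c\<rfloor>) sequentially sequentially"
      by (intro filterlim_compose[OF filterlim_nat_sequentially] filterlim_compose[OF filterlim_floor_sequentially])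
    show "\<forall>\<^sub>F N in sequentially. nat \<lfloor>real N * c\<rfloor> \<le> n2 N" by (simp add: n2_def nat_mono floor_le_ceiling)
  qed
  \<comment> \<open>The relative error \<open>e1 / (4 * c)\<close> costs \<open>e1 / 4\<close> of
    the margin \<open>e1\<close> per unit of \<open>N\<close>. The sum then exceeds
    \<open>real N * (\<rho> * t + 3 * e1 / 4)\<close>, beyond the time \<open>r N * t\<close>, which
    lies below \<open>real N * (\<rho> * t + e1 / 2)\<close>.\<close>
  have "whp (\<lambda>N \<omega>. \<bar>(\<Sum>j<n2 N. T j \<omega>) - real (n2 N)\<bar> \<le> e1 / (4 * c) * real (n2 N))"
    by (rule whp_subseq[OF weak_law_of_large_numbers[OF T] n2lim]) (use e1 c in simp)
  from whp_conj[OF pos this]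
  have up: "whp (\<lambda>N \<omega>. finite {k. 1 \<le> k \<and> (\<Sum>j<k. T j \<omega>) \<le> r N * t} \<and>
      real (renewal_count (\<lambda>n. T n \<omega>) (r N * t)) \<le> real N * (\<rho> * t + e))"
  proof (rule whp_mono)
    have "\<forall>\<^sub>F N in sequentially. 1 / e1 < real N" by (rule eventually_real_gt)
    moreover have "\<forall>\<^sub>F N in sequentially. r N / real N * t < \<rho> * t + e1 / 2"
      by (rule order_tendstoD(2)[OF rt]) (use e1 in simp)
    ultimately show "\<forall>\<^sub>F N in sequentially. \<forall>\<omega>\<in>space M. (\<forall>j. 0 < T j \<omega>) \<and>
        \<bar>(\<Sum>j<n2 N. T j \<omega>) - real (n2 N)\<bar> \<le> e1 / (4 * c) * real (n2 N) \<longrightarrow>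
        finite {k. 1 \<le> k \<and> (\<Sum>j<k. T j \<omega>) \<le> r N * t} \<and>
        real (renewal_count (\<lambda>n. T n \<omega>) (r N * t)) \<le> real N * (\<rho> * t + e)"
      using gt rpos
    proof eventually_elim
      case (elim N)
      show ?case
      proof (intro ballI impI, elim conjE)
        fix \<omega> assume pos: "\<forall>j. 0 < T j \<omega>" and S: "\<bar>(\<Sum>j<n2 N. T j \<omega>) - real (n2 N)\<bar> \<le> e1 / (4 * c) * real (n2 N)"
        have "e1 \<le> c" using r t by (simp add: c_def)
        then have "e1 / (4 * c) \<le> 1" using c by simp
        then have "(1 - e1 / (4 * c)) * (real N * c) \<le> (1 - e1 / (4 * c)) * real (n2 N)"
          using n2[of N] by (intro mult_left_mono) auto
        also have "\<dots> \<le> (\<Sum>j<n2 N. T j \<omega>)" using S by (simp add: algebra_simps)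
        also have "(1 - e1 / (4 * c)) * (real N * c) = real N * (\<rho> * t + 3 * e1 / 4)"
          using c by (simp add: field_simps) (simp add: c_def algebra_simps)
        finally have "real N * (\<rho> * t + 3 * e1 / 4) \<le> (\<Sum>j<n2 N. T j \<omega>)" .
        moreover have "r N * t < real N * (\<rho> * t + 3 * e1 / 4)"
        proof -
          have "r N / real N * t < \<rho> * t + 3 * e1 / 4" using elim e1 by linarith
          then show ?thesis using elim by (simp add: field_simps)
        qed
        ultimately have lt: "r N * t < (\<Sum>j<n2 N. T j \<omega>)" by linarith
        note * = renewal_count_less[of "\<lambda>j. T j \<omega>", OF _ elim(4) lt]
        have "real (renewal_count (\<lambda>n. T n \<omega>) (r N * t)) \<le> real N * c + 1"
          using *(2) pos n2(2)[of N] by (meson less_imp_le of_nat_le_iff order_trans)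
        moreover have "1 \<le> real N * e1" using elim e1 by (simp add: field_simps)
        moreover have "real N * (\<rho> * t + e) = real N * c + real N * e1" by (simp add: c_def e1_def algebra_simps)
        ultimately show "finite {k. 1 \<le> k \<and> (\<Sum>j<k. T j \<omega>) \<le> r N * t} \<and>
          real (renewal_count (\<lambda>n. T n \<omega>) (r N * t)) \<le> real N * (\<rho> * t + e)"
          using *(1) pos by auto
      qed
    qed
  qed
  have low: "whp (\<lambda>N \<omega>. real N * (\<rho> * t - e) \<le> real (renewal_count (\<lambda>n. T n \<omega>) (r N * t)))"
  proof (cases "\<rho> * t \<le> e1")
    \<comment> \<open>Here the lower bound is nonpositive and holds trivially; the index
      \<open>n1 N\<close> of the other case would not tend to infinity.\<close>
    case True
    have "real N * (\<rho> * t - e) \<le> 0" for N using True e by (intro mult_nonneg_nonpos) (auto simp: e1_def)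
    then show ?thesis
      using order_trans[OF _ of_nat_0_le_iff] by (intro whp_eventually always_eventually) blast
  next
    case False
    define c' where "c' = \<rho> * t - e1"
    have c': "0 < c'" using False by (simp add: c'_def)
    define n1 where "n1 N = nat \<lfloor>real N * c'\<rfloor>" for N
    have n1: "real (n1 N) \<le> real N * c'" "real N * c' - 1 \<le> real (n1 N)" for N
      using c' unfolding n1_def by (auto simp: of_nat_floor)
    have n1lim: "filterlim n1 sequentially sequentially"
    proof -
      have "filterlim (\<lambda>N. real N * c') at_top sequentially"
        using c' by (intro filterlim_at_top_mult_tendsto_pos[OF tendsto_const] filterlim_real_sequentially)
      then show ?thesis unfolding n1_def
        by (intro filterlim_compose[OF filterlim_nat_sequentially] filterlim_compose[OF filterlim_floor_sequentially])
    qed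
    \<comment> \<open>The relative error \<open>e1 / (2 * c')\<close> raises the sum to at most
      \<open>real N * (\<rho> * t - e1 / 2)\<close>, still below \<open>r N * t\<close> for large
      \<open>N\<close>.\<close>
    have "whp (\<lambda>N \<omega>. \<bar>(\<Sum>j<n1 N. T j \<omega>) - real (n1 N)\<bar> \<le> e1 / (2 * c') * real (n1 N))"
      by (rule whp_subseq[OF weak_law_of_large_numbers[OF T] n1lim]) (use e1 c' in simp)
    from whp_conj[OF whp_conj[OF pos up] this] show ?thesis
    proof (rule whp_mono)
      have "\<forall>\<^sub>F N in sequentially. 1 / e1 < real N" by (rule eventually_real_gt)
      moreover have "\<forall>\<^sub>F N in sequentially. \<rho> * t - e1 / 2 < r N / real N * t"
        by (rule order_tendstoD(1)[OF rt]) (use e1 in simp)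
      ultimately show "\<forall>\<^sub>F N in sequentially. \<forall>\<omega>\<in>space M. ((\<forall>j. 0 < T j \<omega>) \<and>
          finite {k. 1 \<le> k \<and> (\<Sum>j<k. T j \<omega>) \<le> r N * t} \<and>
          real (renewal_count (\<lambda>n. T n \<omega>) (r N * t)) \<le> real N * (\<rho> * t + e)) \<and>
          \<bar>(\<Sum>j<n1 N. T j \<omega>) - real (n1 N)\<bar> \<le> e1 / (2 * c') * real (n1 N) \<longrightarrow>
          real N * (\<rho> * t - e) \<le> real (renewal_count (\<lambda>n. T n \<omega>) (r N * t))"
        using gt
      proof eventually_elim
        case (elim N)
        show ?case
        proof (intro ballI impI, elim conjE)
          fix \<omega> assume pos: "\<forall>j. 0 < T j \<omega>" and fin: "finite {k. 1 \<le> k \<and> (\<Sum>j<k. T j \<omega>) \<le> r N * t}"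
            and S: "\<bar>(\<Sum>j<n1 N. T j \<omega>) - real (n1 N)\<bar> \<le> e1 / (2 * c') * real (n1 N)"
          have "(\<Sum>j<n1 N. T j \<omega>) \<le> (1 + e1 / (2 * c')) * real (n1 N)" using S by (simp add: algebra_simps)
          also have "\<dots> \<le> (1 + e1 / (2 * c')) * (real N * c')"
            using n1[of N] e1 c' by (intro mult_left_mono) auto
          also have "\<dots> = real N * (\<rho> * t - e1 / 2)"
            using c' by (simp add: field_simps) (simp add: c'_def algebra_simps)
          also have "\<dots> \<le> r N * t" using elim by (simp add: field_simps)
          finally have "n1 N \<le> renewal_count (\<lambda>n. T n \<omega>) (r N * t)"
            using renewal_count_ge[of "\<lambda>j. T j \<omega>", OF _ fin] pos by auto
          moreover have "1 \<le> real N * e1" using elim e1 by (simp add: field_simps)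
          moreover have "real N * (\<rho> * t - e) = real N * c' - real N * e1" by (simp add: c'_def e1_def algebra_simps)
          ultimately show "real N * (\<rho> * t - e) \<le> real (renewal_count (\<lambda>n. T n \<omega>) (r N * t))"
            using n1(2)[of N] by linarith
        qed
      qed
    qed
  qed
  from whp_conj[OF up low] show ?thesis
    by (rule whp_mono, use gt in eventually_elim) (auto simp: abs_le_iff field_simps)
qed

text \<open>Finiteness at the last time \<open>S\<close> yields it at all earlier ones, and with it
  monotonicity of the counts, which makes pointwise closeness uniform.\<close>

lemma (in prob_space) whp_renewal_count_uniform:
  assumes T: "renewal_intervals T" and r: "(\<lambda>N. r N / real N) \<longlonglongrightarrow> \<rho>" "0 < \<rho>" and e: "0 < e"
  shows "whp (\<lambda>N \<omega>. \<forall>t\<in>{0..S}. finite {k. 1 \<le> k \<and> (\<Sum>j<k. T j \<omega>) \<le> r N * t} \<and>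
    \<bar>real (renewal_count (\<lambda>n. T n \<omega>) (r N * t)) - \<rho> * real N * t\<bar> \<le> e * real N)"
proof (cases "0 \<le> S")
  case S: True
  have gt: "\<forall>\<^sub>F N in sequentially. (0 :: nat) < N" by (rule eventually_gt_at_top)
  have rpos: "\<forall>\<^sub>F N in sequentially. 0 < r N"
    using order_tendstoD(1)[OF r] gt by eventually_elim (simp add: zero_less_divide_iff)
  have "whp (\<lambda>N \<omega>. finite {k. 1 \<le> k \<and> (\<Sum>j<k. T j \<omega>) \<le> r N * S})"
    by (rule whp_mono[OF whp_renewal_count[OF T r S zero_less_one]]) simp
  then have fin: "whp (\<lambda>N \<omega>. \<forall>t\<in>{0..S}. finite {k. 1 \<le> k \<and> (\<Sum>j<k. T j \<omega>) \<le> r N * t})"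
  proof (rule whp_mono)
    show "\<forall>\<^sub>F N in sequentially. \<forall>\<omega>\<in>space M. finite {k. 1 \<le> k \<and> (\<Sum>j<k. T j \<omega>) \<le> r N * S} \<longrightarrow>
       (\<forall>t\<in>{0..S}. finite {k. 1 \<le> k \<and> (\<Sum>j<k. T j \<omega>) \<le> r N * t})"
      using rpos
    proof eventually_elim
      case (elim N)
      have "r N * t \<le> r N * S" if "t \<le> S" for t using that elim by simp
      then show ?case by (force elim!: finite_subset[rotated])
    qed
  qed
  then have mono: "whp (\<lambda>N \<omega>. mono_on {0..S} (\<lambda>t. real (renewal_count (\<lambda>n. T n \<omega>) (r N * t)) / real N))"
  proof (rule whp_mono)
    show "\<forall>\<^sub>F N in sequentially. \<forall>\<omega>\<in>space M. (\<forall>t\<in>{0..S}. finite {k. 1 \<le> k \<and> (\<Sum>j<k. T j \<omega>) \<le> r N * t}) \<longrightarrow>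
       mono_on {0..S} (\<lambda>t. real (renewal_count (\<lambda>n. T n \<omega>) (r N * t)) / real N)"
      using rpos
    proof eventually_elim
      case (elim N)
      have "renewal_count (\<lambda>n. T n \<omega>) (r N * s) \<le> renewal_count (\<lambda>n. T n \<omega>) (r N * t)"
        if "finite {k. 1 \<le> k \<and> (\<Sum>j<k. T j \<omega>) \<le> r N * t}" "s \<le> t" for \<omega> s t
      proof -
        have "r N * s \<le> r N * t" using that elim by simp
        then show ?thesis unfolding renewal_count_def using that(1) by (intro card_mono) auto
      qed
      then show ?case by (auto simp: mono_on_def intro!: divide_right_mono)
    qed
  qed
  have "whp (\<lambda>N \<omega>. \<forall>t\<in>{0..S}. \<bar>real (renewal_count (\<lambda>n. T n \<omega>) (r N * t)) / real N - \<rho> * t\<bar> \<le> e)"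
  proof (rule whp_uniform_mono[OF _ mono _ e])
    show "continuous_on {0..S} (\<lambda>t. \<rho> * t)" by (intro continuous_intros)
    show "whp (\<lambda>N \<omega>. \<bar>real (renewal_count (\<lambda>n. T n \<omega>) (r N * t)) / real N - \<rho> * t\<bar> \<le> e)"
      if "t \<in> {0..S}" "0 < e" for t e
      by (rule whp_mono[OF whp_renewal_count[OF T r _ that(2)]]) (use that in auto)
  qed
  from whp_conj[OF fin this] show ?thesis
  proof (rule whp_mono, use gt in eventually_elim)
    case (elim N)
    have "\<bar>x - \<rho> * real N * t\<bar> \<le> e * real N" if "\<bar>x / real N - \<rho> * t\<bar> \<le> e" for x t
    proof -
      have "\<bar>x / real N - \<rho> * t\<bar> * real N \<le> e * real N" using that by (intro mult_right_mono) auto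
      moreover have "\<bar>x / real N - \<rho> * t\<bar> * real N = \<bar>x - \<rho> * real N * t\<bar>"
      proof -
        have "\<bar>x / real N - \<rho> * t\<bar> * real N = \<bar>(x / real N - \<rho> * t) * real N\<bar>" by (simp add: abs_mult)
        also have "(x / real N - \<rho> * t) * real N = x - \<rho> * real N * t" using elim by (simp add: field_simps)
        finally show ?thesis .
      qed
      ultimately show ?thesis by simp
    qed
    then show ?case by blast
  qed
qed (auto intro!: whp_eventually)

section \<open>Counting deadlines\<close>

text \<open>The thresholds vary with \<open>i\<close>, so the indicators are independent but not
  identically distributed; Hoeffding's inequality asks only for bounded summands. With at most
  \<open>K * real N\<close> of them, a deviation of order \<open>N\<close> has exponentially small
  probability.\<close>

lemma (in prob_space) whp_count_le:
  fixes u :: "nat \<Rightarrow> int \<Rightarrow> 'a \<Rightarrow> real"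
  assumes indep: "\<And>N. 1 \<le> N \<Longrightarrow> indep_vars (\<lambda>_. borel) (u N) {1..}"
    and law: "\<And>N i. 1 \<le> N \<Longrightarrow> 1 \<le> i \<Longrightarrow> distr M borel (u N i) = nuN N"
    and n: "\<And>N. real (n N) \<le> K * real N" "0 < K" and e: "0 < e"
  shows "whp (\<lambda>N \<omega>. \<bar>real (card {i \<in> {1..int (n N)}. u N i \<omega> \<le> c N i}) - (\<Sum>i=1..int (n N). cdf (nuN N) (c N i))\<bar> \<le> e * real N)"
proof (rule whp_prob)
  let ?S = "\<lambda>N \<omega>. \<Sum>i=1..int (n N). of_bool (u N i \<omega> \<le> c N i) :: real"
  let ?m = "\<lambda>N. \<Sum>i=1..int (n N). cdf (nuN N) (c N i)"
  \<comment> \<open>No bad event is required at \<open>N = 0\<close>, where nothing is assumed, nor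
    at \<open>n N = 0\<close>, where count and mean both vanish and the variance term of Hoeffding's
    bound would be 0.\<close>
  define B where "B N = (if 1 \<le> N \<and> 1 \<le> n N then {\<omega> \<in> space M. e * real N \<le> \<bar>?S N \<omega> - ?m N\<bar>} else {})" for N
  have B: "B N \<in> events \<and> prob (B N) \<le> 2 * exp (- (2 * e\<^sup>2 / K) * real N)" if N: "1 \<le> N" for N
  proof (cases "1 \<le> n N")
    case True
    have u [measurable]: "u N i \<in> borel_measurable M" if "i \<in> {1..int (n N)}" for i
      using indep[OF N] that unfolding indep_vars_def by auto
    have exp: "expectation (\<lambda>\<omega>. of_bool (u N i \<omega> \<le> c N i)) = cdf (nuN N) (c N i)" if "i \<in> {1..int (n N)}" for i
    proof -
      have "expectation (\<lambda>\<omega>. of_bool (u N i \<omega> \<le> c N i)) = expectation (indicator (u N i -` {..c N i} \<inter> space M))"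
        by (rule Bochner_Integration.integral_cong) (auto simp: indicator_def)
      also have "\<dots> = prob (u N i -` {..c N i} \<inter> space M)" by simp
      also have "\<dots> = measure (distr M borel (u N i)) {..c N i}"
        using u[OF that] by (subst measure_distr) auto
      also have "\<dots> = cdf (nuN N) (c N i)" using law[OF N, of i] that by (simp add: cdf_def)
      finally show ?thesis .
    qed
    interpret Hoeffding_ineq M "{1..int (n N)}" "\<lambda>i \<omega>. of_bool (u N i \<omega> \<le> c N i)" "\<lambda>_. 0" "\<lambda>_. 1" "?m N"
    proof unfold_locales
      have "indep_vars (\<lambda>_. borel) (u N) {1..int (n N)}"
        by (rule indep_vars_subset[OF indep[OF N]]) auto
      then show "indep_vars (\<lambda>_. borel) (\<lambda>i \<omega>. of_bool (u N i \<omega> \<le> c N i) :: real) {1..int (n N)}"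
        by (rule indep_vars_compose2[where Y = "\<lambda>i x. of_bool (x \<le> c N i)"]) measurable
      show "?m N \<equiv> \<Sum>i=1..int (n N). expectation (\<lambda>\<omega>. of_bool (u N i \<omega> \<le> c N i))"
        using exp by (intro eq_reflection sum.cong) auto
    qed auto
    have "prob {\<omega> \<in> space M. e * real N \<le> \<bar>?S N \<omega> - ?m N\<bar>}
        \<le> 2 * exp (- 2 * (e * real N)\<^sup>2 / (\<Sum>i=1..int (n N). (1 - 0)\<^sup>2))"
      by (rule Hoeffding_ineq_abs_ge) (use e True in auto)
    also have "\<dots> \<le> 2 * exp (- (2 * e\<^sup>2 / K) * real N)"
    proof -
      have "2 * (e * real N)\<^sup>2 / (K * real N) \<le> 2 * (e * real N)\<^sup>2 / real (n N)"
        using n True N by (intro divide_left_mono) auto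
      moreover have "2 * (e * real N)\<^sup>2 / (K * real N) = 2 * e\<^sup>2 / K * real N"
        using n N by (simp add: power2_eq_square)
      ultimately show ?thesis by simp
    qed
    finally have "prob {\<omega> \<in> space M. e * real N \<le> \<bar>?S N \<omega> - ?m N\<bar>} \<le> 2 * exp (- (2 * e\<^sup>2 / K) * real N)" .
    moreover have "{\<omega> \<in> space M. e * real N \<le> \<bar>?S N \<omega> - ?m N\<bar>} \<in> events" by measurable
    ultimately show ?thesis using N True by (simp add: B_def)
  qed (simp add: B_def)
  show "B N \<in> events" for N using B[of N] by (cases "1 \<le> N") (auto simp: B_def)
  show "(\<lambda>N. prob (B N)) \<longlonglongrightarrow> 0"
  proof (rule tendsto_sandwich)
    show "\<forall>\<^sub>F N in sequentially. 0 \<le> prob (B N)" by simp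
    show "\<forall>\<^sub>F N in sequentially. prob (B N) \<le> 2 * exp (- (2 * e\<^sup>2 / K) * real N)"
      using eventually_ge_at_top[of 1] by eventually_elim (use B in blast)
    have "0 < 2 * e\<^sup>2 / K" using e n by simp
    then have "filterlim (\<lambda>N. - (2 * e\<^sup>2 / K) * real N) at_bot sequentially"
      by (intro filterlim_tendsto_neg_mult_at_bot[OF tendsto_const] filterlim_real_sequentially) auto
    then have "(\<lambda>N. exp (- (2 * e\<^sup>2 / K) * real N)) \<longlonglongrightarrow> 0"
      by (rule filterlim_compose[OF exp_at_bot])
    then show "(\<lambda>N. 2 * exp (- (2 * e\<^sup>2 / K) * real N)) \<longlonglongrightarrow> 0" using tendsto_mult_right_zero by blast
  qed auto
  show "\<forall>\<^sub>F N in sequentially. \<forall>\<omega>\<in>space M - B N.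
      \<bar>real (card {i \<in> {1..int (n N)}. u N i \<omega> \<le> c N i}) - ?m N\<bar> \<le> e * real N"
    using eventually_ge_at_top[of 1]
  proof eventually_elim
    case (elim N)
    have "?S N \<omega> = real (card {i \<in> {1..int (n N)}. u N i \<omega> \<le> c N i})" for \<omega>
      by (simp add: sum_of_bool_eq Int_def)
    then show ?case using elim e by (auto simp: B_def not_le intro: less_imp_le split: if_splits)
  qed
qed

text \<open>For monotone \<open>G\<close> this is the sum over left end points of the cells counted
  back from \<open>t\<close>. Left and right sums differ by a telescoping total of at most
  \<open>h\<close>, and the incomplete cell next to 0 costs at most another \<open>h\<close>.
  Continuity of \<open>G\<close> plays no part in the estimate.\<close>

lemma mono_riemann_sum:
  fixes G :: "real \<Rightarrow> real"
  assumes mono: "mono G" and G: "\<And>x. 0 \<le> G x" "\<And>x. G x \<le> 1" and h: "0 < h" and t: "0 \<le> t"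
  defines "m \<equiv> nat \<lfloor>t / h\<rfloor>"
  shows "\<bar>h * (\<Sum>i=1..int m. G (t - of_int i * h)) - integral {0..t} G\<bar> \<le> 2 * h"
proof -
  have int: "G integrable_on {p..q}" for p q
    using mono by (intro integrable_on_mono_on) (auto simp: mono_def mono_on_def)
  \<comment> \<open>In \<open>up\<close>, the summand \<open>h * G (t - real m * h)\<close> on the
    left makes the induction close: it dominates the integral over the next cell.\<close>
  have low: "h * (\<Sum>i=1..int m. G (t - of_int i * h)) \<le> integral {t - real m * h..t} G"
    and up: "integral {t - real m * h..t} G + h * G (t - real m * h) \<le> h + h * (\<Sum>i=1..int m. G (t - of_int i * h))" for m
  proof (induction m)
    case 0
    { case 1 show ?case by simp }
    { case 2 show ?case using G(2)[of t] h by simp }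
  next
    case (Suc m)
    have set: "{1..int (Suc m)} = insert (int (Suc m)) {1..int m}" by auto
    have sum: "(\<Sum>i=1..int (Suc m). G (t - of_int i * h)) = G (t - real (Suc m) * h) + (\<Sum>i=1..int m. G (t - of_int i * h))"
      unfolding set by (subst sum.insert) auto
    have le: "t - real (Suc m) * h \<le> t - real m * h" "t - real m * h \<le> t" using h by (auto simp: algebra_simps)
    have comb: "integral {t - real (Suc m) * h..t} G = integral {t - real (Suc m) * h..t - real m * h} G + integral {t - real m * h..t} G"
      using le int by (intro Henstock_Kurzweil_Integration.integral_combine[symmetric]) auto
    have "integral {t - real (Suc m) * h..t - real m * h} (\<lambda>_. G (t - real (Suc m) * h)) \<le> integral {t - real (Suc m) * h..t - real m * h} G"
      using mono int by (intro integral_le) (auto simp: mono_def)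
    then have lo: "h * G (t - real (Suc m) * h) \<le> integral {t - real (Suc m) * h..t - real m * h} G"
      using h by (simp add: algebra_simps)
    have "integral {t - real (Suc m) * h..t - real m * h} G \<le> integral {t - real (Suc m) * h..t - real m * h} (\<lambda>_. G (t - real m * h))"
      using mono int by (intro integral_le) (auto simp: mono_def)
    then have hi: "integral {t - real (Suc m) * h..t - real m * h} G \<le> h * G (t - real m * h)"
      using h by (simp add: algebra_simps)
    { case 1 show ?case using Suc.IH(1) lo unfolding sum comb distrib_left by linarith }
    { case 2 show ?case using Suc.IH(2) hi unfolding sum comb distrib_left by linarith }
  qed
  have "0 \<le> t / h" using t h by simp
  then have "real m \<le> t / h" "t / h < real m + 1" by (auto simp: m_def)
  then have m: "0 \<le> t - real m * h" "t - real m * h \<le> h" "0 \<le> real m * h" using h by (auto simp: field_simps)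
  have comb: "integral {0..t} G = integral {0..t - real m * h} G + integral {t - real m * h..t} G"
    using m int by (intro Henstock_Kurzweil_Integration.integral_combine[symmetric]) auto
  have "0 \<le> integral {0..t - real m * h} G" using int G by (intro integral_nonneg) auto
  moreover have "integral {0..t - real m * h} G \<le> integral {0..t - real m * h} (\<lambda>_. 1)"
    using int G by (intro integral_le) auto
  then have "integral {0..t - real m * h} G \<le> h" using m by simp
  moreover have "0 \<le> h * G (t - real m * h)" using h G by simp
  ultimately show ?thesis using low[of m] up[of m] comb by linarith
qed

text \<open>Weak convergence gives convergence at all continuity points of the limit. The jumps are
  countably many, hence null for Lebesgue measure, and dominated convergence applies.\<close>

lemma cdf_integral_tendsto:
  assumes "\<And>N. real_distribution (nuN N)" "real_distribution nu" "weak_conv_m nuN nu"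
  shows "(\<lambda>N. integral {0..t} (cdf (nuN N))) \<longlonglongrightarrow> integral {0..t} (cdf nu)"
proof -
  have mono: "mono (cdf M)" if "real_distribution M" for M
  proof -
    interpret real_distribution M by fact
    show ?thesis by (rule monoI) (rule cdf_nondecreasing)
  qed
  have bound: "0 \<le> cdf M x" "cdf M x \<le> 1" if "real_distribution M" for M x
  proof -
    interpret real_distribution M by fact
    show "0 \<le> cdf M x" "cdf M x \<le> 1" by (rule cdf_nonneg, rule cdf_bounded_prob)
  qed
  have int: "set_integrable lborel {0..t} (cdf M)" if "real_distribution M" for M
    unfolding set_integrable_def
    using borel_measurable_mono[OF mono[OF that]] bound[OF that]
    by (intro integrableI_bounded_set[where A = "{0..t}" and B = 1]) (auto simp: emeasure_lborel_Icc_eq indicator_def)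
  have "(\<lambda>N. \<integral>x. indicator {0..t} x *\<^sub>R cdf (nuN N) x \<partial>lborel) \<longlonglongrightarrow> (\<integral>x. indicator {0..t} x *\<^sub>R cdf nu x \<partial>lborel)"
  proof (rule integral_dominated_convergence[where w = "indicator {0..t}"])
    show "(\<lambda>x. indicator {0..t} x *\<^sub>R cdf nu x) \<in> borel_measurable lborel"
      "(\<lambda>x. indicator {0..t} x *\<^sub>R cdf (nuN N) x) \<in> borel_measurable lborel" for N
      using int assms unfolding set_integrable_def by auto
    show "integrable lborel (indicator {0..t} :: real \<Rightarrow> real)" by (simp add: emeasure_lborel_Icc_eq)
    have "countable {x. \<not> isCont (cdf nu) x}" by (rule mono_ctble_discont[OF mono[OF assms(2)]])
    then have "AE x in lborel. x \<notin> {x. \<not> isCont (cdf nu) x}"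
      by (intro AE_not_in countable_imp_null_set_lborel)
    then show "AE x in lborel. (\<lambda>N. indicator {0..t} x *\<^sub>R cdf (nuN N) x) \<longlonglongrightarrow> indicator {0..t} x *\<^sub>R cdf nu x"
    proof eventually_elim
      case (elim x)
      then have "(\<lambda>N. cdf (nuN N) x) \<longlonglongrightarrow> cdf nu x"
        using assms(3) by (auto simp: weak_conv_m_def weak_conv_def)
      then show ?case by (intro tendsto_intros)
    qed
    show "AE x in lborel. norm (indicator {0..t} x *\<^sub>R cdf (nuN N) x) \<le> indicator {0..t} x" for N
      using bound[OF assms(1)] by (auto simp: indicator_def)
  qed
  then show ?thesis
    using set_borel_integral_eq_integral(2)[OF int[OF assms(1)]] set_borel_integral_eq_integral(2)[OF int[OF assms(2)]]
    by (simp add: set_lebesgue_integral_def)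
qed

section \<open>Deadlines of arriving customers\<close>

locale lead_times = prob_space M for M :: "'a measure" +
  fixes u :: "nat \<Rightarrow> int \<Rightarrow> 'a \<Rightarrow> real" and nuN :: "nat \<Rightarrow> real measure" and nu :: "real measure"
  assumes indep: "\<And>N. 1 \<le> N \<Longrightarrow> indep_vars (\<lambda>_. borel) (u N) {1..}"
    and law: "\<And>N i. 1 \<le> N \<Longrightarrow> 1 \<le> i \<Longrightarrow> distr M borel (u N i) = nuN N"
    and pos: "whp (\<lambda>N \<omega>. \<forall>i\<ge>1. 0 < u N i \<omega>)"
    and nuN: "\<And>N. real_distribution (nuN N)" and nu: "real_distribution nu" and weak: "weak_conv_m nuN nu"
begin

lemma mono_cdf: "mono (cdf nu)" "mono (cdf (nuN N))"
proof -
  interpret nu: real_distribution nu by (rule nu)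
  interpret nuN: real_distribution "nuN N" by (rule nuN)
  show "mono (cdf nu)" "mono (cdf (nuN N))"
    by (auto intro!: monoI nu.cdf_nondecreasing nuN.cdf_nondecreasing)
qed

lemma cdf_01: "0 \<le> cdf nu x" "cdf nu x \<le> 1" "0 \<le> cdf (nuN N) x" "cdf (nuN N) x \<le> 1"
proof -
  interpret nu: real_distribution nu by (rule nu)
  interpret nuN: real_distribution "nuN N" by (rule nuN)
  show "0 \<le> cdf nu x" "cdf nu x \<le> 1" "0 \<le> cdf (nuN N) x" "cdf (nuN N) x \<le> 1"
    by (rule nu.cdf_nonneg nu.cdf_bounded_prob nuN.cdf_nonneg nuN.cdf_bounded_prob)+
qed

lemma integrable_cdf: "cdf nu integrable_on {p..q}"
  using mono_cdf(1) by (intro integrable_on_mono_on) (auto simp: mono_def mono_on_def)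

text \<open>After reflection of the variable, \<open>lam * Gamma t\<close> is \<lambda> times the
  integral of G(t - s) over s in [0, t]: the fluid mass of the arrivals whose deadline has passed by
  \<open>t\<close>.\<close>

definition Gamma :: "real \<Rightarrow> real" where
  "Gamma t = integral {0..t} (cdf nu)"

text \<open>Holds because the integrand lies between 0 and 1, jumps or not. This allows small errors
  in arrival times to be traded for small errors in \<open>Gamma\<close>.\<close>

lemma Gamma_lipschitz: "0 \<le> s \<Longrightarrow> s \<le> t \<Longrightarrow> Gamma s \<le> Gamma t \<and> Gamma t \<le> Gamma s + (t - s)"
proof -
  assume st: "0 \<le> s" "s \<le> t"
  have "Gamma t = Gamma s + integral {s..t} (cdf nu)"
    unfolding Gamma_def using st integrable_cdf by (intro Henstock_Kurzweil_Integration.integral_combine[symmetric]) auto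
  moreover have "0 \<le> integral {s..t} (cdf nu)" using integrable_cdf cdf_01 by (intro integral_nonneg) auto
  moreover have "integral {s..t} (cdf nu) \<le> integral {s..t} (\<lambda>_. 1)"
    using integrable_cdf cdf_01 by (intro integral_le) auto
  ultimately show "Gamma s \<le> Gamma t \<and> Gamma t \<le> Gamma s + (t - s)" using st by simp
qed

lemma continuous_on_Gamma: "continuous_on {0..} Gamma"
proof (rule continuous_onI)
  fix x e :: real assume "x \<in> {0..}" "0 < e"
  then have "dist (Gamma x') (Gamma x) \<le> dist x' x" if "x' \<in> {0..}" for x'
    using Gamma_lipschitz[of x x'] Gamma_lipschitz[of x' x] that by (cases "x \<le> x'") (auto simp: dist_real_def)
  then show "\<exists>d>0. \<forall>x'\<in>{0..}. dist x' x < d \<longrightarrow> dist (Gamma x') (Gamma x) \<le> e"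
    using \<open>0 < e\<close> by (meson order_less_imp_le order_trans)
qed

text \<open>The \<open>i\<close>-th arrival is placed at \<open>i / (lam * N)\<close>, with the
  limiting rate \<open>lam\<close>, instead of at its true time. The thresholds for the lead times
  thereby become deterministic; the true times return in \<open>expired_approx\<close>.\<close>

definition deadline_count :: "real \<Rightarrow> nat \<Rightarrow> 'a \<Rightarrow> real \<Rightarrow> nat" where
  "deadline_count lam N \<omega> t = card {i. 1 \<le> i \<and> of_int i / (lam * real N) + u N i \<omega> \<le> t}"

text \<open>A positive lead time forces \<open>i / (lam * N) < t\<close>, so only finitely many
  indices matter. The right-hand side has the shape of \<open>whp_count_le\<close>, with thresholds
  on a grid of mesh \<open>1 / (lam * N)\<close> as in \<open>mono_riemann_sum\<close>.\<close>

lemma deadlines_eq: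
  assumes lam: "0 < lam" "1 \<le> N" and u: "\<forall>i\<ge>1. 0 < u N i \<omega>"
  shows "{i. 1 \<le> i \<and> of_int i / (lam * real N) + u N i \<omega> \<le> t} =
    {i \<in> {1..int (nat \<lfloor>t / (1 / (lam * real N))\<rfloor>)}. u N i \<omega> \<le> t - of_int i * (1 / (lam * real N))}"
proof -
  have "i \<le> int (nat \<lfloor>t / (1 / (lam * real N))\<rfloor>)" if i: "1 \<le> i" "of_int i / (lam * real N) + u N i \<omega> \<le> t" for i
  proof -
    have "of_int i / (lam * real N) < t" using u i by (smt (verit))
    then have "of_int i < t * (lam * real N)" using lam by (simp add: field_simps)
    then have "i \<le> \<lfloor>t / (1 / (lam * real N))\<rfloor>" by (simp add: le_floor_iff)
    then show ?thesis by linarith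
  qed
  then show ?thesis by (auto simp: algebra_simps)
qed

lemma finite_deadlines:
  assumes "0 < lam" "1 \<le> N" "\<forall>i\<ge>1. 0 < u N i \<omega>"
  shows "finite {i. 1 \<le> i \<and> of_int i / (lam * real N) + u N i \<omega> \<le> t}"
  unfolding deadlines_eq[OF assms] by (rule finite_subset[of _ "{1..int (nat \<lfloor>t / (1 / (lam * real N))\<rfloor>)}"]) auto

text \<open>Three errors add up to \<open>e\<close>: \<open>e / 2\<close> for the fluctuation of the
  count about its mean, \<open>2 / N \<le> e / 4\<close> for the Riemann sum, and
  \<open>e / 4\<close> for the weak convergence of the lead time laws.\<close>

lemma whp_deadline_count:
  assumes lam: "0 < lam" and t: "0 \<le> t" and e: "0 < e"
  shows "whp (\<lambda>N \<omega>. \<bar>real (deadline_count lam N \<omega> t) / real N - lam * Gamma t\<bar> \<le> e)"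
proof -
  define h where "h N = 1 / (lam * real N)" for N :: nat
  define n where "n N = nat \<lfloor>t / h N\<rfloor>" for N
  have n: "real (n N) \<le> (lam * t + 1) * real N" for N
  proof -
    have "0 \<le> t / h N" using t lam by (simp add: h_def)
    then have "real (n N) \<le> t / h N" by (simp add: n_def)
    also have "\<dots> = lam * t * real N" by (simp add: h_def)
    also have "\<dots> \<le> (lam * t + 1) * real N" by (simp add: algebra_simps)
    finally show ?thesis .
  qed
  have K: "0 < lam * t + 1" using lam t by (simp add: add_nonneg_pos)
  have "whp (\<lambda>N \<omega>. \<bar>real (card {i \<in> {1..int (n N)}. u N i \<omega> \<le> t - of_int i * h N}) -
      (\<Sum>i=1..int (n N). cdf (nuN N) (t - of_int i * h N))\<bar> \<le> e / 2 * real N)"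
    by (rule whp_count_le[OF indep law n K]) (use e in auto)
  from whp_conj[OF pos this] show ?thesis
  proof (rule whp_mono)
    have "(\<lambda>N. integral {0..t} (cdf (nuN N))) \<longlonglongrightarrow> Gamma t"
      unfolding Gamma_def by (rule cdf_integral_tendsto[OF nuN nu weak])
    then have "\<forall>\<^sub>F N in sequentially. dist (integral {0..t} (cdf (nuN N))) (Gamma t) < e / (4 * lam)"
      by (rule tendstoD) (use e lam in simp)
    moreover have "\<forall>\<^sub>F N in sequentially. 8 / e < real N" by (rule eventually_real_gt)
    ultimately show "\<forall>\<^sub>F N in sequentially. \<forall>\<omega>\<in>space M. (\<forall>i\<ge>1. 0 < u N i \<omega>) \<and>
        \<bar>real (card {i \<in> {1..int (n N)}. u N i \<omega> \<le> t - of_int i * h N}) -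
        (\<Sum>i=1..int (n N). cdf (nuN N) (t - of_int i * h N))\<bar> \<le> e / 2 * real N \<longrightarrow>
        \<bar>real (deadline_count lam N \<omega> t) / real N - lam * Gamma t\<bar> \<le> e"
      using eventually_ge_at_top[of 1]
    proof eventually_elim
      case (elim N)
      have hN: "0 < h N" using lam elim by (simp add: h_def)
      let ?s = "\<Sum>i=1..int (n N). cdf (nuN N) (t - of_int i * h N)"
      have "\<bar>h N * ?s - integral {0..t} (cdf (nuN N))\<bar> \<le> 2 * h N"
        unfolding n_def by (rule mono_riemann_sum[OF mono_cdf(2) cdf_01(3,4) hN t])
      then have "\<bar>h N * ?s - Gamma t\<bar> \<le> 2 * h N + e / (4 * lam)"
        using elim(1) by (simp add: dist_real_def)
      then have "lam * \<bar>h N * ?s - Gamma t\<bar> \<le> lam * (2 * h N + e / (4 * lam))"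
        using lam by (intro mult_left_mono) auto
      moreover have "lam * \<bar>h N * ?s - Gamma t\<bar> = \<bar>?s / real N - lam * Gamma t\<bar>"
      proof -
        have "lam * \<bar>h N * ?s - Gamma t\<bar> = \<bar>lam * (h N * ?s - Gamma t)\<bar>" using lam by (simp add: abs_mult)
        also have "lam * (h N * ?s - Gamma t) = ?s / real N - lam * Gamma t"
          using lam elim by (simp add: h_def field_simps)
        finally show ?thesis .
      qed
      moreover have "lam * (2 * h N + e / (4 * lam)) = 2 / real N + e / 4"
        using lam elim by (simp add: h_def field_simps)
      moreover have "2 / real N \<le> e / 4" using elim e by (simp add: field_simps)
      ultimately have mean: "\<bar>?s / real N - lam * Gamma t\<bar> \<le> e / 2" by linarith
      show ?case
      proof (intro ballI impI, elim conjE)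
        fix \<omega> assume u: "\<forall>i\<ge>1. 0 < u N i \<omega>"
          and c: "\<bar>real (card {i \<in> {1..int (n N)}. u N i \<omega> \<le> t - of_int i * h N}) - ?s\<bar> \<le> e / 2 * real N"
        have d: "deadline_count lam N \<omega> t = card {i \<in> {1..int (n N)}. u N i \<omega> \<le> t - of_int i * h N}"
          unfolding deadline_count_def n_def h_def using deadlines_eq[OF lam elim(3) u] by simp
        have "\<bar>real (deadline_count lam N \<omega> t) - ?s\<bar> / real N \<le> e / 2"
          using c elim(3) unfolding d by (simp add: field_simps)
        then have "\<bar>real (deadline_count lam N \<omega> t) / real N - ?s / real N\<bar> \<le> e / 2"
          by (simp add: abs_divide diff_divide_distrib[symmetric])
        then show "\<bar>real (deadline_count lam N \<omega> t) / real N - lam * Gamma t\<bar> \<le> e" using mean by linarith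
      qed
    qed
  qed
qed

lemma whp_deadline_count_uniform:
  assumes lam: "0 < lam" and e: "0 < e"
  shows "whp (\<lambda>N \<omega>. \<forall>t\<in>{0..T}. \<bar>real (deadline_count lam N \<omega> t) / real N - lam * Gamma t\<bar> \<le> e)"
proof (rule whp_uniform_mono[OF _ _ _ e])
  show "continuous_on {0..T} (\<lambda>t. lam * Gamma t)"
    by (intro continuous_intros continuous_on_subset[OF continuous_on_Gamma]) auto
  show "whp (\<lambda>N \<omega>. \<bar>real (deadline_count lam N \<omega> t) / real N - lam * Gamma t\<bar> \<le> e)"
    if "t \<in> {0..T}" "0 < e" for t e
    using that by (intro whp_deadline_count[OF lam]) auto
  show "whp (\<lambda>N \<omega>. mono_on {0..T} (\<lambda>t. real (deadline_count lam N \<omega> t) / real N))"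
  proof (rule whp_mono[OF pos])
    show "\<forall>\<^sub>F N in sequentially. \<forall>\<omega>\<in>space M. (\<forall>i\<ge>1. 0 < u N i \<omega>) \<longrightarrow>
      mono_on {0..T} (\<lambda>t. real (deadline_count lam N \<omega> t) / real N)"
      using eventually_ge_at_top[of 1]
    proof eventually_elim
      case (elim N)
      have "deadline_count lam N \<omega> s \<le> deadline_count lam N \<omega> t"
        if "\<forall>i\<ge>1. 0 < u N i \<omega>" "s \<le> t" for \<omega> s t
        unfolding deadline_count_def
        using that(2) finite_deadlines[where t = t, OF lam elim that(1)] by (intro card_mono) auto
      then show ?case by (auto simp: mono_on_def intro!: divide_right_mono)
    qed
  qed
qed

text \<open>Bounds the number of customers that \<open>overtaken_reneging\<close> does not exclude.
  \<open>K * real N\<close> stands for an upper bound on the number of arrivals.\<close>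

lemma whp_few_short_lead_times:
  assumes K: "0 < K" and G0: "isCont (cdf nu) 0" "cdf nu 0 = 0" and e: "0 < e"
  obtains d where "0 < d" "whp (\<lambda>N \<omega>. real (card {i \<in> {1..int (nat \<lfloor>K * real N\<rfloor>)}. u N i \<omega> \<le> d}) \<le> e * real N)"
proof -
  have "(cdf nu \<longlongrightarrow> 0) (at 0)" using G0 by (simp add: isCont_def)
  then have "\<forall>\<^sub>F x in at 0. cdf nu x < e / (4 * K)" by (rule order_tendstoD) (use e K in simp)
  then obtain d0 where d0: "0 < d0" "\<And>x. x \<noteq> 0 \<Longrightarrow> dist x 0 < d0 \<Longrightarrow> cdf nu x < e / (4 * K)"
    unfolding eventually_at by auto
  have "countable {x. \<not> isCont (cdf nu) x}" by (rule mono_ctble_discont[OF mono_cdf(1)])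
  \<comment> \<open>\<open>d\<close> must be a continuity point, since the distribution functions
    are known to converge only there; all but countably many points of the interval qualify.\<close>
  then obtain d where d: "0 < d" "d < d0" "isCont (cdf nu) d"
    using open_minus_countable[of "{x. \<not> isCont (cdf nu) x}" "{0<..<d0}"] d0 by auto
  have n: "real (nat \<lfloor>K * real N\<rfloor>) \<le> K * real N" for N using K by (simp add: of_nat_floor)
  have "whp (\<lambda>N \<omega>. \<bar>real (card {i \<in> {1..int (nat \<lfloor>K * real N\<rfloor>)}. u N i \<omega> \<le> d}) -
      (\<Sum>i=1..int (nat \<lfloor>K * real N\<rfloor>). cdf (nuN N) d)\<bar> \<le> e / 2 * real N)"
    by (rule whp_count_le[OF indep law n K]) (use e in auto)
  then have "whp (\<lambda>N \<omega>. real (card {i \<in> {1..int (nat \<lfloor>K * real N\<rfloor>)}. u N i \<omega> \<le> d}) \<le> e * real N)"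
  proof (rule whp_mono)
    have "(\<lambda>N. cdf (nuN N) d) \<longlonglongrightarrow> cdf nu d"
      using weak d by (auto simp: weak_conv_m_def weak_conv_def)
    moreover have "cdf nu d < e / (2 * K)"
    proof -
      have "cdf nu d < e / (4 * K)" using d by (intro d0) auto
      also have "\<dots> \<le> e / (2 * K)" using e K by (simp add: field_simps)
      finally show ?thesis .
    qed
    ultimately have "\<forall>\<^sub>F N in sequentially. cdf (nuN N) d < e / (2 * K)" by (rule order_tendstoD)
    then show "\<forall>\<^sub>F N in sequentially. \<forall>\<omega>\<in>space M.
        \<bar>real (card {i \<in> {1..int (nat \<lfloor>K * real N\<rfloor>)}. u N i \<omega> \<le> d}) -
        (\<Sum>i=1..int (nat \<lfloor>K * real N\<rfloor>). cdf (nuN N) d)\<bar> \<le> e / 2 * real N \<longrightarrow>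
        real (card {i \<in> {1..int (nat \<lfloor>K * real N\<rfloor>)}. u N i \<omega> \<le> d}) \<le> e * real N"
    proof eventually_elim
      case (elim N)
      have "(\<Sum>i=1..int (nat \<lfloor>K * real N\<rfloor>). cdf (nuN N) d) = real (nat \<lfloor>K * real N\<rfloor>) * cdf (nuN N) d"
        by simp
      also have "\<dots> \<le> K * real N * (e / (2 * K))"
        using n[of N] elim cdf_01(3) K by (intro mult_mono) auto
      also have "\<dots> = e / 2 * real N" using K by simp
      finally have "(\<Sum>i=1..int (nat \<lfloor>K * real N\<rfloor>). cdf (nuN N) d) \<le> e / 2 * real N" .
      then show ?case by (intro ballI impI) linarith
    qed
  qed
  then show thesis using that d by blast
qed

end

section \<open>The initial queue\<close>

lemma integral_scaled_queue_measure:
  fixes g :: "real \<Rightarrow> real"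
  assumes fin: "finite (queue_set x0 a u b t)" and g: "continuous_on {0..} g" and c: "0 \<le> c"
  shows "(\<integral>x. g x \<partial>scale_measure (ennreal c) (queue_measure x0 a u b t))
    = c * (\<Sum>i\<in>queue_set x0 a u b t. g (u i + a i - t))"
proof -
  let ?Q = "queue_measure x0 a u b t"
  have sets: "sets ?Q = sets nn_borel" by (simp add: queue_measure_def)
  have gm: "g \<in> borel_measurable nn_borel"
    unfolding nn_borel_def by (rule borel_measurable_continuous_on_restrict[OF g])
  then have gQ: "g \<in> borel_measurable ?Q" using measurable_cong_sets[OF sets refl] by blast
  have "scale_measure (ennreal c) ?Q = density ?Q (\<lambda>_. ennreal c)"
    by (rule measure_eqI) (auto simp: emeasure_density_const)
  then have "(\<integral>x. g x \<partial>scale_measure (ennreal c) ?Q) = (\<integral>x. c *\<^sub>R g x \<partial>?Q)"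
    using c by (simp add: integral_density[OF gQ])
  also have "\<dots> = c * (\<integral>x. g x \<partial>?Q)" by simp
  also have "(\<integral>x. g x \<partial>?Q) = (\<integral>i. g (u i + a i - t) \<partial>count_space (queue_set x0 a u b t))"
    unfolding queue_measure_def
    by (rule integral_distr[OF _ gm]) (auto simp: queue_set_def nn_borel_def space_restrict_space)
  also have "\<dots> = (\<Sum>i\<in>queue_set x0 a u b t. g (u i + a i - t))"
    by (rule lebesgue_integral_count_space_finite[OF fin])
  finally show ?thesis .
qed

lemma continuous_map_weak_integral:
  assumes "continuous_on {0..} g" "bounded (g ` {0..})"
  shows "continuous_map weak_topology euclideanreal (\<lambda>m. \<integral>x. g x \<partial>m)"
  unfolding continuous_map_def topspace_weak_topology
proof (intro conjI allI impI)
  fix U :: "real set" assume "openin euclideanreal U"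
  then show "openin weak_topology {m \<in> finite_nn_measures. (\<integral>x. g x \<partial>m) \<in> U}"
    unfolding weak_topology_def using assms by (intro topology_generated_by_Basis) auto
qed auto

locale initial_queue = prob_space M for M :: "'a measure" +
  fixes x0 :: "nat \<Rightarrow> 'a \<Rightarrow> nat" and a u :: "nat \<Rightarrow> 'a \<Rightarrow> int \<Rightarrow> real"
    and b :: "nat \<Rightarrow> 'a \<Rightarrow> int \<Rightarrow> ereal" and F :: "nat \<Rightarrow> 'a \<Rightarrow> real" and Q0 :: "real measure" and F0 :: real
  assumes conv: "converges_in_distribution M (prod_topology weak_topology euclideanreal)
      (\<lambda>N \<omega>. (scale_measure (ennreal (1 / real N)) (queue_measure (x0 N \<omega>) (a N \<omega>) (u N \<omega>) (b N \<omega>) 0), F N \<omega>))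
      (\<lambda>_. (Q0, F0))"
    and fin: "whp (\<lambda>N \<omega>. finite (queue_set (x0 N \<omega>) (a N \<omega>) (u N \<omega>) (b N \<omega>) 0))"
    and Q0: "Q0 \<in> finite_nn_measures"
begin

abbreviation Q :: "nat \<Rightarrow> 'a \<Rightarrow> int set" where
  "Q N \<omega> \<equiv> queue_set (x0 N \<omega>) (a N \<omega>) (u N \<omega>) (b N \<omega>) 0"

text \<open>Integration against a test function is continuous on the first factor of the pair, and
  the limit is deterministic, so convergence in distribution becomes convergence in probability of
  sums over the initial queue.\<close>

lemma whp_test_function:
  assumes g: "continuous_on {0..} g" "bounded (g ` {0..})" and e: "0 < e"
  shows "whp (\<lambda>N \<omega>. finite (Q N \<omega>) \<and> \<bar>(\<Sum>i\<in>Q N \<omega>. g (u N \<omega> i + a N \<omega> i)) / real N - (\<integral>x. g x \<partial>Q0)\<bar> < e)"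
proof -
  have "continuous_map (prod_topology weak_topology euclideanreal) euclideanreal (\<lambda>p. \<integral>x. g x \<partial>fst p)"
    using continuous_map_compose[OF continuous_map_fst continuous_map_weak_integral[OF g]] by (simp add: comp_def)
  from converges_in_distribution_constD[OF conv this e]
  have "whp (\<lambda>N \<omega>. \<bar>(\<integral>x. g x \<partial>scale_measure (ennreal (1 / real N))
    (queue_measure (x0 N \<omega>) (a N \<omega>) (u N \<omega>) (b N \<omega>) 0)) - (\<integral>x. g x \<partial>Q0)\<bar> < e)" by simp
  from whp_conj[OF fin this] show ?thesis
    by (rule whp_mono, intro always_eventually) (auto simp: integral_scaled_queue_measure[OF _ g(1)])
qed

lemma space_Q0: "space Q0 = {0..}" and sets_Q0: "sets Q0 = sets nn_borel" and finite_Q0: "finite_measure Q0"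
proof -
  show "sets Q0 = sets nn_borel" "finite_measure Q0" using Q0 by (auto simp: finite_nn_measures_def)
  then show "space Q0 = {0..}" using sets_eq_imp_space_eq[of Q0 nn_borel] by (simp add: nn_borel_def space_restrict_space)
qed

lemma in_sets_Q0: "A \<in> sets borel \<Longrightarrow> A \<subseteq> {0..} \<Longrightarrow> A \<in> sets Q0"
  unfolding sets_Q0 nn_borel_def by (subst sets_restrict_space_iff) auto

lemma whp_initial_size:
  assumes e: "0 < e"
  shows "whp (\<lambda>N \<omega>. finite (Q N \<omega>) \<and> \<bar>real (card (Q N \<omega>)) / real N - measure Q0 {0..}\<bar> \<le> e)"
  using whp_test_function[of "\<lambda>_. 1", OF _ _ e]
  by (rule whp_mono) (auto simp: space_Q0 image_constant_conv less_imp_le)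

text \<open>The indicator of \<open>{0..t}\<close> is no weak test function. It is squeezed between
  piecewise linear functions \<open>g p q\<close>, which are 1 up to \<open>p\<close> and 0 from
  \<open>q\<close> on; continuity of the distribution function of \<open>Q0\<close> makes the gap
  small.\<close>

lemma whp_initial_deadline_count:
  assumes K: "continuous_on {0..} (\<lambda>x. measure Q0 {0..x})" "measure Q0 {0..0} = 0" and t: "0 \<le> t" and e: "0 < e"
  shows "whp (\<lambda>N \<omega>. \<bar>real (card {i \<in> Q N \<omega>. u N \<omega> i + a N \<omega> i \<le> t}) / real N - measure Q0 {0..t}\<bar> \<le> e)"
proof -
  interpret Q0: finite_measure Q0 by (rule finite_Q0)
  define g where "g p q x = max 0 (min 1 ((q - x) / (q - p)))" for p q x :: real
  have g01: "0 \<le> g p q x" "g p q x \<le> 1" for p q x by (auto simp: g_def)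
  have g1: "g p q x = 1" if "p < q" "x \<le> p" for p q x using that by (auto simp: g_def)
  have g0: "g p q x = 0" if "p < q" "q \<le> x" for p q x using that by (auto simp: g_def divide_le_0_iff)
  have gc: "continuous_on {0..} (g p q)" if "p < q" for p q
    unfolding g_def using that by (intro continuous_intros) auto
  have gb: "bounded (g p q ` {0..})" for p q
    unfolding bounded_iff using g01 by (intro exI[of _ 1]) auto
  have gi: "integrable Q0 (g p q)" if "p < q" for p q
  proof (rule Q0.integrable_const_bound[where B = 1])
    have "g p q \<in> borel_measurable nn_borel"
      unfolding nn_borel_def by (rule borel_measurable_continuous_on_restrict[OF gc[OF that]])
    then show "g p q \<in> borel_measurable Q0" using measurable_cong_sets[OF sets_Q0 refl] by blast
  qed (use g01 in auto)
  have I: "integrable Q0 (indicator {0..s} :: real \<Rightarrow> real)" "(\<integral>x. indicator {0..s} x \<partial>Q0) = measure Q0 {0..s}" for s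
  proof -
    have s: "{0..s} \<in> sets Q0" by (rule in_sets_Q0) auto
    then show "integrable Q0 (indicator {0..s} :: real \<Rightarrow> real)" by (simp add: Q0.emeasure_eq_measure)
    show "(\<integral>x. indicator {0..s} x \<partial>Q0) = measure Q0 {0..s}" using s by (simp add: Int_absorb2 space_Q0)
  qed
  have g_up: "(\<integral>x. g p q x \<partial>Q0) \<le> measure Q0 {0..q}" if "p < q" for p q
    unfolding I(2)[symmetric] using that
    by (intro integral_mono gi I(1)) (auto simp: space_Q0 indicator_def g01 g0)
  have g_low: "measure Q0 {0..p} \<le> (\<integral>x. g p q x \<partial>Q0)" if "p < q" for p q
    unfolding I(2)[symmetric] using that
    by (intro integral_mono gi I(1)) (auto simp: space_Q0 indicator_def g01 g1)
  have "\<exists>d>0. \<forall>x\<in>{0..}. dist x t < d \<longrightarrow> dist (measure Q0 {0..x}) (measure Q0 {0..t}) < e / 2"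
    using K(1)[unfolded continuous_on_iff, rule_format, of t "e / 2"] t e by auto
  then obtain d where d: "0 < d" and dist: "\<And>x. x \<in> {0..} \<Longrightarrow> dist x t < d \<Longrightarrow>
      dist (measure Q0 {0..x}) (measure Q0 {0..t}) < e / 2" by blast
  have near: "measure Q0 {0..t} - e / 2 < measure Q0 {0..x} \<and> measure Q0 {0..x} < measure Q0 {0..t} + e / 2"
    if "0 \<le> x" "\<bar>x - t\<bar> < d" for x
    using dist[of x] that unfolding dist_real_def abs_diff_less_iff by simp
  have e2: "0 < e / 2" using e by simp
  define q where "q = t + d / 2"
  have q: "t < q" "measure Q0 {0..q} < measure Q0 {0..t} + e / 2"
    using d near[of q] t unfolding q_def by simp_all
  have up: "whp (\<lambda>N \<omega>. real (card {i \<in> Q N \<omega>. u N \<omega> i + a N \<omega> i \<le> t}) / real N \<le> measure Q0 {0..t} + e)"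
  proof (rule whp_mono[OF whp_test_function[OF gc[OF q(1)] gb e2]], intro always_eventually allI ballI impI, elim conjE)
    fix N \<omega> assume f: "finite (Q N \<omega>)"
      and s: "\<bar>(\<Sum>i\<in>Q N \<omega>. g t q (u N \<omega> i + a N \<omega> i)) / real N - (\<integral>x. g t q x \<partial>Q0)\<bar> < e / 2"
    have "real (card {i \<in> Q N \<omega>. u N \<omega> i + a N \<omega> i \<le> t}) = (\<Sum>i\<in>Q N \<omega>. of_bool (u N \<omega> i + a N \<omega> i \<le> t))"
      using f by (simp add: sum_of_bool_eq Int_def)
    also have "\<dots> \<le> (\<Sum>i\<in>Q N \<omega>. g t q (u N \<omega> i + a N \<omega> i))"
      using g1[OF q(1)] g01 by (intro sum_mono) auto
    finally have "real (card {i \<in> Q N \<omega>. u N \<omega> i + a N \<omega> i \<le> t}) / real N \<le> (\<Sum>i\<in>Q N \<omega>. g t q (u N \<omega> i + a N \<omega> i)) / real N"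
      by (rule divide_right_mono) simp
    then show "real (card {i \<in> Q N \<omega>. u N \<omega> i + a N \<omega> i \<le> t}) / real N \<le> measure Q0 {0..t} + e"
      using s q(2) g_up[OF q(1)] by linarith
  qed
  have low: "whp (\<lambda>N \<omega>. measure Q0 {0..t} - e \<le> real (card {i \<in> Q N \<omega>. u N \<omega> i + a N \<omega> i \<le> t}) / real N)"
  proof (cases "t = 0")
    \<comment> \<open>At 0 there is no room for a test function that falls to 0 before
      \<open>t\<close>; the absence of mass at 0 makes the bound trivial.\<close>
    case True
    have "measure Q0 {0..t} - e \<le> real k / real N" for k N :: nat
    proof -
      have "measure Q0 {0..t} - e \<le> 0" using True K(2) e by simp
      also have "0 \<le> real k / real N" by simp
      finally show ?thesis .
    qed
    then show ?thesis by (intro whp_eventually always_eventually allI ballI)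
  next
    case False
    define p where "p = max 0 (t - d / 2)"
    have "0 < t" using t False by simp
    then have "0 \<le> p" "p < t" "\<bar>p - t\<bar> < d" using d unfolding p_def max_def by (simp_all add: abs_if)
    then have p: "p < t" "measure Q0 {0..t} - e / 2 < measure Q0 {0..p}"
      using near[of p] by simp_all
    show ?thesis
    proof (rule whp_mono[OF whp_test_function[OF gc[OF p(1)] gb e2]], intro always_eventually allI ballI impI, elim conjE)
      fix N \<omega> assume f: "finite (Q N \<omega>)"
        and s: "\<bar>(\<Sum>i\<in>Q N \<omega>. g p t (u N \<omega> i + a N \<omega> i)) / real N - (\<integral>x. g p t x \<partial>Q0)\<bar> < e / 2"
      have "(\<Sum>i\<in>Q N \<omega>. g p t (u N \<omega> i + a N \<omega> i)) \<le> (\<Sum>i\<in>Q N \<omega>. of_bool (u N \<omega> i + a N \<omega> i \<le> t))"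
        using g0[OF p(1)] g01 by (intro sum_mono) auto
      also have "\<dots> = real (card {i \<in> Q N \<omega>. u N \<omega> i + a N \<omega> i \<le> t})"
        using f by (simp add: sum_of_bool_eq Int_def)
      finally have "(\<Sum>i\<in>Q N \<omega>. g p t (u N \<omega> i + a N \<omega> i)) / real N \<le> real (card {i \<in> Q N \<omega>. u N \<omega> i + a N \<omega> i \<le> t}) / real N"
        by (rule divide_right_mono) simp
      then show "measure Q0 {0..t} - e \<le> real (card {i \<in> Q N \<omega>. u N \<omega> i + a N \<omega> i \<le> t}) / real N"
        using s p(2) g_low[OF p(1)] by linarith
    qed
  qed
  from whp_conj[OF up low] show ?thesis by (rule whp_mono) (auto simp: abs_le_iff)
qed

lemma whp_initial_deadline_count_uniform:
  assumes K: "continuous_on {0..} (\<lambda>x. measure Q0 {0..x})" "measure Q0 {0..0} = 0" and e: "0 < e"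
  shows "whp (\<lambda>N \<omega>. \<forall>t\<in>{0..T}. \<bar>real (card {i \<in> Q N \<omega>. u N \<omega> i + a N \<omega> i \<le> t}) / real N - measure Q0 {0..t}\<bar> \<le> e)"
proof (rule whp_uniform_mono[OF _ _ _ e])
  show "continuous_on {0..T} (\<lambda>t. measure Q0 {0..t})" by (rule continuous_on_subset[OF K(1)]) auto
  show "whp (\<lambda>N \<omega>. mono_on {0..T} (\<lambda>t. real (card {i \<in> Q N \<omega>. u N \<omega> i + a N \<omega> i \<le> t}) / real N))"
    by (rule whp_mono[OF fin], intro always_eventually) (auto simp: mono_on_def intro!: divide_right_mono card_mono)
  show "whp (\<lambda>N \<omega>. \<bar>real (card {i \<in> Q N \<omega>. u N \<omega> i + a N \<omega> i \<le> t}) / real N - measure Q0 {0..t}\<bar> \<le> e)"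
    if "t \<in> {0..T}" "0 < e" for t e
    using that by (intro whp_initial_deadline_count[OF K]) auto
qed

end

section \<open>Sample paths of the queue\<close>

text \<open>Right-continuity makes the path a pointwise limit of its values at grid points just to
  the right. Each approximation factors through an integer and is measurable. The \<open>+ 1\<close>
  in \<open>?q\<close> keeps the grid point strictly to the right of \<open>t\<close>, as
  \<open>at_right\<close> demands.\<close>

lemma rcll_borel_measurable:
  fixes x :: "real \<Rightarrow> real"
  assumes "x \<in> rcll"
  shows "(\<lambda>t. x (max 0 t)) \<in> borel_measurable borel"
proof (rule borel_measurable_LIMSEQ_real)
  let ?q = "\<lambda>n t. (real_of_int \<lfloor>real (Suc n) * max 0 t\<rfloor> + 1) / real (Suc n)"
  fix t :: real
  let ?t = "max 0 t"
  have lower: "?t < ?q n t" for n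
  proof -
    have "?t * real (Suc n) < real_of_int \<lfloor>real (Suc n) * ?t\<rfloor> + 1"
      unfolding mult.commute[of ?t] by linarith
    then show ?thesis by (rule pos_less_divide_eq[THEN iffD2, rotated]) simp
  qed
  have upper: "?q n t \<le> ?t + 1 / real (Suc n)" for n
  proof -
    have "(?t + 1 / real (Suc n)) * real (Suc n) = real (Suc n) * ?t + 1"
      unfolding distrib_right by (subst mult.commute) (simp del: of_nat_Suc add: nonzero_eq_divide_eq)
    then have "real_of_int \<lfloor>real (Suc n) * ?t\<rfloor> + 1 \<le> (?t + 1 / real (Suc n)) * real (Suc n)"
      by linarith
    then show ?thesis by (simp add: pos_divide_le_eq del: of_nat_Suc)
  qed
  have lim: "(\<lambda>n. ?q n t) \<longlonglongrightarrow> ?t"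
  proof (rule tendsto_sandwich)
    show "\<forall>\<^sub>F n in sequentially. ?t \<le> ?q n t" using lower by (simp add: less_imp_le)
    show "\<forall>\<^sub>F n in sequentially. ?q n t \<le> ?t + 1 / real (Suc n)" using upper by simp
    show "(\<lambda>n. ?t + 1 / real (Suc n)) \<longlonglongrightarrow> ?t"
      using tendsto_add[OF tendsto_const LIMSEQ_inverse_real_of_nat, of ?t] by (simp add: inverse_eq_divide)
  qed simp
  have "(x \<longlongrightarrow> x ?t) (at_right ?t)" using assms by (auto simp: rcll_def)
  moreover have "filterlim (\<lambda>n. ?q n t) (at_right ?t) sequentially"
    using lim lower by (intro filterlim_at_withinI) auto
  ultimately show "(\<lambda>n. x (?q n t)) \<longlonglongrightarrow> x ?t" by (rule filterlim_compose)
next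
  fix n
  let ?f = "\<lambda>k::int. x ((real_of_int k + 1) / real (Suc n))"
  have "(\<lambda>t. \<lfloor>real (Suc n) * max 0 t\<rfloor>) \<in> borel \<rightarrow>\<^sub>M count_space UNIV" by measurable
  moreover have "?f \<in> count_space UNIV \<rightarrow>\<^sub>M borel" by simp
  ultimately show "(\<lambda>t. x ((real_of_int \<lfloor>real (Suc n) * max 0 t\<rfloor> + 1) / real (Suc n))) \<in> borel_measurable borel"
    by (rule measurable_compose)
qed

text \<open>Natural numbers at distance less than 1 coincide. Needed to see that the infimum of the
  idle times is itself idle.\<close>

lemma rcll_nat_right_constant:
  fixes X :: "real \<Rightarrow> nat"
  assumes "(\<lambda>t. real (X t)) \<in> rcll" "0 \<le> t"
  shows "\<forall>\<^sub>F s in at_right t. X s = X t"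
proof -
  have "((\<lambda>t. real (X t)) \<longlongrightarrow> real (X t)) (at_right t)"
    using assms by (auto simp: rcll_def)
  then have "\<forall>\<^sub>F s in at_right t. dist (real (X s)) (real (X t)) < 1"
    by (rule tendstoD) simp
  then show ?thesis by eventually_elim (simp add: dist_real_def)
qed

section \<open>Bookkeeping along a single path\<close>

locale edf_sample =
  fixes E S :: "real \<Rightarrow> nat" and a u :: "int \<Rightarrow> real" and b :: "int \<Rightarrow> ereal"
    and X R :: "real \<Rightarrow> nat" and T :: real
  assumes path: "edf_path E S a u b X R"
    and rcll_X: "(\<lambda>t. real (X t)) \<in> rcll"
    and arrivals: "\<And>t. t \<in> {0..T} \<Longrightarrow> finite {i. 1 \<le> i \<and> a i \<le> t} \<and> card {i. 1 \<le> i \<and> a i \<le> t} = E t"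
    and arrival_pos: "\<And>i. 1 \<le> i \<Longrightarrow> 0 < a i"
begin

text \<open>The interval is half-open so that the first idle time itself still counts as
  \<open>busy\<close>; estimates for busy periods can then be used at that very moment.\<close>

definition busy :: "real \<Rightarrow> bool" where
  "busy t \<longleftrightarrow> (\<forall>s\<in>{0..<t}. 0 < X s)"

text \<open>The unscaled counterpart of \<open>fluid_H\<close> at \<open>x = 0\<close>. The
  condition \<open>0 < b i\<close> removes only those already taken into service at time 0; later
  entries to service leave the set unchanged.\<close>

definition pending :: "real \<Rightarrow> int set" where
  "pending t = {i \<in> customers (X 0). a i \<le> t \<and> t < u i + a i \<and> 0 < b i}"

abbreviation C :: "int set" where "C \<equiv> customers (X 0)"
abbreviation Q :: "real \<Rightarrow> int set" where "Q \<equiv> queue_set (X 0) a u b"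
abbreviation D :: "real \<Rightarrow> nat" where "D \<equiv> completions S X"

lemma lead_pos: "i \<in> C \<Longrightarrow> 0 < u i" and initial: "i \<in> C \<Longrightarrow> i \<le> 0 \<Longrightarrow> a i \<le> 0"
  using path unfolding edf_path_def by blast+

lemma entry: "i \<in> C \<Longrightarrow> b i \<noteq> \<infinity> \<Longrightarrow> ereal (a i) \<le> b i \<and> b i < ereal (u i + a i)"
  using path unfolding edf_path_def by blast

lemma R_eq: "0 \<le> t \<Longrightarrow> R t = card {i \<in> C. b i = \<infinity> \<and> u i + a i \<le> t}"
  using path unfolding edf_path_def by simp

lemma X_eq: "0 \<le> t \<Longrightarrow> int (X t) = int (X 0) + int (E t) - int (D t) - int (R t)"
  using path unfolding edf_path_def by blast

lemma entered_eq: "0 \<le> t \<Longrightarrow> card {i \<in> C. b i \<le> ereal t} = D t + of_bool (0 < X t)"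
  using path unfolding edf_path_def by blast

lemma edf: "0 < t \<Longrightarrow> i \<in> C \<Longrightarrow> b i = ereal t \<Longrightarrow> j \<in> Q t \<Longrightarrow> u i + a i \<le> u j + a j"
  using path unfolding edf_path_def by fastforce

lemma arrived:
  assumes "t \<in> {0..T}"
  shows "finite {i \<in> C. a i \<le> t}" "card {i \<in> C. a i \<le> t} = X 0 + E t"
proof -
  have eq: "{i \<in> C. a i \<le> t} = {- int (X 0) + 1..0} \<union> {i. 1 \<le> i \<and> a i \<le> t}"
    using initial assms by (force simp: customers_def)
  show "finite {i \<in> C. a i \<le> t}" unfolding eq using arrivals[OF assms] by simp
  have "card ({- int (X 0) + 1..0} \<union> {i. 1 \<le> i \<and> a i \<le> t}) = card {- int (X 0) + 1..0} + card {i. 1 \<le> i \<and> a i \<le> t}"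
    using arrivals[OF assms] by (intro card_Un_disjoint) auto
  then show "card {i \<in> C. a i \<le> t} = X 0 + E t" unfolding eq using arrivals[OF assms] by simp
qed

lemma entered_arrived: "i \<in> C \<Longrightarrow> b i \<le> ereal t \<Longrightarrow> a i \<le> t"
  using entry[of i] by (cases "b i") auto

lemma finite_entered: "t \<in> {0..T} \<Longrightarrow> finite {i \<in> C. b i \<le> ereal t}"
  by (rule finite_subset[OF _ arrived(1)]) (auto dest: entered_arrived)

lemma finite_Q: "t \<in> {0..T} \<Longrightarrow> finite (Q t)"
  by (rule finite_subset[OF _ arrived(1)]) (auto simp: queue_set_def)

lemma finite_pending: "t \<in> {0..T} \<Longrightarrow> finite (pending t)"
  by (rule finite_subset[OF _ arrived(1)]) (auto simp: pending_def)

lemma finite_reneged: "t \<in> {0..T} \<Longrightarrow> finite {i \<in> C. b i = \<infinity> \<and> u i + a i \<le> t}"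
  by (rule finite_subset[OF _ arrived(1)]) (auto dest: lead_pos)

text \<open>Everyone who has arrived has entered service, is queued, or has reneged. Comparing this
  partition with the balance equation for \<open>X\<close> leaves \<open>X t - 1\<close>, truncated
  at 0.\<close>

lemma card_Q:
  assumes "t \<in> {0..T}"
  shows "card (Q t) = queue_length X t"
proof -
  have eq: "{i \<in> C. a i \<le> t} = {i \<in> C. b i \<le> ereal t} \<union> (Q t \<union> {i \<in> C. b i = \<infinity> \<and> u i + a i \<le> t})"
  proof (intro set_eqI iffI)
    fix i assume i: "i \<in> {i \<in> C. a i \<le> t}"
    show "i \<in> {i \<in> C. b i \<le> ereal t} \<union> (Q t \<union> {i \<in> C. b i = \<infinity> \<and> u i + a i \<le> t})"
    proof (cases "b i \<le> ereal t \<or> b i = \<infinity>")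
      \<comment> \<open>A customer who enters service later does so before the deadline, so the
        deadline is still ahead at \<open>t\<close>.\<close>
      case False
      then have "ereal t < b i" "b i < ereal (u i + a i)" using entry[of i] i by auto
      then have "ereal t < ereal (u i + a i)" by (rule less_trans)
      then show ?thesis using i False by (auto simp: queue_set_def)
    qed (use i in \<open>auto simp: queue_set_def\<close>)
  qed (auto simp: queue_set_def dest: entered_arrived lead_pos)
  have "card {i \<in> C. a i \<le> t} = card {i \<in> C. b i \<le> ereal t} + card (Q t \<union> {i \<in> C. b i = \<infinity> \<and> u i + a i \<le> t})"
    unfolding eq using finite_entered[OF assms] finite_Q[OF assms] finite_reneged[OF assms]
    by (intro card_Un_disjoint) (auto simp: queue_set_def)
  also have "card (Q t \<union> {i \<in> C. b i = \<infinity> \<and> u i + a i \<le> t}) = card (Q t) + R t"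
    using assms R_eq[of t] finite_Q[OF assms] finite_reneged[OF assms]
    by (subst card_Un_disjoint) (auto simp: queue_set_def)
  finally have "X 0 + E t = D t + of_bool (0 < X t) + card (Q t) + R t"
    using arrived(2)[OF assms] entered_eq[of t] assms by simp
  moreover have "X t + D t + R t = X 0 + E t" using X_eq[of t] assms by auto
  ultimately show ?thesis by (cases "X t = 0") (auto simp: queue_length_def)
qed

lemma R_mono: "0 \<le> s \<Longrightarrow> s \<le> t \<Longrightarrow> t \<le> T \<Longrightarrow> R s \<le> R t"
  using R_eq[of s] R_eq[of t] finite_reneged[of t] by (auto intro!: card_mono)

lemma Q_subset_pending: "0 \<le> t \<Longrightarrow> Q t \<subseteq> pending t"
proof
  fix i assume t: "0 \<le> t" and "i \<in> Q t"
  then have i: "i \<in> C" "a i \<le> t" "ereal t < b i" "0 < u i + a i - t" by (auto simp: queue_set_def)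
  have "0 < b i" using t i(3) by (metis ereal_less_eq(5) le_less_trans zero_ereal_def)
  then show "i \<in> pending t" using i by (simp add: pending_def)
qed

lemma X_le_pending: "t \<in> {0..T} \<Longrightarrow> X t \<le> card (pending t) + 1"
  using card_mono[OF finite_pending Q_subset_pending, of t] card_Q[of t] by (simp add: queue_length_def)

lemma busy_mono: "busy t \<Longrightarrow> s \<le> t \<Longrightarrow> busy s"
  by (auto simp: busy_def)

lemma D_busy:
  assumes "busy t" "0 \<le> t"
  shows "D t = S t"
proof -
  have "integral {0..t} (\<lambda>s. of_bool (0 < X s)) = integral {0..t} (\<lambda>s. 1 :: real)"
    \<comment> \<open>\<open>busy t\<close> says nothing about the instant \<open>t\<close> itself,
      which is a null set.\<close>
    by (rule integral_spike[where S = "{t}"]) (use assms in \<open>auto simp: busy_def\<close>)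
  then show ?thesis using assms by (simp add: completions_def)
qed

text \<open>\<open>integral\<close> is 0 by convention for a non-integrable function, so the busy
  time is meaningful only after the path regularity of \<open>X\<close> has been used.\<close>

lemma busy_time_integrable:
  "(\<lambda>s. of_bool (0 < X s) :: real) integrable_on {0..t}"
proof -
  have m: "(\<lambda>s. real (X (max 0 s))) \<in> borel_measurable borel"
    using rcll_borel_measurable[OF rcll_X] .
  have "(\<lambda>s. of_bool (0 < real (X (max 0 s))) :: real) \<in> borel_measurable borel"
    using m by measurable
  then have "set_integrable lborel {0..t} (\<lambda>s. of_bool (0 < real (X (max 0 s))) :: real)"
    unfolding set_integrable_def
    by (intro integrableI_bounded_set[where A = "{0..t}" and B = 1]) (auto simp: emeasure_lborel_Icc_eq)
  then have "(\<lambda>s. of_bool (0 < real (X (max 0 s))) :: real) integrable_on {0..t}"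
    by (rule set_borel_integral_eq_integral)
  then show ?thesis by (rule integrable_eq) auto
qed

definition busy_time :: "real \<Rightarrow> real" where
  "busy_time t = integral {0..t} (\<lambda>s. of_bool (0 < X s))"

lemma D_eq: "D t = S (busy_time t)"
  by (simp add: completions_def busy_time_def)

lemma busy_time_bounds:
  assumes "0 \<le> t"
  shows "0 \<le> busy_time t" "busy_time t \<le> t"
proof -
  show "0 \<le> busy_time t" unfolding busy_time_def by (rule integral_nonneg[OF busy_time_integrable]) auto
  have "busy_time t \<le> integral {0..t} (\<lambda>s. 1 :: real)"
    unfolding busy_time_def by (rule integral_le[OF busy_time_integrable]) auto
  then show "busy_time t \<le> t" using assms by simp
qed

text \<open>In the application \<open>w\<close> is the supremum of the idle times up to
  \<open>t\<close> and \<open>s\<close> an idle time close to it, since the supremum need not be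
  attained.\<close>

lemma busy_time_diff:
  assumes "0 \<le> s" "s \<le> w" "w \<le> t" and "\<And>v. v \<in> {w<..t} \<Longrightarrow> 0 < X v"
  shows "t - w \<le> busy_time t - busy_time s"
proof -
  let ?f = "\<lambda>s. of_bool (0 < X s) :: real"
  have int: "?f integrable_on {p..q}" if "0 \<le> p" for p q
    using integrable_subinterval_real[OF busy_time_integrable[of q], of p q] that by auto
  have "integral {s..w} ?f + integral {w..t} ?f = integral {s..t} ?f"
    using assms int by (intro Henstock_Kurzweil_Integration.integral_combine) auto
  moreover have "integral {0..s} ?f + integral {s..t} ?f = integral {0..t} ?f"
    using assms int by (intro Henstock_Kurzweil_Integration.integral_combine) auto
  moreover have "0 \<le> integral {s..w} ?f" by (rule integral_nonneg[OF int[OF assms(1)]]) auto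
  moreover have "integral {w..t} ?f = integral {w..t} (\<lambda>s. 1 :: real)"
    by (rule integral_spike[where S = "{w}"]) (use assms in auto)
  ultimately show ?thesis using assms by (simp add: busy_time_def)
qed

end

text \<open>\<open>n\<close> is the scaling index. The condition \<open>1 \<le> eps * n\<close> lets
  the customer in service, and every other difference of one, be booked as an error
  \<open>eps * n\<close>.\<close>

locale edf_sample_rates = edf_sample +
  fixes lam mu eps n :: real
  assumes E_approx: "\<And>t. t \<in> {0..T} \<Longrightarrow> \<bar>real (E t) - lam * n * t\<bar> \<le> eps * n"
    and S_approx: "\<And>t. t \<in> {0..T} \<Longrightarrow> \<bar>real (S t) - mu * n * t\<bar> \<le> eps * n"
    and rates: "0 < lam" "lam < mu" "0 < n" "1 \<le> eps * n"
begin

lemma eps_pos: "0 < eps"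
  using rates by (metis less_le_trans mult_pos_neg not_less_iff_gr_or_eq mult_zero_left zero_less_mult_pos2 zero_less_one)

text \<open>A customer with a later deadline was served while \<open>i\<close> had not yet arrived. From the last such
  moment on only later arrivals enter service, which is too slow to keep the server busy.\<close>

lemma overtaken_reneging:
  assumes i: "i \<in> C" "b i = \<infinity>" "u i + a i \<le> T" and busy: "busy (u i + a i)"
    and k: "k \<in> C" "0 < b k" "b k < ereal (u i + a i)" "u i + a i < u k + a k"
  shows "1 \<le> i" "(mu - lam) * u i \<le> 5 * eps"
proof -
  define r where "r = u i + a i"
  have T0: "0 \<le> T" "0 < r"
  proof -
    have "0 < ereal r" using k unfolding r_def by (metis less_trans)
    then show "0 \<le> T" "0 < r" using i by (auto simp: r_def)
  qed
  have T: "r \<in> {0..T}" using T0 i by (auto simp: r_def)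
  \<comment> \<open>Those with a deadline after \<open>r\<close> who were served in preference; the
    last of them, \<open>m\<close>, enters at time \<open>s\<close>.\<close>
  define K where "K = {k \<in> C. 0 < b k \<and> b k < ereal r \<and> r < u k + a k}"
  have "finite K" by (rule finite_subset[OF _ finite_entered[OF T]]) (auto simp: K_def)
  moreover have "k \<in> K" using k by (simp add: K_def r_def)
  ultimately have "Max (b ` K) \<in> b ` K" by (intro Max_in) auto
  then obtain m where m: "m \<in> K" "b m = Max (b ` K)" by auto
  have max: "b k \<le> b m" if "k \<in> K" for k using that \<open>finite K\<close> m by simp
  obtain s where s: "b m = ereal s" using m(1) unfolding K_def by (cases "b m") simp_all
  have s0: "0 < s" "s < r" "m \<in> C" "r < u m + a m"
    using m(1) s unfolding K_def by simp_all
  \<comment> \<open>The choice of \<open>m\<close> at time \<open>s\<close>, with a deadline after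
    \<open>r\<close>, shows that nobody with a deadline up to \<open>r\<close> was waiting
    then.\<close>
  have not_Q: "j \<notin> Q s" if "u j + a j \<le> r" for j
    using edf[of s m j] s s0 that by auto
  have "s < a i" using not_Q[of i] i s0 by (auto simp: queue_set_def r_def)
  then show "1 \<le> i" using s0 initial[of i] i by (cases "1 \<le> i") auto
  \<comment> \<open>Entering after \<open>s\<close>, the last entry from \<open>K\<close>, implies a
    deadline up to \<open>r\<close>. Such a customer was not waiting at \<open>s\<close> and must
    have arrived later.\<close>
  have late: "s < a j" if j: "j \<in> C" "ereal s < b j" "b j < ereal r" for j
  proof -
    have "0 < b j" using j(2) s0 by (metis ereal_less(2) less_trans)
    then have "j \<notin> K" using max[of j] j s by auto
    then have "u j + a j \<le> r" using j \<open>0 < b j\<close> by (auto simp: K_def)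
    from not_Q[OF this] show ?thesis using j entry[of j]
      by (cases "b j") (auto simp: queue_set_def)
  qed
  \<comment> \<open>Entries in (s, t] are bounded by arrivals in (s, t], while the busy server lets
    in at least \<open>S t - S s - 1\<close>. Four approximation errors and the unit make up
    \<open>5 * eps\<close>.\<close>
  have slow: "(mu - lam) * (t - s) \<le> 5 * eps" if t: "s < t" "t < r" for t
  proof -
    have tT: "t \<in> {0..T}" "s \<in> {0..T}" using t s0 T by auto
    have "{j \<in> C. b j \<le> ereal t} - {j \<in> C. b j \<le> ereal s} \<subseteq> {j \<in> C. a j \<le> t} - {j \<in> C. a j \<le> s}"
    proof
      fix j assume j: "j \<in> {j \<in> C. b j \<le> ereal t} - {j \<in> C. b j \<le> ereal s}"
      then have "b j \<le> ereal t" by simp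
      also have "ereal t < ereal r" using t by simp
      finally have "b j < ereal r" .
      then show "j \<in> {j \<in> C. a j \<le> t} - {j \<in> C. a j \<le> s}"
        using late[of j] entered_arrived[of j t] j by (auto simp: not_le)
    qed
    then have "card ({j \<in> C. b j \<le> ereal t} - {j \<in> C. b j \<le> ereal s}) \<le> card ({j \<in> C. a j \<le> t} - {j \<in> C. a j \<le> s})"
      using arrived(1)[OF tT(1)] by (intro card_mono) auto
    moreover have "{j \<in> C. b j \<le> ereal s} \<subseteq> {j \<in> C. b j \<le> ereal t}"
    proof -
      have "ereal s \<le> ereal t" using t by simp
      from order_trans[OF _ this] show ?thesis by auto
    qed
    then have "card ({j \<in> C. b j \<le> ereal t} - {j \<in> C. b j \<le> ereal s}) = card {j \<in> C. b j \<le> ereal t} - card {j \<in> C. b j \<le> ereal s}"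
      by (rule card_Diff_subset[OF finite_entered[OF tT(2)]])
    moreover have "card ({j \<in> C. a j \<le> t} - {j \<in> C. a j \<le> s}) = card {j \<in> C. a j \<le> t} - card {j \<in> C. a j \<le> s}"
      using t by (intro card_Diff_subset[OF arrived(1)[OF tT(2)]]) auto
    moreover have "card {j \<in> C. b j \<le> ereal t} = S t + of_bool (0 < X t)" "card {j \<in> C. b j \<le> ereal s} = S s + of_bool (0 < X s)"
      using entered_eq[of t] entered_eq[of s] D_busy[OF busy_mono[OF busy], of t] D_busy[OF busy_mono[OF busy], of s] tT t
      by (simp_all add: r_def)
    ultimately have "S t - (S s + 1) \<le> (X 0 + E t) - (X 0 + E s)"
      unfolding arrived(2)[OF tT(1)] arrived(2)[OF tT(2)] by (simp add: of_bool_def split: if_splits)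
    moreover have "E s \<le> E t"
    proof -
      have "card {j \<in> C. a j \<le> s} \<le> card {j \<in> C. a j \<le> t}"
        using t by (intro card_mono[OF arrived(1)[OF tT(1)]]) auto
      then show ?thesis unfolding arrived(2)[OF tT(1)] arrived(2)[OF tT(2)] by simp
    qed
    ultimately have "real (S t) - real (S s) - 1 \<le> real (E t) - real (E s)" by linarith
    then have "mu * n * t - mu * n * s - lam * n * t + lam * n * s \<le> 5 * (eps * n)"
      using E_approx[OF tT(1)] E_approx[OF tT(2)] S_approx[OF tT(1)] S_approx[OF tT(2)] rates by linarith
    then have "n * ((mu - lam) * (t - s)) \<le> n * (5 * eps)" by (simp add: algebra_simps)
    then show ?thesis using rates by (simp only: mult_le_cancel_left_pos)
  qed
  have "u i \<le> 5 * eps / (mu - lam)"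
  \<comment> \<open>Entries at the instant \<open>r\<close> itself are outside \<open>K\<close>, so
    \<open>slow\<close> stops short of \<open>r\<close>; the bound is passed to the limit.\<close>
  proof (rule dense_le_bounded)
    show "0 < u i" using lead_pos i by simp
    fix w assume "0 < w" "w < u i"
    then have "(mu - lam) * w \<le> 5 * eps" using slow[of "s + w"] \<open>s < a i\<close> by (simp add: r_def)
    then show "w \<le> 5 * eps / (mu - lam)" using rates by (simp add: field_simps)
  qed
  then show "(mu - lam) * u i \<le> 5 * eps" using rates by (simp add: field_simps)
qed

text \<open>Entries at one instant are governed by a jump of \<open>S\<close>, and a function
  uniformly close to a continuous one has only small jumps.\<close>

lemma entered_jump:
  assumes "r \<in> {0<..T}" "busy r"
  shows "real (card {i \<in> C. b i = ereal r}) \<le> 4 * eps * n"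
proof -
  have "mu > 0" using rates by simp
  \<comment> \<open>The step back by \<open>eps / mu\<close> costs at most \<open>eps * n\<close>
    completions. Two errors of \<open>S\<close> and one unit complete the
    \<open>4 * eps * n\<close>.\<close>
  define t where "t = max 0 (r - eps / mu)"
  have t: "0 \<le> t" "t < r" "mu * (r - t) \<le> eps"
  proof -
    show "0 \<le> t" "t < r" using assms eps_pos \<open>mu > 0\<close> by (auto simp: t_def)
    have "r - t \<le> eps / mu" by (auto simp: t_def)
    then show "mu * (r - t) \<le> eps" using \<open>mu > 0\<close> by (simp add: field_simps)
  qed
  have tT: "t \<in> {0..T}" "r \<in> {0..T}" using t assms by auto
  have fin: "finite {i \<in> C. b i = ereal r}"
    by (rule finite_subset[OF _ finite_entered[OF tT(2)]]) auto
  have "card ({i \<in> C. b i = ereal r} \<union> {i \<in> C. b i \<le> ereal t}) = card {i \<in> C. b i = ereal r} + card {i \<in> C. b i \<le> ereal t}"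
    using t by (intro card_Un_disjoint fin finite_entered[OF tT(1)]) auto
  moreover have "card ({i \<in> C. b i = ereal r} \<union> {i \<in> C. b i \<le> ereal t}) \<le> card {i \<in> C. b i \<le> ereal r}"
  proof (rule card_mono[OF finite_entered[OF tT(2)]])
    have "ereal t \<le> ereal r" using t by simp
    from order_trans[OF _ this] show "{i \<in> C. b i = ereal r} \<union> {i \<in> C. b i \<le> ereal t} \<subseteq> {i \<in> C. b i \<le> ereal r}"
      by auto
  qed
  moreover have "card {i \<in> C. b i \<le> ereal r} = S r + of_bool (0 < X r)" "card {i \<in> C. b i \<le> ereal t} = S t + of_bool (0 < X t)"
    using entered_eq[of t] entered_eq[of r] D_busy[OF assms(2)] D_busy[OF busy_mono[OF assms(2)], of t] tT t
    by simp_all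
  ultimately have "card {i \<in> C. b i = ereal r} + S t \<le> S r + 1"
    by (simp add: of_bool_def split: if_splits)
  then have "real (card {i \<in> C. b i = ereal r}) + real (S t) \<le> real (S r) + 1" by linarith
  moreover have "n * (mu * (r - t)) \<le> n * eps" using t rates by simp
  then have "mu * n * r - mu * n * t \<le> eps * n" by (simp add: algebra_simps)
  ultimately show ?thesis using S_approx[OF tT(1)] S_approx[OF tT(2)] rates by linarith
qed

text \<open>Entries before \<open>r\<close> from among the pending customers are excluded by
  \<open>none\<close>. What remains is queued or enters exactly at \<open>r\<close>, and the latter
  are few by \<open>entered_jump\<close>.\<close>

lemma pending_le_queue:
  assumes r: "r \<in> {0<..T}" "busy r"
    and none: "\<not> (\<exists>k\<in>C. 0 < b k \<and> b k < ereal r \<and> r < u k + a k)"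
  shows "real (card (pending r)) \<le> real (X r) + 4 * eps * n"
proof -
  have rT: "r \<in> {0..T}" using r by auto
  have "pending r \<subseteq> Q r \<union> {i \<in> C. b i = ereal r}"
    using none by (fastforce simp: pending_def queue_set_def)
  then have "card (pending r) \<le> card (Q r \<union> {i \<in> C. b i = ereal r})"
    using finite_Q[OF rT] finite_subset[OF _ finite_entered[OF rT], of "{i \<in> C. b i = ereal r}"]
    by (intro card_mono finite_UnI) (assumption, fastforce)
  also have "\<dots> \<le> card (Q r) + card {i \<in> C. b i = ereal r}" by (rule card_Un_le)
  also have "card (Q r) \<le> X r" using card_Q[OF rT] by (simp add: queue_length_def)
  finally show ?thesis using entered_jump[OF r] by linarith
qed

text \<open>Reneged customers who were overtaken number at most \<open>small\<close>. For the
  others, collected in \<open>G\<close>, the latest deadline \<open>r\<close> decides: all of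
  \<open>G\<close> has reneged by \<open>r\<close>, and there queue and \<open>pending\<close>
  nearly coincide, which turns the balance equation into a bound for \<open>R r\<close>.\<close>

lemma R_upper:
  assumes t: "t \<in> {0..T}" "busy t"
  defines "small \<equiv> card {i. 1 \<le> i \<and> a i \<le> T \<and> (mu - lam) * u i \<le> 5 * eps}"
  shows "R t \<le> small \<or> (\<exists>r\<in>{0..t}. real (R t) \<le> small + 4 * eps * n
           + (real (X 0) + real (E r) - real (S r) - real (card (pending r))))"
proof -
  have fin: "finite {i. 1 \<le> i \<and> a i \<le> T \<and> (mu - lam) * u i \<le> 5 * eps}"
    by (rule finite_subset[OF _ conjunct1[OF arrivals[of T]]]) (use t in auto)
  let ?Y = "\<lambda>t. {i \<in> C. b i = \<infinity> \<and> u i + a i \<le> t}"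
  define G where "G = {i \<in> ?Y t. \<not> (\<exists>k\<in>C. 0 < b k \<and> b k < ereal (u i + a i) \<and> u i + a i < u k + a k)}"
  have finG: "finite G" by (rule finite_subset[OF _ finite_reneged[OF t(1)]]) (auto simp: G_def)
  have bad: "?Y t - G \<subseteq> {i. 1 \<le> i \<and> a i \<le> T \<and> (mu - lam) * u i \<le> 5 * eps}"
  proof
    fix i assume i: "i \<in> ?Y t - G"
    then obtain k where k: "k \<in> C" "0 < b k" "b k < ereal (u i + a i)" "u i + a i < u k + a k"
      by (auto simp: G_def)
    have "u i + a i \<le> t" "t \<le> T" using i t by auto
    then have "1 \<le> i" "(mu - lam) * u i \<le> 5 * eps"
      using overtaken_reneging[OF _ _ _ _ k] i t busy_mono[OF t(2)] by auto
    then show "i \<in> {i. 1 \<le> i \<and> a i \<le> T \<and> (mu - lam) * u i \<le> 5 * eps}"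
      using i lead_pos[of i] t by auto
  qed
  show ?thesis
  proof (cases "G = {}")
    case True
    then have "R t \<le> small" using card_mono[OF fin bad] R_eq[of t] t by (simp add: small_def)
    then show ?thesis ..
  next
    case False
    define r where "r = Max ((\<lambda>i. u i + a i) ` G)"
    have "r \<in> (\<lambda>i. u i + a i) ` G" unfolding r_def using finG False by (intro Max_in) auto
    then obtain i where i: "i \<in> G" "r = u i + a i" by blast
    have max: "u j + a j \<le> r" if "j \<in> G" for j using that finG by (simp add: r_def)
    have "0 \<in> {0..T}" using t by auto
    \<comment> \<open>\<open>R 0 = 0\<close> and finiteness exclude deadlines up to 0;
      \<open>r\<close> must be positive because \<open>entered_jump\<close> looks at an instant
      before it.\<close>
    have "?Y 0 = {}" using R_eq[of 0] path finite_reneged[of 0] t unfolding edf_path_def by auto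
    then have r0: "0 < r" using i by (fastforce simp: G_def)
    have rt: "r \<le> t" using i by (auto simp: G_def)
    have rT: "r \<in> {0<..T}" "r \<in> {0..T}" using r0 rt t by auto
    have "?Y t \<subseteq> ?Y r \<union> (?Y t - G)" using max by (auto simp: G_def)
    then have "card (?Y t) \<le> card (?Y r \<union> (?Y t - G))"
      using finite_reneged[OF t(1)] finite_reneged[OF rT(2)] by (intro card_mono) auto
    also have "\<dots> \<le> card (?Y r) + card (?Y t - G)" by (rule card_Un_le)
    finally have "R t \<le> R r + small"
      using card_mono[OF fin bad] R_eq[of t] R_eq[of r] t rT by (simp add: small_def)
    moreover have "real (card (pending r)) \<le> real (X r) + 4 * eps * n"
      by (rule pending_le_queue[OF rT(1) busy_mono[OF t(2) rt]]) (use i in \<open>auto simp: G_def\<close>)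
    moreover have "int (X r) = int (X 0) + int (E r) - int (S r) - int (R r)"
      using X_eq[of r] D_busy[OF busy_mono[OF t(2) rt]] r0 by simp
    ultimately have "real (R t) \<le> small + 4 * eps * n
           + (real (X 0) + real (E r) - real (S r) - real (card (pending r)))" by linarith
    then show ?thesis using r0 rt by auto
  qed
qed

text \<open>Reneging is nondecreasing and the number in system at \<open>s\<close> is at most the
  pending customers plus the one in service, whence the 1.\<close>

lemma R_lower:
  assumes t: "t \<in> {0..T}" "busy t" and s: "s \<in> {0..t}"
  shows "real (X 0) + real (E s) - real (S s) - real (card (pending s)) - 1 \<le> real (R t)"
proof -
  have sT: "s \<in> {0..T}" using s t by auto
  have "int (X s) = int (X 0) + int (E s) - int (S s) - int (R s)"
    using X_eq[of s] D_busy[OF busy_mono[OF t(2)]] s by simp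
  moreover have "R s \<le> R t" using R_mono s t by auto
  ultimately show ?thesis using X_le_pending[OF sT] by linarith
qed

text \<open>From an idle time \<open>p\<close> within \<open>eps / mu\<close> of the last ones, the
  server works nearly all the time up to \<open>t\<close> and the arrivals are slower than the
  completions. Two errors each of \<open>E\<close> and \<open>S\<close> plus the gap after
  \<open>p\<close> give 5.\<close>

lemma X_small_after_idle:
  assumes t: "t \<in> {0..T}" and s: "s \<in> {0..t}" "X s = 0"
  shows "real (X t) \<le> 5 * eps * n"
proof -
  have "mu > 0" using rates by simp
  define w where "w = Sup {s \<in> {0..t}. X s = 0}"
  have bdd: "bdd_above {s \<in> {0..t}. X s = 0}" by (auto intro: bdd_aboveI[of _ t])
  have ne: "{s \<in> {0..t}. X s = 0} \<noteq> {}" using s by auto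
  have w: "s \<le> w" "w \<le> t" unfolding w_def using s by (intro cSup_upper bdd cSup_least ne; simp)+
  have "w - eps / mu < Sup {s \<in> {0..t}. X s = 0}" using eps_pos \<open>mu > 0\<close> by (simp add: w_def)
  then obtain p where p: "p \<in> {0..t}" "X p = 0" "w - eps / mu < p"
    using less_cSup_iff[OF ne bdd] by auto
  have pw: "p \<le> w" unfolding w_def using p by (intro cSup_upper bdd) simp
  have "0 < X v" if "v \<in> {w<..t}" for v
  proof (rule ccontr)
    assume "\<not> 0 < X v"
    then have "v \<in> {s \<in> {0..t}. X s = 0}" using that w s by auto
    then have "v \<le> w" unfolding w_def by (intro cSup_upper bdd)
    then show False using that by auto
  qed
  then have B: "t - w \<le> busy_time t - busy_time p"
    using p pw w by (intro busy_time_diff) auto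
  have pT: "p \<in> {0..T}" using p t by auto
  have bT: "busy_time t \<in> {0..T}" "busy_time p \<in> {0..T}"
    using busy_time_bounds[of t] busy_time_bounds[of p] t p by auto
  have "R p \<le> R t" using R_mono p t by auto
  then have "real (X t) \<le> real (E t) - real (E p) - (real (D t) - real (D p))"
    using X_eq[of t] X_eq[of p] p t by auto
  also have "\<dots> \<le> lam * n * t - lam * n * p - (mu * n * busy_time t - mu * n * busy_time p) + 4 * eps * n"
    using E_approx[OF t] E_approx[OF pT] S_approx[OF bT(1)] S_approx[OF bT(2)] unfolding D_eq by linarith
  also have "\<dots> = n * (lam * (t - p) - mu * (busy_time t - busy_time p) + 4 * eps)"
    by (simp add: algebra_simps)
  also have "\<dots> \<le> n * (5 * eps)"
  proof (rule mult_left_mono)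
    have "t - p \<le> busy_time t - busy_time p + eps / mu" using B p by linarith
    then have "mu * (t - p) \<le> mu * (busy_time t - busy_time p + eps / mu)"
      using \<open>mu > 0\<close> by (intro mult_left_mono) auto
    also have "\<dots> = mu * (busy_time t - busy_time p) + eps" using \<open>mu > 0\<close> by (simp add: algebra_simps)
    moreover have "lam * (t - p) \<le> mu * (t - p)" using p rates by (intro mult_right_mono) auto
    ultimately show "lam * (t - p) - mu * (busy_time t - busy_time p) + 4 * eps \<le> 5 * eps" by linarith
  qed (use rates in auto)
  finally show ?thesis by (simp add: mult.commute mult.left_commute)
qed

text \<open>Up to the first idle time the balance equation and the two-sided bounds on
  \<open>R\<close> give closeness to \<phi>. Later both the queue and the positive part of \<phi>
  are small. Of the 14, the last unit is the difference between queue length and number in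
  system.\<close>

lemma queue_approx:
  fixes psi H :: "real \<Rightarrow> real" and eta :: real
  defines "phi \<equiv> \<lambda>t. psi t - (SUP s\<in>{0..t}. max (psi s - H s) 0)"
  assumes cont: "continuous_on {0..} psi" "continuous_on {0..} H"
    and anti: "\<And>s t. 0 \<le> s \<Longrightarrow> s \<le> t \<Longrightarrow> psi t \<le> psi s"
    and psi: "\<And>t. t \<in> {0..T} \<Longrightarrow> \<bar>real (X 0) + real (E t) - real (S t) - n * psi t\<bar> \<le> 4 * eps * n"
    and H: "\<And>t. t \<in> {0..T} \<Longrightarrow> \<bar>real (card (pending t)) - n * H t\<bar> \<le> eps * n"
    and small: "real (card {i. 1 \<le> i \<and> a i \<le> T \<and> (mu - lam) * u i \<le> 5 * eps}) \<le> eta * n"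
    and t: "t \<in> {0..T}"
  shows "\<bar>real (queue_length X t) / n - max (phi t) 0\<bar> \<le> 14 * eps + eta"
proof -
  let ?g = "\<lambda>s. max (psi s - H s) 0"
  have bdd: "bdd_above (?g ` {0..t})" for t
  proof -
    have "continuous_on {0..t} ?g"
      by (intro continuous_intros) (auto intro: continuous_on_subset[OF cont(1)] continuous_on_subset[OF cont(2)])
    then have "compact (?g ` {0..t})" by (rule compact_continuous_image) simp
    then show ?thesis by (intro bounded_imp_bdd_above compact_imp_bounded)
  qed
  have "0 \<le> eta * n" using small by linarith
  then have eta: "0 \<le> eta" using rates by (simp add: zero_le_mult_iff)
  \<comment> \<open>6 is 4 for \<open>psi\<close>, 1 for \<open>H\<close> and 1 for the customer in
    service.\<close>
  have R_lower': "n * (SUP s\<in>{0..t}. ?g s) \<le> real (R t) + 6 * eps * n" if t: "t \<in> {0..T}" "busy t" for t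
  proof -
    have "(SUP s\<in>{0..t}. ?g s) \<le> (real (R t) + 6 * eps * n) / n"
    proof (rule cSUP_least)
      fix s assume s: "s \<in> {0..t}"
      then have sT: "s \<in> {0..T}" using t by auto
      have "n * (psi s - H s) \<le> real (R t) + 6 * eps * n"
        using R_lower[OF t s] psi[OF sT] H[OF sT] rates by (simp add: algebra_simps)
      moreover have "0 \<le> real (R t) + 6 * eps * n" using rates eps_pos by simp
      ultimately show "?g s \<le> (real (R t) + 6 * eps * n) / n" using rates by (simp add: field_simps)
    qed (use t in auto)
    then show ?thesis using rates by (simp add: field_simps)
  qed
  \<comment> \<open>9 is 4 from \<open>R_upper\<close>, 4 for \<open>psi\<close> and 1 for
    \<open>H\<close>; \<open>eta\<close> pays for the overtaken customers.\<close>
  have R_upper': "real (R t) \<le> n * (SUP s\<in>{0..t}. ?g s) + 9 * eps * n + eta * n" if t: "t \<in> {0..T}" "busy t" for t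
  proof -
    have up: "?g s \<le> (SUP s\<in>{0..t}. ?g s)" if "s \<in> {0..t}" for s using that by (rule cSUP_upper[OF _ bdd])
    from R_upper[OF t] show ?thesis
    proof (elim disjE bexE)
      assume "R t \<le> card {i. 1 \<le> i \<and> a i \<le> T \<and> (mu - lam) * u i \<le> 5 * eps}"
      then have "real (R t) \<le> eta * n" using small by linarith
      moreover have "0 \<le> (SUP s\<in>{0..t}. ?g s)" using up[of 0] t by auto
      then have "0 \<le> n * (SUP s\<in>{0..t}. ?g s)" using rates by simp
      moreover have "0 \<le> 9 * eps * n" using rates eps_pos by simp
      ultimately show ?thesis by linarith
    next
      fix r assume r: "r \<in> {0..t}" and R: "real (R t) \<le>
        real (card {i. 1 \<le> i \<and> a i \<le> T \<and> (mu - lam) * u i \<le> 5 * eps}) + 4 * eps * n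
           + (real (X 0) + real (E r) - real (S r) - real (card (pending r)))"
      have rT: "r \<in> {0..T}" using r t by auto
      have "psi r - H r \<le> (SUP s\<in>{0..t}. ?g s)" using up[OF r] by linarith
      then have "n * (psi r - H r) \<le> n * (SUP s\<in>{0..t}. ?g s)" using rates by simp
      then have "n * psi r - n * H r \<le> n * (SUP s\<in>{0..t}. ?g s)" by (simp add: algebra_simps)
      then show ?thesis using R small psi[OF rT] H[OF rT] by linarith
    qed
  qed
  have nphi: "n * phi t = n * psi t - n * (SUP s\<in>{0..t}. ?g s)" for t
    by (simp add: phi_def algebra_simps)
  have anti_phi: "phi t \<le> phi s" if "0 \<le> s" "s \<le> t" for s t
  proof -
    have "(SUP s\<in>{0..s}. ?g s) \<le> (SUP s\<in>{0..t}. ?g s)"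
      using that by (intro cSUP_subset_mono bdd) auto
    then show ?thesis using anti[OF that] by (simp add: phi_def)
  qed
  have X_busy: "real (X t) = real (X 0) + real (E t) - real (S t) - real (R t)" if "t \<in> {0..T}" "busy t" for t
    using X_eq[of t] D_busy[of t] that by auto
  have approx: "\<bar>real (X t) - n * phi t\<bar> \<le> 13 * eps * n + eta * n" if t: "t \<in> {0..T}" "busy t" for t
  proof -
    have "0 \<le> eps * n" "0 \<le> eta * n" using rates eta by auto
    then show ?thesis
      using X_busy[OF t] R_upper'[OF t] R_lower'[OF t] psi[OF t(1)] nphi[of t] by linarith
  qed
  have main: "\<bar>real (X t) - n * max (phi t) 0\<bar> \<le> 13 * eps * n + eta * n"
  proof (cases "busy t")
    case True
    have "n * max (phi t) 0 = max (n * phi t) 0" using rates by (simp add: max_def mult_le_0_iff)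
    then show ?thesis using approx[OF t True] by linarith
  next
    case False
    then obtain p where p: "p \<in> {0..<t}" "X p = 0" by (auto simp: busy_def)
    define w where "w = Inf {s. 0 \<le> s \<and> X s = 0}"
    have bdd': "bdd_below {s. 0 \<le> s \<and> X s = 0}" by (auto intro: bdd_belowI[of _ 0])
    have w: "0 \<le> w" "w \<le> p" unfolding w_def using p by (intro cInf_lower bdd' cInf_greatest; auto)+
    have w_busy: "busy w"
    proof (unfold busy_def, intro ballI, rule ccontr)
      fix s assume s: "s \<in> {0..<w}" "\<not> 0 < X s"
      then have "w \<le> s" unfolding w_def by (intro cInf_lower bdd') auto
      then show False using s by auto
    qed
    \<comment> \<open>The infimum is attained: a positive value at \<open>w\<close> would persist to
      the right and push the idle times away from \<open>w\<close>.\<close>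
    have "X w = 0"
    proof (rule ccontr)
      assume w0: "X w \<noteq> 0"
      from rcll_nat_right_constant[OF rcll_X w(1)] obtain c where c: "w < c" "\<And>s. w < s \<Longrightarrow> s < c \<Longrightarrow> X s = X w"
        unfolding eventually_at_right_field by blast
      have "c \<le> w" unfolding w_def
      proof (rule cInf_greatest)
        fix s assume s: "s \<in> {s. 0 \<le> s \<and> X s = 0}"
        then have "w \<le> s" unfolding w_def by (intro cInf_lower bdd')
        then show "c \<le> s" using c(2)[of s] w0 s by (cases "s = w") force+
      qed (use p in auto)
      then show False using c by simp
    qed
    moreover have "w \<in> {0..T}" using w p t by auto
    ultimately have "n * phi w \<le> 13 * eps * n + eta * n" using approx[of w] w_busy by simp
    moreover have "n * phi t \<le> n * phi w" using anti_phi[of w t] w p rates by simp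
    moreover have "0 \<le> 13 * eps * n + eta * n" using rates eta by simp
    moreover have "n * max (phi t) 0 = max (n * phi t) 0" using rates by (simp add: max_def mult_le_0_iff)
    moreover have "0 \<le> n * max (phi t) 0" using rates by simp
    moreover have "real (X t) \<le> 5 * eps * n" using X_small_after_idle[OF t, of p] p by auto
    moreover have "0 \<le> eps * n" "0 \<le> eta * n" using rates eta by auto
    ultimately show ?thesis by linarith
  qed
  have "\<bar>real (queue_length X t) - real (X t)\<bar> \<le> eps * n"
    using rates(4) by (auto simp: queue_length_def)
  then have "\<bar>real (queue_length X t) - n * max (phi t) 0\<bar> \<le> n * (14 * eps + eta)"
    using main by (simp add: algebra_simps)
  moreover have "real (queue_length X t) / n - max (phi t) 0 = (real (queue_length X t) - n * max (phi t) 0) / n"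
    using rates by (simp add: field_simps)
  ultimately show ?thesis using rates by (simp add: abs_divide pos_divide_le_eq mult.commute)
qed

end

section \<open>The fluid limit\<close>

text \<open>Between nearby times \<open>p \<le> q\<close> the supremum can grow only by the
  oscillation of \<open>g\<close> on [p, q].\<close>

lemma continuous_on_running_sup:
  fixes g :: "real \<Rightarrow> real"
  assumes g: "continuous_on {0..} g"
  shows "continuous_on {0..} (\<lambda>t. SUP s\<in>{0..t}. g s)"
proof -
  let ?M = "\<lambda>t. SUP s\<in>{0..t}. g s"
  have bdd: "bdd_above (g ` {0..t})" for t
  proof -
    have "compact (g ` {0..t})"
      by (intro compact_continuous_image continuous_on_subset[OF g]) auto
    then show ?thesis by (intro bounded_imp_bdd_above compact_imp_bounded)
  qed
  have upper: "g s \<le> ?M t" if "s \<in> {0..t}" for s t using that by (rule cSUP_upper[OF _ bdd])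
  show ?thesis
  proof (rule continuous_onI)
    fix t e :: real assume t: "t \<in> {0..}" and e: "0 < e"
    have "\<exists>d>0. \<forall>x\<in>{0..}. dist x t < d \<longrightarrow> dist (g x) (g t) < e / 2"
      using g[unfolded continuous_on_iff, rule_format, of t "e / 2"] t e by auto
    then obtain d where d: "0 < d" and dist: "\<And>x. x \<in> {0..} \<Longrightarrow> dist x t < d \<Longrightarrow> dist (g x) (g t) < e / 2"
      by blast
    have near: "g t - e / 2 < g x \<and> g x < g t + e / 2" if "0 \<le> x" "\<bar>x - t\<bar> < d" for x
      using dist[of x] that unfolding dist_real_def abs_diff_less_iff by simp
    have step: "?M p \<le> ?M q \<and> ?M q \<le> ?M p + e" if pq: "0 \<le> p" "p \<le> q" "\<bar>p - t\<bar> < d" "\<bar>q - t\<bar> < d" for p q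
    proof
      show "?M p \<le> ?M q" using pq by (intro cSUP_subset_mono bdd) auto
      show "?M q \<le> ?M p + e"
      proof (rule cSUP_least)
        fix x assume x: "x \<in> {0..q}"
        show "g x \<le> ?M p + e"
        proof (cases "x \<le> p")
          case True
          then show ?thesis using upper[of x p] x e by simp
        next
          case False
          then have "\<bar>x - t\<bar> < d" using x pq by auto
          then show ?thesis using near[of x] near[of p] upper[of p p] x pq by auto
        qed
      qed (use pq in auto)
    qed
    have "dist (?M x) (?M t) \<le> e" if x: "x \<in> {0..}" "dist x t < d" for x
      using step[of x t] step[of t x] x t d by (cases "x \<le> t") (auto simp: dist_real_def)
    then show "\<exists>d>0. \<forall>x'\<in>{0..}. dist x' t < d \<longrightarrow> dist (?M x') (?M t) \<le> e" using d by blast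
  qed
qed

context
  fixes lam mu :: real and G :: "real \<Rightarrow> real" and Q0 :: "real measure"
  assumes rates: "lam < mu" and G: "mono G" and Q0: "Q0 \<in> finite_nn_measures"
    and cont: "continuous_on {0..} (\<lambda>x. measure Q0 {0..x})" and zero: "measure Q0 {0..0} = 0"
begin

text \<open>Reflecting the integration variable brings \<open>fluid_H\<close> into the pattern of
  \<open>card_pending\<close>: initial mass minus its expired part, plus arrivals minus
  theirs.\<close>

lemma fluid_H_eq:
  assumes "0 \<le> t"
  shows "fluid_H lam G Q0 0 t = measure Q0 {0..} - measure Q0 {0..t} + lam * (t - integral {0..t} G)"
proof -
  have sets: "sets Q0 = sets nn_borel" and "finite_measure Q0" using Q0 by (auto simp: finite_nn_measures_def)
  then interpret finite_measure Q0 by simp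
  have in_sets: "A \<in> sets Q0" if "A \<in> sets borel" "A \<subseteq> {0..}" for A
    using that unfolding sets nn_borel_def by (subst sets_restrict_space_iff) auto
  have "measure Q0 {t<..} = measure Q0 ({0..} - {0..t})" using assms by (intro arg_cong[where f = "measure Q0"]) auto
  also have "\<dots> = measure Q0 {0..} - measure Q0 {0..t}"
    by (intro finite_measure_Diff in_sets) auto
  finally have 1: "measure Q0 {t<..} = measure Q0 {0..} - measure Q0 {0..t}" .
  have int: "(\<lambda>s. G (t - s)) integrable_on {0..t}"
  proof -
    have "(\<lambda>s. - G (t - s)) integrable_on {0..t}"
      using G by (intro integrable_on_mono_on) (auto simp: mono_on_def mono_def)
    then show ?thesis using integrable_neg by fastforce
  qed
  have "integral {0..t} (\<lambda>s. G (t - s)) = integral {- t..- 0} (\<lambda>x. G (t - (- x)))"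
    by (rule Henstock_Kurzweil_Integration.integral_reflect_real[symmetric])
  also have "\<dots> = integral {0 - t..t - t} (\<lambda>x. G (x + t))" by (simp add: add.commute)
  also have "\<dots> = integral {0..t} G" by (rule integral_shift_real_ivl)
  finally have "integral {0..t} (\<lambda>s. 1 - G (t - s)) = t - integral {0..t} G"
    using assms int by (subst Henstock_Kurzweil_Integration.integral_diff) auto
  then show ?thesis using 1 by (simp add: fluid_H_def)
qed

lemma continuous_on_fluid_H: "continuous_on {0..} (fluid_H lam G Q0 0)"
proof -
  have "continuous_on {0..} (\<lambda>t. integral {0..t} G)"
  proof -
    have "continuous_on {0..b} (\<lambda>t. integral {0..t} G)" for b
      using G by (intro indefinite_integral_continuous_1 integrable_on_mono_on) (auto simp: mono_on_def mono_def)
    note c = this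
    show ?thesis
      unfolding continuous_on_eq_continuous_within
    proof
      fix t :: real assume t: "t \<in> {0..}"
      have "continuous (at t within {0..t + 1}) (\<lambda>t. integral {0..t} G)"
        using c[of "t + 1"] t by (auto simp: continuous_on_eq_continuous_within)
      moreover have "at t within {0..t + 1} = at t within {0..}"
        by (rule at_within_nhd[of t "{..<t + 1}"]) auto
      ultimately show "continuous (at t within {0..}) (\<lambda>t. integral {0..t} G)" by simp
    qed
  qed
  then have "continuous_on {0..} (\<lambda>t. measure Q0 {0..} - measure Q0 {0..t} + lam * (t - integral {0..t} G))"
    by (intro continuous_intros cont)
  then show ?thesis using fluid_H_eq by (subst continuous_on_cong[OF refl]) auto
qed

lemma continuous_on_fluid_psi: "continuous_on {0..} (fluid_psi lam mu Q0)"
  unfolding fluid_psi_def by (intro continuous_intros)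

lemma continuous_on_fluid_phi: "continuous_on {0..} (fluid_phi lam mu G Q0)"
  unfolding fluid_phi_def
  by (intro continuous_intros continuous_on_fluid_psi continuous_on_running_sup continuous_on_max continuous_on_fluid_H)

lemma fluid_psi_antimono: "s \<le> t \<Longrightarrow> fluid_psi lam mu Q0 t \<le> fluid_psi lam mu Q0 s"
  using rates by (simp add: fluid_psi_def mult_left_mono_neg)

lemma fluid_phi_antimono:
  assumes "0 \<le> s" "s \<le> t"
  shows "fluid_phi lam mu G Q0 t \<le> fluid_phi lam mu G Q0 s"
proof -
  let ?g = "\<lambda>s. max (fluid_psi lam mu Q0 s - fluid_H lam G Q0 0 s) 0"
  have "compact (?g ` {0..t})"
    by (intro compact_continuous_image continuous_on_max continuous_intros
        continuous_on_subset[OF continuous_on_fluid_psi] continuous_on_subset[OF continuous_on_fluid_H]) auto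
  then have "bdd_above (?g ` {0..t})" by (intro bounded_imp_bdd_above compact_imp_bounded)
  then have "(SUP s\<in>{0..s}. ?g s) \<le> (SUP s\<in>{0..t}. ?g s)" using assms by (intro cSUP_subset_mono) auto
  then show ?thesis using fluid_psi_antimono[OF assms(2)] by (simp add: fluid_phi_def)
qed

text \<open>\<phi> is nonincreasing, continuous and initially nonnegative, so it is positive exactly
  before its first zero; cutting it off there is the same as taking the positive part.\<close>

lemma fluid_limit_eq:
  assumes t: "0 \<le> t"
  shows "fluid_limit lam mu G Q0 t = max (fluid_phi lam mu G Q0 t) 0"
proof (cases "0 < fluid_phi lam mu G Q0 t")
  case True
  have "ereal t \<le> fluid_T lam mu G Q0"
    unfolding fluid_T_def
  proof (rule Inf_greatest)
    fix x assume "x \<in> {ereal t | t. 0 \<le> t \<and> fluid_phi lam mu G Q0 t = 0}"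
    then obtain s where s: "x = ereal s" "0 \<le> s" "fluid_phi lam mu G Q0 s = 0" by blast
    then show "ereal t \<le> x" using fluid_phi_antimono[of s t] True by (cases "s \<le> t") auto
  qed
  then show ?thesis using True by (simp add: fluid_limit_def)
next
  case False
  \<comment> \<open>Without mass at 0, \<psi> and H agree at time 0 and the supremum vanishes.
    \<phi> thus starts at a nonnegative value and the intermediate value theorem yields a zero up to
    \<open>t\<close>.\<close>
  have "fluid_phi lam mu G Q0 0 = measure Q0 {0..}"
    using fluid_H_eq[of 0] zero by (simp add: fluid_phi_def fluid_psi_def)
  then have "\<exists>s. 0 \<le> s \<and> s \<le> t \<and> fluid_phi lam mu G Q0 s = 0"
    using False t by (intro IVT2') (auto intro: continuous_on_subset[OF continuous_on_fluid_phi])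
  then obtain s where s: "0 \<le> s" "s \<le> t" "fluid_phi lam mu G Q0 s = 0" by blast
  then have "fluid_T lam mu G Q0 \<le> ereal s" unfolding fluid_T_def by (intro Inf_lower) auto
  then have "fluid_phi lam mu G Q0 t = 0" if "ereal t \<le> fluid_T lam mu G Q0"
  proof -
    have "ereal t \<le> ereal s" using that \<open>fluid_T lam mu G Q0 \<le> ereal s\<close> by (rule order_trans)
    then show ?thesis using s by (cases "s = t") auto
  qed
  then show ?thesis using False by (auto simp: fluid_limit_def)
qed

lemma continuous_on_fluid_limit: "continuous_on {0..} (fluid_limit lam mu G Q0)"
proof -
  have "continuous_on {0..} (\<lambda>t. max (fluid_phi lam mu G Q0 t) 0)"
    by (intro continuous_on_max continuous_on_fluid_phi continuous_intros)
  then show ?thesis using fluid_limit_eq by (subst continuous_on_cong[OF refl]) auto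
qed

end

section \<open>Expired and pending customers compared with their fluid values\<close>

context edf_sample
begin

lemma arrival_index:
  assumes mono: "\<And>i j. 1 \<le> i \<Longrightarrow> i < j \<Longrightarrow> a i < a j" and i: "1 \<le> i"
  shows "a i \<in> {0..T} \<Longrightarrow> int (E (a i)) = i" and "s \<in> {0..T} \<Longrightarrow> a i \<le> s \<longleftrightarrow> i \<le> int (E s)"
proof -
  have le: "a j \<le> a i \<longleftrightarrow> j \<le> i" if "1 \<le> j" "1 \<le> i" for i j
    using mono[of i j] mono[of j i] that by (cases i j rule: linorder_cases) auto
  have 1: "i \<le> int (E s)" if "s \<in> {0..T}" "a i \<le> s"
  proof -
    have "{1..i} \<subseteq> {j. 1 \<le> j \<and> a j \<le> s}" using le[OF _ i] that by force
    then have "card {1..i} \<le> E s" using arrivals[OF that(1)] card_mono by metis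
    then show ?thesis by simp
  qed
  have 2: "int (E s) < i" if "s \<in> {0..T}" "s < a i"
  proof -
    have "{j. 1 \<le> j \<and> a j \<le> s} \<subseteq> {1..<i}" using le[OF i] that by (force simp: not_le[symmetric])
    then have "card {j. 1 \<le> j \<and> a j \<le> s} \<le> card {1..<i}" by (rule card_mono[rotated]) simp
    then have "E s \<le> card {1..<i}" using arrivals[OF that(1)] by simp
    then show ?thesis using i by simp
  qed
  show "s \<in> {0..T} \<Longrightarrow> a i \<le> s \<longleftrightarrow> i \<le> int (E s)" using 1 2 by (meson not_le)
  assume ai: "a i \<in> {0..T}"
  have "{j. 1 \<le> j \<and> a j \<le> a i} = {1..i}" using le[OF _ i] by auto
  then show "int (E (a i)) = i" using arrivals[OF ai] i by auto
qed

text \<open>Closeness of \<open>E\<close> to its mean places each arrival within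
  \<open>e / lam\<close> of \<open>i / (lam * n)\<close>. The expired arrivals are therefore
  squeezed between the idealised counts at \<open>t - e / lam\<close> and
  \<open>t + e / lam\<close>; the shift costs \<open>e * n\<close> by the Lipschitz bound. Since
  \<open>e \<le> lam\<close>, a horizon of \<open>T + 1\<close> suffices.\<close>

lemma expired_approx:
  fixes Gam :: "real \<Rightarrow> real"
  assumes mono: "\<And>i j. 1 \<le> i \<Longrightarrow> i < j \<Longrightarrow> a i < a j" and pos: "\<And>i. 1 \<le> i \<Longrightarrow> 0 < u i"
    and Gam: "Gam 0 = 0" "\<And>s t. 0 \<le> s \<Longrightarrow> s \<le> t \<Longrightarrow> Gam s \<le> Gam t \<and> Gam t \<le> Gam s + (t - s)"
    and n: "0 < n" "0 < lam" "0 < e" "e \<le> lam"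
    and E: "\<And>t. t \<in> {0..T} \<Longrightarrow> \<bar>real (E t) - lam * n * t\<bar> \<le> e * n"
    and fin: "\<And>t. finite {i. 1 \<le> i \<and> of_int i / (lam * n) + u i \<le> t}"
    and W: "\<And>t. t \<in> {0..T + 1} \<Longrightarrow>
      \<bar>real (card {i. 1 \<le> i \<and> of_int i / (lam * n) + u i \<le> t}) - n * (lam * Gam t)\<bar> \<le> e * n"
    and t: "t \<in> {0..T}"
  shows "\<bar>real (card {i. 1 \<le> i \<and> u i + a i \<le> t}) - n * (lam * Gam t)\<bar> \<le> 2 * (e * n)"
proof -
  let ?C = "{i. 1 \<le> i \<and> u i + a i \<le> t}"
  let ?W = "\<lambda>t. {i. 1 \<le> i \<and> of_int i / (lam * n) + u i \<le> t}"
  have e1: "0 < e / lam" "e / lam \<le> 1" using n by auto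
  have finC: "finite ?C"
    by (rule finite_subset[OF _ conjunct1[OF arrivals[OF t]]]) (use pos in force)
  have sub1: "?C \<subseteq> ?W (t + e / lam)"
  proof safe
    fix i assume i: "1 \<le> i" "u i + a i \<le> t"
    then have ai: "a i \<in> {0..T}" using pos[of i] arrival_pos[of i] t by auto
    from arrival_index(1)[OF mono i(1) ai] have Ei: "real (E (a i)) = of_int i" by (metis of_int_of_nat_eq)
    have "of_int i \<le> lam * n * a i + e * n" using E[OF ai] unfolding Ei by linarith
    also have "\<dots> = (a i + e / lam) * (lam * n)" using n by (simp add: field_simps)
    finally have "of_int i / (lam * n) \<le> a i + e / lam" using n by (simp add: pos_divide_le_eq)
    then show "of_int i / (lam * n) + u i \<le> t + e / lam" using i by linarith
  qed
  have sub2: "?W (t - e / lam) \<subseteq> ?C"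
  proof safe
    fix i assume i: "1 \<le> i" "of_int i / (lam * n) + u i \<le> t - e / lam"
    define s where "s = of_int i / (lam * n) + e / lam"
    have s: "s \<in> {0..T}" "s + u i \<le> t"
    proof -
      have "0 \<le> of_int i / (lam * n)" using i n by simp
      then show "s \<in> {0..T}" "s + u i \<le> t" using i pos[of i] e1 t by (auto simp: s_def)
    qed
    have "lam * n * s = of_int i + e * n" using n by (simp add: s_def field_simps)
    then have "of_int i \<le> real (E s)" using E[OF s(1)] by linarith
    then have "i \<le> int (E s)" by linarith
    then have "a i \<le> s" using arrival_index(2)[OF mono i(1) s(1)] by simp
    then show "u i + a i \<le> t" using s by linarith
  qed
  have nl: "0 < n * lam" using n by simp
  have eq: "n * lam * (e / lam) = e * n" using n by simp
  have up: "real (card ?C) \<le> n * (lam * Gam t) + 2 * (e * n)"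
  proof -
    have "t + e / lam \<in> {0..T + 1}" using t e1 by auto
    then have "real (card ?C) \<le> n * (lam * Gam (t + e / lam)) + e * n"
      using card_mono[OF fin sub1] W[of "t + e / lam"] by linarith
    moreover have "n * lam * Gam (t + e / lam) \<le> n * lam * (Gam t + e / lam)"
      using Gam(2)[of t "t + e / lam"] e1 t nl by (intro mult_left_mono) auto
    ultimately show ?thesis using eq by (simp add: algebra_simps)
  qed
  have low: "n * (lam * Gam t) - 2 * (e * n) \<le> real (card ?C)"
  proof (cases "0 \<le> t - e / lam")
    case True
    then have "t - e / lam \<in> {0..T + 1}" using t e1 by auto
    then have "n * (lam * Gam (t - e / lam)) - e * n \<le> real (card ?C)"
      using card_mono[OF finC sub2] W[of "t - e / lam"] by linarith
    moreover have "n * lam * Gam t \<le> n * lam * (Gam (t - e / lam) + e / lam)"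
      using Gam(2)[of "t - e / lam" t] e1 True nl by (intro mult_left_mono) auto
    ultimately show ?thesis using eq by (simp add: algebra_simps)
  next
    \<comment> \<open>No idealised count is available at a negative time, but then
      \<open>Gam t \<le> t < e / lam\<close> and the lower bound is nonpositive.\<close>
    case False
    then have "n * lam * Gam t \<le> n * lam * (e / lam)"
      using Gam(2)[of 0 t] Gam(1) t nl by (intro mult_left_mono) auto
    moreover have "0 \<le> e * n" using n by simp
    ultimately show ?thesis using eq by (simp add: algebra_simps)
  qed
  show ?thesis using up low by linarith
qed

text \<open>Among the customers of the initial condition, pending ones are the queued ones not yet
  expired; every new arrival has \<open>0 < b i\<close>, so only its deadline matters.\<close>

lemma card_pending:
  assumes t: "t \<in> {0..T}"
  shows "real (card (pending t)) = real (card (Q 0)) - real (card {i \<in> Q 0. u i + a i \<le> t})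
    + real (E t) - real (card {i. 1 \<le> i \<and> u i + a i \<le> t})"
proof -
  have T0: "0 \<in> {0..T}" using t by auto
  have Q0: "Q 0 \<subseteq> {i. i \<le> 0}"
  proof
    fix i assume "i \<in> Q 0"
    then show "i \<in> {i. i \<le> 0}" using arrival_pos[of i] by (cases "1 \<le> i") (auto simp: queue_set_def)
  qed
  have C: "i \<in> C" if "1 \<le> i" for i using that by (auto simp: customers_def)
  have late: "0 < b i" if "1 \<le> i" for i
  proof (cases "b i = \<infinity>")
    case False
    have "ereal 0 < ereal (a i)" using arrival_pos[OF that] by simp
    also have "\<dots> \<le> b i" using entry[OF C[OF that] False] by simp
    finally show ?thesis by (simp add: zero_ereal_def)
  qed simp
  let ?A = "{i. 1 \<le> i \<and> a i \<le> t}" and ?X = "{i. 1 \<le> i \<and> u i + a i \<le> t}"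
  have eq: "pending t = (Q 0 - {i \<in> Q 0. u i + a i \<le> t}) \<union> (?A - ?X)"
  proof (intro set_eqI)
    fix i
    show "i \<in> pending t \<longleftrightarrow> i \<in> (Q 0 - {i \<in> Q 0. u i + a i \<le> t}) \<union> (?A - ?X)"
    proof (cases "1 \<le> i")
      case True
      then show ?thesis using Q0 C late by (auto simp: pending_def)
    next
      case False
      then show ?thesis using initial[of i] t by (auto simp: pending_def queue_set_def zero_ereal_def)
    qed
  qed
  have XA: "?X \<subseteq> ?A" using lead_pos C by force
  have fA: "finite ?A" "card ?A = E t" using arrivals[OF t] by auto
  have fQ: "finite (Q 0)" by (rule finite_Q[OF T0])
  have "card (pending t) = card (Q 0 - {i \<in> Q 0. u i + a i \<le> t}) + card (?A - ?X)"
    unfolding eq using fA fQ Q0 by (intro card_Un_disjoint) auto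
  also have "card (?A - ?X) = E t - card ?X" using XA fA by (simp add: card_Diff_subset finite_subset)
  also have "card (Q 0 - {i \<in> Q 0. u i + a i \<le> t}) = card (Q 0) - card {i \<in> Q 0. u i + a i \<le> t}"
    using fQ by (intro card_Diff_subset) auto
  moreover have "card ?X \<le> E t" using card_mono[OF fA(1) XA] fA by simp
  moreover have "card {i \<in> Q 0. u i + a i \<le> t} \<le> card (Q 0)" using fQ by (intro card_mono) auto
  ultimately show ?thesis by (simp add: of_nat_diff)
qed

end

lemma scaled_abs_le:
  fixes x y e n :: real
  assumes "0 < n" "\<bar>x / n - y\<bar> \<le> e"
  shows "\<bar>x - n * y\<bar> \<le> e * n"
proof -
  have "x - n * y = (x / n - y) * n" using assms(1) by (simp add: field_simps)
  then have "\<bar>x - n * y\<bar> = \<bar>x / n - y\<bar> * n" using assms(1) by (simp add: abs_mult)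
  then show ?thesis using assms by (simp add: mult_right_mono)
qed

section \<open>From the stochastic model to sample paths\<close>

context edf_queue
begin

lemma arrival_time_mono:
  assumes "\<omega> \<in> space M" "\<And>n. 0 < tau n \<omega>" "1 \<le> i" "i < j"
  shows "a i \<omega> < a j \<omega>"
proof -
  have "(\<Sum>n<nat i. tau n \<omega>) < (\<Sum>n<nat j. tau n \<omega>)"
    by (rule sum_strict_mono2[where b = "nat i"]) (use assms in \<open>auto simp: less_imp_le\<close>)
  then show ?thesis using assms arrival_times[of i] arrival_times[of j] rates by (simp add: divide_strict_right_mono)
qed

lemma arrival_time_pos:
  assumes "\<omega> \<in> space M" "\<And>n. 0 < tau n \<omega>" "1 \<le> i"
  shows "0 < a i \<omega>"
proof -
  have "0 < (\<Sum>n<nat i. tau n \<omega>)" by (rule sum_pos) (use assms in \<open>auto simp: lessThan_empty_iff\<close>)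
  then show ?thesis using assms arrival_times[of i] rates by simp
qed

lemma arrivals_eq:
  assumes "\<omega> \<in> space M"
  shows "{i. 1 \<le> i \<and> a i \<omega> \<le> t} = int ` {k. 1 \<le> k \<and> (\<Sum>j<k. tau j \<omega>) \<le> lam * t}"
proof (intro set_eqI iffI)
  fix i assume i: "i \<in> {i. 1 \<le> i \<and> a i \<omega> \<le> t}"
  then have "(\<Sum>j<nat i. tau j \<omega>) \<le> lam * t"
    using arrival_times[of i] assms rates by (simp add: pos_divide_le_eq mult.commute)
  then show "i \<in> int ` {k. 1 \<le> k \<and> (\<Sum>j<k. tau j \<omega>) \<le> lam * t}"
    using i by (intro image_eqI[of _ _ "nat i"]) auto
next
  fix i assume "i \<in> int ` {k. 1 \<le> k \<and> (\<Sum>j<k. tau j \<omega>) \<le> lam * t}"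
  then show "i \<in> {i. 1 \<le> i \<and> a i \<omega> \<le> t}"
    using arrival_times[of i] assms rates by (auto simp: pos_divide_le_eq mult.commute)
qed

lemma finite_initial_queue:
  assumes "\<omega> \<in> space M" "\<And>n. 0 < tau n \<omega>"
  shows "finite (queue_set x0 (\<lambda>i. a i \<omega>) v w 0)"
proof (rule finite_subset)
  show "queue_set x0 (\<lambda>i. a i \<omega>) v w 0 \<subseteq> {- int x0 + 1..0}"
  proof
    fix i assume "i \<in> queue_set x0 (\<lambda>i. a i \<omega>) v w 0"
    then show "i \<in> {- int x0 + 1..0}"
      using arrival_time_pos[OF assms, of i] by (cases "1 \<le> i") (auto simp: queue_set_def customers_def)
  qed
qed simp

lemma X_rcll: "\<omega> \<in> space M \<Longrightarrow> (\<lambda>t. real (X \<omega> t)) \<in> rcll"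
  using measurable_space[OF random_paths(1)] by (simp add: space_borel_of topspace_skorohod)

lemma queue_length_measurable:
  assumes "1 \<le> N"
  shows "(\<lambda>\<omega> t. real (queue_length (X \<omega>) t) / real N) \<in> M \<rightarrow>\<^sub>M borel_of skorohod"
proof -
  let ?g = "\<lambda>x :: real. max (x - 1) 0 / real N"
  have "dist (?g x) (?g y) \<le> dist x y" for x y
  proof -
    have "\<bar>max (x - 1) 0 - max (y - 1) 0\<bar> / real N \<le> \<bar>max (x - 1) 0 - max (y - 1) 0\<bar> / 1"
      using assms by (intro divide_left_mono) auto
    also have "\<dots> \<le> \<bar>x - y\<bar>" by (simp add: max_def)
    finally show ?thesis by (simp add: dist_real_def abs_divide diff_divide_distrib[symmetric])
  qed
  from measurable_compose[OF random_paths(1) continuous_map_measurable_borel_of[OF skorohod_compose[OF this]]]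
  have "(\<lambda>\<omega> t. ?g (real (X \<omega> t))) \<in> M \<rightarrow>\<^sub>M borel_of skorohod" .
  moreover have "?g (real k) = real (k - 1) / real N" for k by (cases k) auto
  ultimately show ?thesis by (simp add: queue_length_def)
qed

end

theorem theorem3:
  fixes M :: "'a measure"
    and lamN muN :: "nat \<Rightarrow> real"
    and tau sigma :: "nat \<Rightarrow> 'a \<Rightarrow> real"
    and nuN :: "nat \<Rightarrow> real measure"
    and a u :: "nat \<Rightarrow> int \<Rightarrow> 'a \<Rightarrow> real"
    and b :: "nat \<Rightarrow> int \<Rightarrow> 'a \<Rightarrow> ereal"
    and X R :: "nat \<Rightarrow> 'a \<Rightarrow> real \<Rightarrow> nat"
    and lam mu F0 :: real
    and nu Q0 :: "real measure"
  assumes model: "\<And>N. 1 \<le> N \<Longrightarrow>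
      edf_queue M (lamN N) (muN N) tau sigma (nuN N) (a N) (u N) (b N) (X N) (R N)"
    and "(\<lambda>N. lamN N / real N) \<longlonglongrightarrow> lam" "0 < lam"
    and "(\<lambda>N. muN N / real N) \<longlonglongrightarrow> mu" "0 < mu"
    and "real_distribution nu"
    and "weak_conv_m (\<lambda>N. distr M borel (u N 1)) nu"
    and "strict_mono_on {x. 0 < x \<and> ereal x < y_max (cdf nu)} (cdf nu)"
    and "isCont (cdf nu) 0" "cdf nu 0 = 0"
    and "Q0 \<in> finite_nn_measures"
    and "0 \<le> F0" "ereal F0 \<le> y_star lam mu (cdf nu)"
    and "measure Q0 {0..F0} = 0"
    and "continuous_on {0..} (\<lambda>x. measure Q0 {0..x})"
    and "\<And>x. F0 < x \<Longrightarrow> 0 < measure Q0 {0..x}"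
    and "converges_in_distribution M (prod_topology weak_topology euclideanreal)
      (\<lambda>N \<omega>. (scale_measure (ennreal (1 / real N))
                (queue_measure (X N \<omega> 0) (\<lambda>i. a N i \<omega>) (\<lambda>i. u N i \<omega>) (\<lambda>i. b N i \<omega>) 0),
              head_lead_time (X N \<omega> 0) (\<lambda>i. a N i \<omega>) (\<lambda>i. u N i \<omega>) (\<lambda>i. b N i \<omega>) 0))
      (\<lambda>_. (Q0, F0))"
    and "lam < mu"
  shows "converges_in_distribution M skorohod
      (\<lambda>N \<omega> t. real (queue_length (X N \<omega>) t) / real N)
      (\<lambda>_. fluid_limit lam mu (cdf nu) Q0)"
proof -
  note lamN = assms(2) and lam = assms(3) and muN = assms(4) and mu = assms(5) and nu = assms(6)
    and weak = assms(7) and G0 = assms(9,10) and Q0 = assms(11) and Q0_zero = assms(14)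
    and Q0_cont = assms(15) and conv = assms(17) and lam_less = assms(18)
  let ?G = "cdf nu"
  let ?E = "\<lambda>N \<omega> t. renewal_count (\<lambda>n. tau n \<omega>) (lamN N * t)"
  let ?S = "\<lambda>N \<omega> t. renewal_count (\<lambda>n. sigma n \<omega>) (muN N * t)"
  interpret prob_space M using model[of 1] by (simp add: edf_queue_def)
  have tau: "renewal_intervals tau" and sigma: "renewal_intervals sigma"
    using edf_queue.arrival_renewal[OF model, of 1] edf_queue.service_renewal[OF model, of 1] by auto
  define good where "good N \<omega> \<longleftrightarrow> (\<forall>j. 0 < tau j \<omega>) \<and>
    edf_path (?E N \<omega>) (?S N \<omega>) (\<lambda>i. a N i \<omega>) (\<lambda>i. u N i \<omega>) (\<lambda>i. b N i \<omega>) (X N \<omega>) (R N \<omega>)" for N \<omega>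
  have good: "whp good"
  proof (rule whp_AE)
    have "AE \<omega> in M. \<forall>j. 0 < tau j \<omega>"
      using tau by (subst AE_all_countable) (simp add: renewal_intervals_def)
    then have "AE \<omega> in M. good N \<omega>" if "1 \<le> N" for N
      using edf_queue.dynamics[OF model[OF that]] by eventually_elim (simp add: good_def)
    then show "\<forall>\<^sub>F N in sequentially. AE \<omega> in M. good N \<omega>"
      by (rule eventually_mono[OF eventually_ge_at_top[of 1]])
  qed
  have u_pos: "0 < u N i \<omega>" if "good N \<omega>" "1 \<le> i" for N \<omega> i
  proof -
    have "\<forall>i\<in>customers (X N \<omega> 0). 0 < u N i \<omega> \<and> (i \<le> 0 \<longrightarrow> a N i \<omega> \<le> 0)"
      using that(1) unfolding good_def edf_path_def by (elim conjE)
    moreover have "i \<in> customers (X N \<omega> 0)" using that(2) by (simp add: customers_def)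
    ultimately show ?thesis by blast
  qed
  have u_meas: "u N i \<in> borel_measurable M" if "1 \<le> N" for N i
    using edf_queue.random_variables(2)[OF model[OF that]] .
  \<comment> \<open>Nothing is assumed at index 0, yet \<open>lead_times\<close> wants a probability
    law at every index.\<close>
  define nuN' where "nuN' N = distr M borel (u (max 1 N) 1)" for N
  interpret lt: lead_times M u nuN' nu
  proof (intro lead_times.intro lead_times_axioms.intro prob_space_axioms)
    show "indep_vars (\<lambda>_. borel) (u N) {1..}" if "1 \<le> N" for N
      using edf_queue.lead_times_indep[OF model[OF that]] .
    show "distr M borel (u N i) = nuN' N" if "1 \<le> N" "1 \<le> i" for N i
      using edf_queue.lead_times_law[OF model[OF that(1)], of i] edf_queue.lead_times_law[OF model[OF that(1)], of 1] that
      by (simp add: nuN'_def max_def)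
    show "whp (\<lambda>N \<omega>. \<forall>i\<ge>1. 0 < u N i \<omega>)" by (rule whp_mono[OF good]) (simp add: u_pos)
    show "real_distribution (nuN' N)" for N
      unfolding nuN'_def by (intro real_distribution_distr u_meas) simp
    show "weak_conv_m nuN' nu"
      unfolding weak_conv_m_def weak_conv_def
    proof (intro allI impI)
      fix x assume "isCont (cdf nu) x"
      then have "(\<lambda>N. cdf (distr M borel (u N 1)) x) \<longlonglongrightarrow> cdf nu x"
        using weak by (auto simp: weak_conv_m_def weak_conv_def)
      moreover have "\<forall>\<^sub>F N in sequentially. cdf (distr M borel (u N 1)) x = cdf (nuN' N) x"
        using eventually_ge_at_top[of 1] by eventually_elim (simp add: nuN'_def max_def)
      ultimately show "(\<lambda>N. cdf (nuN' N) x) \<longlonglongrightarrow> cdf nu x" by (rule Lim_transform_eventually)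
    qed
  qed (rule nu)
  interpret iq: initial_queue M "\<lambda>N \<omega>. X N \<omega> 0" "\<lambda>N \<omega> i. a N i \<omega>" "\<lambda>N \<omega> i. u N i \<omega>" "\<lambda>N \<omega> i. b N i \<omega>"
    "\<lambda>N \<omega>. head_lead_time (X N \<omega> 0) (\<lambda>i. a N i \<omega>) (\<lambda>i. u N i \<omega>) (\<lambda>i. b N i \<omega>) 0" Q0 F0
  proof unfold_locales
    show "whp (\<lambda>N \<omega>. finite (queue_set (X N \<omega> 0) (\<lambda>i. a N i \<omega>) (\<lambda>i. u N i \<omega>) (\<lambda>i. b N i \<omega>) 0))"
    proof (rule whp_mono[OF good])
      show "\<forall>\<^sub>F N in sequentially. \<forall>\<omega>\<in>space M. good N \<omega> \<longrightarrow>
          finite (queue_set (X N \<omega> 0) (\<lambda>i. a N i \<omega>) (\<lambda>i. u N i \<omega>) (\<lambda>i. b N i \<omega>) 0)"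
        using eventually_ge_at_top[of 1]
        by eventually_elim (auto simp: good_def intro!: edf_queue.finite_initial_queue[OF model])
    qed
  qed (use conv Q0 in auto)
  have Q0_0: "measure Q0 {0..0} = 0"
  proof -
    interpret finite_measure Q0 by (rule iq.finite_Q0)
    have "measure Q0 {0..0} \<le> measure Q0 {0..F0}"
      using assms(12) by (intro finite_measure_mono iq.in_sets_Q0) auto
    then show ?thesis using Q0_zero by (simp add: measure_le_0_iff)
  qed
  note fluid = lam_less lt.mono_cdf(1) Q0 Q0_cont Q0_0
  show ?thesis
  proof (rule converges_in_distribution_skorohod_constI)
    show "\<forall>\<^sub>F N in sequentially. (\<lambda>\<omega> t. real (queue_length (X N \<omega>) t) / real N) \<in> M \<rightarrow>\<^sub>M borel_of skorohod"
      using eventually_ge_at_top[of 1]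
      by eventually_elim (rule edf_queue.queue_length_measurable[OF model])
    show "fluid_limit lam mu ?G Q0 \<in> rcll"
      by (rule continuous_on_imp_rcll[OF continuous_on_fluid_limit[OF fluid]])

    \<comment> \<open>Choice of constants and the event of high probability\<close>
    fix T' e :: real assume e: "0 < e"
    define T where "T = max T' 0"
    \<comment> \<open>At most \<open>lam * N * T + eps * N\<close> customers arrive by
      \<open>T\<close>, and \<open>eps \<le> 1\<close>.\<close>
    define K where "K = lam * T + 1"
    have T: "0 \<le> T" "T' \<le> T" by (auto simp: T_def)
    have K: "0 < K" using lam T by (simp add: K_def add_nonneg_pos)
    define eta where "eta = e / 4"
    have eta: "0 < eta" using e by (simp add: eta_def)
    from lt.whp_few_short_lead_times[OF K G0 eta] obtain d where d: "0 < d"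
      and few: "whp (\<lambda>N \<omega>. real (card {i \<in> {1..int (nat \<lfloor>K * real N\<rfloor>)}. u N i \<omega> \<le> d}) \<le> eta * real N)" .
    \<comment> \<open>The bound 1 serves \<open>K\<close>, \<open>lam\<close> serves
      \<open>expired_approx\<close>, \<open>d * (mu - lam) / 5\<close> turns
      \<open>(mu - lam) * u \<le> 5 * eps\<close> into \<open>u \<le> d\<close>, and
      \<open>e / 56\<close> makes \<open>14 * eps \<le> e / 4\<close>.\<close>
    define eps where "eps = min (min 1 lam) (min (d * (mu - lam) / 5) (e / 56))"
    have eps: "0 < eps" "eps \<le> 1" "eps \<le> lam" "eps \<le> d * (mu - lam) / 5" "eps \<le> e / 56"
      using lam lam_less d e by (auto simp: eps_def)
    \<comment> \<open>Five errors enter the estimate \<open>H\<close>: initial size, initial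
      deadlines, arrivals, and two from \<open>expired_approx\<close>.\<close>
    define eps1 where "eps1 = eps / 5"
    have eps1: "0 < eps1" "eps1 \<le> lam" "eps1 \<le> eps" using eps lam by (auto simp: eps1_def)
    have "whp (\<lambda>N \<omega>. good N \<omega> \<and>
      (\<forall>t\<in>{0..T}. finite {k. 1 \<le> k \<and> (\<Sum>j<k. tau j \<omega>) \<le> lamN N * t} \<and>
        \<bar>real (?E N \<omega> t) - lam * real N * t\<bar> \<le> eps1 * real N) \<and>
      (\<forall>t\<in>{0..T}. finite {k. 1 \<le> k \<and> (\<Sum>j<k. sigma j \<omega>) \<le> muN N * t} \<and>
        \<bar>real (?S N \<omega> t) - mu * real N * t\<bar> \<le> eps1 * real N) \<and>
      (\<forall>t\<in>{0..T + 1}. \<bar>real (lt.deadline_count lam N \<omega> t) / real N - lam * lt.Gamma t\<bar> \<le> eps1) \<and>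
      real (card {i \<in> {1..int (nat \<lfloor>K * real N\<rfloor>)}. u N i \<omega> \<le> d}) \<le> eta * real N \<and>
      (finite (iq.Q N \<omega>) \<and> \<bar>real (card (iq.Q N \<omega>)) / real N - measure Q0 {0..}\<bar> \<le> eps1) \<and>
      (\<forall>t\<in>{0..T}. \<bar>real (card {i \<in> iq.Q N \<omega>. u N i \<omega> + a N i \<omega> \<le> t}) / real N - measure Q0 {0..t}\<bar> \<le> eps1))"
      by (intro whp_conj good few whp_renewal_count_uniform[OF tau lamN lam eps1(1)]
          whp_renewal_count_uniform[OF sigma muN mu eps1(1)] lt.whp_deadline_count_uniform[OF lam eps1(1)]
          iq.whp_initial_size[OF eps1(1)] iq.whp_initial_deadline_count_uniform[OF Q0_cont Q0_0 eps1(1)])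
    then show "whp (\<lambda>N \<omega>. \<forall>t\<in>{0..T'}. dist (real (queue_length (X N \<omega>) t) / real N) (fluid_limit lam mu ?G Q0 t) < e)"
    proof (rule whp_mono, use eventually_ge_at_top[of 1] eventually_real_gt[of "1 / eps"] in eventually_elim)
      case (elim N)
      show ?case
      proof (intro ballI impI, elim conjE)
        fix \<omega> t assume w: "\<omega> \<in> space M" and t: "t \<in> {0..T'}" and g: "good N \<omega>"
          and E: "\<forall>t\<in>{0..T}. finite {k. 1 \<le> k \<and> (\<Sum>j<k. tau j \<omega>) \<le> lamN N * t} \<and>
            \<bar>real (?E N \<omega> t) - lam * real N * t\<bar> \<le> eps1 * real N"
          and S: "\<forall>t\<in>{0..T}. finite {k. 1 \<le> k \<and> (\<Sum>j<k. sigma j \<omega>) \<le> muN N * t} \<and>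
            \<bar>real (?S N \<omega> t) - mu * real N * t\<bar> \<le> eps1 * real N"
          and W: "\<forall>t\<in>{0..T + 1}. \<bar>real (lt.deadline_count lam N \<omega> t) / real N - lam * lt.Gamma t\<bar> \<le> eps1"
          and few: "real (card {i \<in> {1..int (nat \<lfloor>K * real N\<rfloor>)}. u N i \<omega> \<le> d}) \<le> eta * real N"
          and size: "\<bar>real (card (iq.Q N \<omega>)) / real N - measure Q0 {0..}\<bar> \<le> eps1"
          and init: "\<forall>t\<in>{0..T}. \<bar>real (card {i \<in> iq.Q N \<omega>. u N i \<omega> + a N i \<omega> \<le> t}) / real N - measure Q0 {0..t}\<bar> \<le> eps1"

        \<comment> \<open>Deterministic comparison on one sample path\<close>
        have N: "0 < real N" using elim by simp
        have tau_pos: "0 < tau j \<omega>" for j using g by (simp add: good_def)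
        have up: "0 < u N i \<omega>" if "1 \<le> i" for i using u_pos[OF g that] .
        note queue = model[OF elim(1)]
        have eN: "eps1 * real N \<le> eps * real N" using eps1 N by (intro mult_right_mono) auto
        have eN5: "eps * real N = 5 * (eps1 * real N)" by (simp add: eps1_def)
        interpret p: edf_sample_rates "?E N \<omega>" "?S N \<omega>" "\<lambda>i. a N i \<omega>" "\<lambda>i. u N i \<omega>" "\<lambda>i. b N i \<omega>"
          "X N \<omega>" "R N \<omega>" T lam mu eps "real N"
        proof unfold_locales
          show "edf_path (?E N \<omega>) (?S N \<omega>) (\<lambda>i. a N i \<omega>) (\<lambda>i. u N i \<omega>) (\<lambda>i. b N i \<omega>) (X N \<omega>) (R N \<omega>)"
            using g by (simp add: good_def)
          show "(\<lambda>t. real (X N \<omega> t)) \<in> rcll" by (rule edf_queue.X_rcll[OF queue w])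
          show "finite {i. 1 \<le> i \<and> a N i \<omega> \<le> t} \<and> card {i. 1 \<le> i \<and> a N i \<omega> \<le> t} = ?E N \<omega> t"
            if "t \<in> {0..T}" for t
            using E that unfolding edf_queue.arrivals_eq[OF queue w]
            by (auto simp: card_image renewal_count_def)
          show "0 < a N i \<omega>" if "1 \<le> i" for i by (rule edf_queue.arrival_time_pos[OF queue w tau_pos that])
          show "\<bar>real (?E N \<omega> t) - lam * real N * t\<bar> \<le> eps * real N"
            "\<bar>real (?S N \<omega> t) - mu * real N * t\<bar> \<le> eps * real N" if "t \<in> {0..T}" for t
            using order_trans[OF _ eN] E S that by blast+
          show "1 \<le> eps * real N" using elim(2) eps by (simp add: field_simps)
        qed (use lam lam_less N in auto)
        have a_mono: "a N i \<omega> < a N j \<omega>" if "1 \<le> i" "i < j" for i j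
          by (rule edf_queue.arrival_time_mono[OF queue w tau_pos that])
        have finW: "finite {i. 1 \<le> i \<and> of_int i / (lam * real N) + u N i \<omega> \<le> t}" for t
          using up by (intro lt.finite_deadlines[OF lam elim(1)]) blast
        have expired: "\<bar>real (card {i. 1 \<le> i \<and> u N i \<omega> + a N i \<omega> \<le> t}) - real N * (lam * lt.Gamma t)\<bar> \<le> 2 * (eps1 * real N)"
          if "t \<in> {0..T}" for t
        proof (rule p.expired_approx[OF a_mono up _ lt.Gamma_lipschitz N lam eps1(1,2) _ finW _ that])
          show "lt.Gamma 0 = 0" by (simp add: lt.Gamma_def)
          show "\<bar>real (?E N \<omega> t) - lam * real N * t\<bar> \<le> eps1 * real N" if "t \<in> {0..T}" for t
            using E that by blast
          show "\<bar>real (card {i. 1 \<le> i \<and> of_int i / (lam * real N) + u N i \<omega> \<le> t}) - real N * (lam * lt.Gamma t)\<bar> \<le> eps1 * real N"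
            if "t \<in> {0..T + 1}" for t
            using scaled_abs_le[OF N, of _ "lam * lt.Gamma t" eps1] W that unfolding lt.deadline_count_def by blast
        qed
        have size': "\<bar>real (card (iq.Q N \<omega>)) - real N * measure Q0 {0..}\<bar> \<le> eps1 * real N"
          by (rule scaled_abs_le[OF N size])
        have H: "\<bar>real (card (p.pending t)) - real N * fluid_H lam ?G Q0 0 t\<bar> \<le> eps * real N" if t: "t \<in> {0..T}" for t
        proof -
          have "real N * fluid_H lam ?G Q0 0 t = real N * measure Q0 {0..} - real N * measure Q0 {0..t}
              + lam * real N * t - real N * (lam * lt.Gamma t)"
            using t by (subst fluid_H_eq[OF fluid]) (auto simp: lt.Gamma_def algebra_simps)
          moreover have "\<bar>real (card {i \<in> iq.Q N \<omega>. u N i \<omega> + a N i \<omega> \<le> t}) - real N * measure Q0 {0..t}\<bar> \<le> eps1 * real N"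
            using init t by (intro scaled_abs_le[OF N]) blast
          moreover have "\<bar>real (?E N \<omega> t) - lam * real N * t\<bar> \<le> eps1 * real N" using E t by blast
          ultimately show ?thesis
            using p.card_pending[OF t] expired[OF t] size' eN5 by linarith
        qed
        have psi: "\<bar>real (X N \<omega> 0) + real (?E N \<omega> t) - real (?S N \<omega> t) - real N * fluid_psi lam mu Q0 t\<bar> \<le> 4 * eps * real N"
          if t: "t \<in> {0..T}" for t
        proof -
          \<comment> \<open>The initial number in system and the initial queue differ by at most
            one; with initial size, arrivals and completions this makes the factor 4.\<close>
          have "card (iq.Q N \<omega>) = X N \<omega> 0 - 1" using p.card_Q[of 0] T by (simp add: queue_length_def)
          then have "\<bar>real (X N \<omega> 0) - real (card (iq.Q N \<omega>))\<bar> \<le> eps * real N" using p.rates(4) by simp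
          moreover have "real N * fluid_psi lam mu Q0 t = real N * measure Q0 {0..} + lam * real N * t - mu * real N * t"
            by (simp add: fluid_psi_def algebra_simps)
          ultimately show ?thesis using p.E_approx[OF t] p.S_approx[OF t] size' eN by linarith
        qed
        have small: "real (card {i. 1 \<le> i \<and> a N i \<omega> \<le> T \<and> (mu - lam) * u N i \<omega> \<le> 5 * eps}) \<le> eta * real N"
        proof -
          have "{i. 1 \<le> i \<and> a N i \<omega> \<le> T \<and> (mu - lam) * u N i \<omega> \<le> 5 * eps}
              \<subseteq> {i \<in> {1..int (nat \<lfloor>K * real N\<rfloor>)}. u N i \<omega> \<le> d}"
          proof safe
            fix i assume i: "1 \<le> i" "a N i \<omega> \<le> T" "(mu - lam) * u N i \<omega> \<le> 5 * eps"
            have TT: "T \<in> {0..T}" using T by simp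
            have "i \<le> int (?E N \<omega> T)" using p.arrival_index(2)[OF a_mono i(1) TT] i(2) by simp
            then have "of_int i \<le> real (?E N \<omega> T)" by linarith
            also have "\<dots> \<le> lam * real N * T + eps * real N" using p.E_approx[OF TT] by linarith
            also have "\<dots> \<le> K * real N" using eps N by (simp add: K_def algebra_simps)
            finally show "i \<in> {1..int (nat \<lfloor>K * real N\<rfloor>)}" using i(1) by (simp add: le_floor_iff)
            have "(mu - lam) * u N i \<omega> \<le> (mu - lam) * d" using i(3) eps(4) by (simp add: mult.commute)
            then show "u N i \<omega> \<le> d" using lam_less by simp
          qed
          then have "card {i. 1 \<le> i \<and> a N i \<omega> \<le> T \<and> (mu - lam) * u N i \<omega> \<le> 5 * eps}
              \<le> card {i \<in> {1..int (nat \<lfloor>K * real N\<rfloor>)}. u N i \<omega> \<le> d}"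
            by (rule card_mono[rotated]) (rule finite_subset[of _ "{1..int (nat \<lfloor>K * real N\<rfloor>)}"], simp_all add: subset_eq)
          then show ?thesis using few by linarith
        qed
        have tT: "t \<in> {0..T}" using t T by auto
        have "\<bar>real (queue_length (X N \<omega>) t) / real N - max (fluid_phi lam mu ?G Q0 t) 0\<bar> \<le> 14 * eps + eta"
          unfolding fluid_phi_def
          by (rule p.queue_approx[OF continuous_on_fluid_psi[OF fluid] continuous_on_fluid_H[OF fluid]
                fluid_psi_antimono[OF fluid] psi H small tT])
        moreover have "14 * eps + eta < e" using eps(5) e by (simp add: eta_def)
        ultimately show "dist (real (queue_length (X N \<omega>) t) / real N) (fluid_limit lam mu ?G Q0 t) < e"
          using fluid_limit_eq[OF fluid, of t] t by (simp add: dist_real_def)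
      qed
    qed
  qed
qed

end
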